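(* Let $p\in[1,\infty)$ and suppose Assumptions 1 and 2 (with this $p$) hold. Then for every $\tau>0$ there is a constant $\eta_\tau>0$ such that for all $v\in W^{1,p}_{0,+}(0,\tau;V):=\{v\in W^{1,p}(0,\tau;V): v(t)\in V_+\text{ for a.e. }t,\ v(0)=0\}$, $$\Big\|\Gamma\int_0^{t}T_{-1}(t-s)Bv(s)\,\mathrm ds\Big\|_{L^p(0,\tau;V)}\le \eta_\tau\|v\|_{L^p(0,\tau;V)},$$ where for such $v$ the integral $\int_0^tT_{-1}(t-s)Bv(s)\,\mathrm ds$ belongs to $D(\tilde A)$ for each $t\in[0,\tau]$, and the norm on the left is taken with respect to $t\in(0,\tau)$. Moreover, if $p>1$ then $\eta_\tau$ can be chosen with $\lim_{\tau\to0}\eta_\tau=0$.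
   Context: Standing setting. $X$ and $V$ are real Banach lattices with positive cones $X_+$, $V_+$; an operator is positive if it maps positive elements to positive elements. $\tilde A:D(\tilde A)\subset X\to X$ is a closed, densely defined linear operator; $D(\tilde A)$ carries the graph norm, and $G,\Gamma:D(\tilde A)\to V$ are bounded linear operators. Assumption 1: (i) $A:=\tilde A|_{\ker G}$, with $D(A)=\ker G$, generates a $C_0$-semigroup $T=(T(t))_{t\ge0}$ on $X$, and $T$ is positive; (ii) $G$ is surjective. Under Assumption 1, for $\lambda\in\rho(A)$ the Dirichlet operator $D_\lambda:=(G|_{\ker(\lambda I-\tilde A)})^{-1}:V\to X$ exists and is bounded. $\omega_0(T)$ denotes the growth bound of $T$. $X_{-1}^A$ is the extrapolation space of $A$, $A_{-1}$ the extension of $A$ with domain $X$ generating the extrapolated semigroup $T_{-1}$ on $X_{-1}^A$, and $B:=(\lambda I-A_{-1})D_\lambda\in\mathcal L(V,X_{-1}^A)$, independent of $\lambda\in\rho(A)$. Assumption 2 (for a given $p\in[1,\infty)$): (i) $D_\lambda$ is positive for all sufficiently large real $\lambda$; (ii) $\Gamma$ is positive (i.e. $\Gamma(D(\tilde A)\cap X_+)\subset V_+$) and for some $\alpha>0$ there is $\gamma_\alpha>0$ with $\int_0^\alpha\|\Gamma T(t)x\|_V^p\,\mathrm dt\le\gamma_\alpha^p\|x\|_X^p$ for all $x\in D(A)\cap X_+$; (iii) there is $\lambda_0>\omega_0(T)$ with $\sup_{\lambda\ge\lambda_0}\|\lambda D_\lambda v\|_X<\infty$ for every $v\in V$; (iv)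 for all $v\in V$ and $u^*\in V'$, $\lim_{\mathbb R\ni\lambda\to+\infty}\langle\Gamma D_\lambda v,u^*\rangle_{V,V'}=0$. *)

theory Defs
  imports "HOL-Analysis.Analysis"
begin

definition lat_abs :: "'a::{lattice,ab_group_add} \<Rightarrow> 'a" where
  "lat_abs x = sup x (- x)"

definition banach_lattice :: "('a::{banach,ordered_real_vector,lattice}) itself \<Rightarrow> bool" where
  "banach_lattice _ \<longleftrightarrow> (\<forall>x y::'a. lat_abs x \<le> lat_abs y \<longrightarrow> norm x \<le> norm y)"

definition linear_on_dom :: "'a::real_vector set \<Rightarrow> ('a \<Rightarrow> 'b::real_vector) \<Rightarrow> bool" where
  "linear_on_dom D f \<longleftrightarrow>
     (\<forall>x\<in>D. \<forall>y\<in>D. f (x + y) = f x + f y) \<and> (\<forall>c. \<forall>x\<in>D. f (c *\<^sub>R x) = c *\<^sub>R f x)"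

definition lin_subspace :: "'a::real_vector set \<Rightarrow> bool" where
  "lin_subspace D \<longleftrightarrow> 0 \<in> D \<and> (\<forall>x\<in>D. \<forall>y\<in>D. x + y \<in> D) \<and> (\<forall>c. \<forall>x\<in>D. c *\<^sub>R x \<in> D)"

definition closed_operator :: "'a::real_normed_vector set \<Rightarrow> ('a \<Rightarrow> 'a) \<Rightarrow> bool" where
  "closed_operator D f \<longleftrightarrow> lin_subspace D \<and> linear_on_dom D f \<and> closed {(x, f x) | x. x \<in> D}"

definition densely_defined :: "'a::real_normed_vector set \<Rightarrow> bool" where
  "densely_defined D \<longleftrightarrow> closure D = UNIV"

definition graph_bounded ::
  "'a::real_normed_vector set \<Rightarrow> ('a \<Rightarrow> 'a) \<Rightarrow> ('a \<Rightarrow> 'b::real_normed_vector) \<Rightarrow> bool" where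
  "graph_bounded D At G \<longleftrightarrow> linear_on_dom D G \<and>
     (\<exists>C. \<forall>x\<in>D. norm (G x) \<le> C * (norm x + norm (At x)))"

definition C0_semigroup :: "(real \<Rightarrow> 'a::banach \<Rightarrow> 'a) \<Rightarrow> bool" where
  "C0_semigroup T \<longleftrightarrow> (\<forall>t\<ge>0. bounded_linear (T t)) \<and> (\<forall>x. T 0 x = x) \<and>
     (\<forall>s\<ge>0. \<forall>t\<ge>0. \<forall>x. T (s + t) x = T s (T t x)) \<and>
     (\<forall>x. ((\<lambda>t. T t x) \<longlongrightarrow> x) (at_right 0))"

definition generator :: "(real \<Rightarrow> 'a::banach \<Rightarrow> 'a) \<Rightarrow> 'a set \<Rightarrow> ('a \<Rightarrow> 'a) \<Rightarrow> bool" where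
  "generator T D A \<longleftrightarrow>
     (\<forall>x. x \<in> D \<longleftrightarrow> (\<exists>y. ((\<lambda>h. (1 / h) *\<^sub>R (T h x - x)) \<longlongrightarrow> y) (at_right 0))) \<and>
     (\<forall>x\<in>D. ((\<lambda>h. (1 / h) *\<^sub>R (T h x - x)) \<longlongrightarrow> A x) (at_right 0))"

definition generates :: "'a::banach set \<Rightarrow> ('a \<Rightarrow> 'a) \<Rightarrow> (real \<Rightarrow> 'a \<Rightarrow> 'a) \<Rightarrow> bool" where
  "generates D A T \<longleftrightarrow> C0_semigroup T \<and> generator T D A"

definition positive_semigroup :: "(real \<Rightarrow> 'a::{banach,ordered_real_vector} \<Rightarrow> 'a) \<Rightarrow> bool" where
  "positive_semigroup T \<longleftrightarrow> (\<forall>t\<ge>0. \<forall>x. 0 \<le> x \<longrightarrow> 0 \<le> T t x)"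

definition above_growth_bound :: "(real \<Rightarrow> 'a::banach \<Rightarrow> 'a) \<Rightarrow> real \<Rightarrow> bool" where
  "above_growth_bound T lam \<longleftrightarrow> (\<exists>w<lam. \<exists>M. \<forall>t\<ge>0. onorm (T t) \<le> M * exp (w * t))"

text \<open>Resolvent set (real spectral parameter, since the spaces are real).\<close>
definition resolvent_set :: "'a::real_normed_vector set \<Rightarrow> ('a \<Rightarrow> 'a) \<Rightarrow> real set" where
  "resolvent_set D A = {lam. bij_betw (\<lambda>x. lam *\<^sub>R x - A x) D UNIV \<and>
                             bounded_linear (inv_into D (\<lambda>x. lam *\<^sub>R x - A x))}"

definition dirichlet_op ::
  "'a::real_vector set \<Rightarrow> ('a \<Rightarrow> 'a) \<Rightarrow> ('a \<Rightarrow> 'b) \<Rightarrow> real \<Rightarrow> 'b \<Rightarrow> 'a" where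
  "dirichlet_op DAt At G lam v = (THE x. x \<in> DAt \<and> At x = lam *\<^sub>R x \<and> G x = v)"

definition strongly_measurable_on :: "real set \<Rightarrow> (real \<Rightarrow> 'a::real_normed_vector) \<Rightarrow> bool" where
  "strongly_measurable_on S f \<longleftrightarrow>
     (\<exists>s::nat \<Rightarrow> real \<Rightarrow> 'a. (\<forall>n. simple_function (restrict_space lborel S) (s n)) \<and>
        (AE t in lborel. t \<in> S \<longrightarrow> (\<lambda>n. s n t) \<longlonglongrightarrow> f t))"

definition Lp_on :: "real \<Rightarrow> real set \<Rightarrow> (real \<Rightarrow> 'a::real_normed_vector) \<Rightarrow> bool" where
  "Lp_on p S f \<longleftrightarrow> strongly_measurable_on S f \<and>
     (\<integral>\<^sup>+ t\<in>S. ennreal (norm (f t) powr p) \<partial>lborel) < \<infinity>"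

definition test_function :: "real \<Rightarrow> (real \<Rightarrow> real) \<Rightarrow> bool" where
  "test_function tau \<phi> \<longleftrightarrow>
     (\<forall>k x. ((deriv ^^ k) \<phi> has_real_derivative (deriv ^^ Suc k) \<phi> x) (at x)) \<and>
     (\<exists>a b. 0 < a \<and> b < tau \<and> (\<forall>t. t \<notin> {a..b} \<longrightarrow> \<phi> t = 0))"

text \<open>W^{1,p}_{0,+}(0,tau;V): v in L^p with weak derivative in L^p, positive a.e.,
  v(0) = 0. The function v is taken to be the continuous representative on [0,tau].\<close>
definition W1p0_pos :: "real \<Rightarrow> real \<Rightarrow> (real \<Rightarrow> 'a::{banach,ordered_real_vector}) \<Rightarrow> bool" where
  "W1p0_pos p tau v \<longleftrightarrow>
     continuous_on {0..tau} v \<and> v 0 = 0 \<and> Lp_on p {0..tau} v \<and>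
     (\<exists>g. Lp_on p {0..tau} g \<and>
        (\<forall>\<phi>. test_function tau \<phi> \<longrightarrow>
           integral {0..tau} (\<lambda>t. deriv \<phi> t *\<^sub>R v t) = - integral {0..tau} (\<lambda>t. \<phi> t *\<^sub>R g t))) \<and>
     (AE t in lborel. t \<in> {0<..<tau} \<longrightarrow> 0 \<le> v t)"

text \<open>For lam in the resolvent set, (lam I - A_{-1}) is an isomorphism of X onto X_{-1}
  with T_{-1}(s) (lam I - A_{-1}) = (lam I - A_{-1}) T(s) and B = (lam I - A_{-1}) D_lam. Hence
  int_0^t T_{-1}(t-s) B v(s) ds = (lam I - A_{-1}) y(t) with
  y(t) = int_0^t T(t-s) D_lam v(s) ds in X.  This element of X_{-1} lies in X iff y(t) is in D(A),
  and then equals lam y(t) - A y(t).\<close>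
definition conv_pre :: "(real \<Rightarrow> 'a::banach \<Rightarrow> 'a) \<Rightarrow> ('b \<Rightarrow> 'a) \<Rightarrow> (real \<Rightarrow> 'b) \<Rightarrow> real \<Rightarrow> 'a" where
  "conv_pre T Dl v t = integral {0..t} (\<lambda>s. T (t - s) (Dl (v s)))"

definition extrap_conv ::
  "(real \<Rightarrow> 'a::banach \<Rightarrow> 'a) \<Rightarrow> ('a \<Rightarrow> 'a) \<Rightarrow> real \<Rightarrow> ('b \<Rightarrow> 'a) \<Rightarrow> (real \<Rightarrow> 'b) \<Rightarrow> real \<Rightarrow> 'a" where
  "extrap_conv T A lam Dl v t = lam *\<^sub>R conv_pre T Dl v t - A (conv_pre T Dl v t)"

end

theory Submission
  imports Defs "HOL-Real_Asymp.Real_Asymp"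
begin

text \<open>The element \<open>z(t) = \<integral>\<^sub>0\<^sup>t T\<^sub>-\<^sub>1(t - s) B v(s) ds\<close> is approximated by convolutions with positive elements of
  \<open>D(A)\<close>. For large \<open>n\<close> put \<open>x\<^sub>n(s) = 2 n (D\<^sub>n - D\<^sub>2\<^sub>n) v(s) = 2 n\<^sup>2 R(2 n, A) D\<^sub>n v(s)\<close>. By the second expression it is
  positive and in \<open>D(A)\<close>; by the first and the closed graph theorem its norm is at most \<open>3 C \<parallel>v(s)\<parallel>\<close>. Jensen's
  inequality, Tonelli's theorem and the admissibility of \<open>\<Gamma>\<close> on positive elements bound the \<open>L\<^sup>p\<close> norm of
  \<open>\<Gamma> \<integral>\<^sub>0\<^sup>t T(t - s) x\<^sub>n(s) ds\<close> by a constant times \<open>\<tau>\<^sup>1\<^sup>-\<^sup>1\<^sup>/\<^sup>p \<parallel>v\<parallel>\<close>, uniformly in \<open>n\<close>.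
  This integral equals \<open>\<Gamma> (2 n R(n, A) - 2 n R(2 n, A)) z(t)\<close>, which converges weakly to \<open>\<Gamma> z(t)\<close>: write
  \<open>z = D\<^sub>m v + W\<close> with \<open>W(t) \<in> D(A)\<close>, where \<open>n R(n, A) D\<^sub>m = n (D\<^sub>m - D\<^sub>n) / (n - m)\<close> and \<open>\<Gamma> D\<^sub>n v \<rightarrow> 0\<close> weakly.
  The decomposition holds because \<open>n D\<^sub>n\<close> being bounded puts the range of \<open>D\<^sub>m\<close> into the Favard class of \<open>A\<close>.\<close>

section \<open>Functional analysis\<close>

text \<open>Admissibility speaks only of positive elements of D(A). The standard regularisation n
  R(n, A) z is a convolution with n D_n v, which is positive but has boundary value n v instead of
  0, so the hypothesis cannot be applied to it. Subtracting two such regularisations removes the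
  boundary value, while the weights 2 and -1 still add up to 1, so the limit is unchanged; the
  weights also explain the bound 3 C = 2 C + C. Since \<Gamma> D_n v tends to 0 only weakly,
  convergence in L^p is out of reach: the limit passes through norming functionals and Fatou's
  lemma. The second obstacle is regularity. The convolution can be differentiated directly for C^1
  inputs, but v has a derivative only in L^p, and the integrals are gauge integrals of Banach-valued
  functions. Hence v is approximated by C^1 functions with a real integrable majorant of the error,
  and A applied to a convolution is controlled by an L^1 norm through the Favard bound. The final
  constant is the p-th root of \<tau>^(p-1) c(\<tau>) (3 C)^p, where c is constant for \<tau> \<le>
  \<alpha>; this gives the limit 0 for p > 1.\<close>

definition sublinear :: "('a::real_vector \<Rightarrow> real) \<Rightarrow> bool" where
  "sublinear q \<longleftrightarrow> (\<forall>x y. q (x + y) \<le> q x + q y) \<and> (\<forall>c\<ge>0. \<forall>x. q (c *\<^sub>R x) = c * q x)"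

lemma sublinearI:
  assumes "\<And>x y. q (x + y) \<le> q x + q y"
    and "\<And>c x. 0 < c \<Longrightarrow> q (c *\<^sub>R x) \<le> c * q x" and "q 0 = 0"
  shows "sublinear q"
  unfolding sublinear_def
proof (intro conjI allI impI)
  fix c :: real and x assume "0 \<le> c"
  show "q (c *\<^sub>R x) = c * q x"
  proof (cases "c = 0")
    case False
    with \<open>0 \<le> c\<close> have c: "0 < c" by simp
    have "q x \<le> (1/c) * q (c *\<^sub>R x)" using assms(2)[of "1/c" "c *\<^sub>R x"] c by simp
    then have "c * q x \<le> q (c *\<^sub>R x)" using c by (simp add: field_simps)
    then show ?thesis using assms(2)[OF c] by (simp add: antisym)
  qed (simp add: assms)
qed (rule assms)

lemma sublinear_add: "sublinear q \<Longrightarrow> q (x + y) \<le> q x + q y"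
  and sublinear_scaleR: "sublinear q \<Longrightarrow> 0 \<le> c \<Longrightarrow> q (c *\<^sub>R x) = c * q x"
  by (auto simp: sublinear_def)

lemma sublinear_0: "sublinear q \<Longrightarrow> q 0 = 0"
  using sublinear_scaleR[of q 0 0] by simp

lemma sublinear_minus_le: "sublinear q \<Longrightarrow> - q (- x) \<le> q x"
  using sublinear_add[of q x "- x"] by (simp add: sublinear_0)

text \<open>The witness is the infimum of \<open>q (x + t *\<^sub>R y) - t * q y\<close> over
  \<open>t \<ge> 0\<close>; \<open>t = 0\<close> and \<open>t = 1\<close> give the two bounds. If
  \<open>q\<close> is minimal, the second bound upgrades subadditivity to additivity; for the norm
  with \<open>y = x\<close> it yields a norming functional.\<close>

lemma sublinear_decrease:
  fixes q :: "'a::real_vector \<Rightarrow> real"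
  assumes q: "sublinear q"
  obtains q' where "sublinear q'" "\<And>x. q' x \<le> q x" "\<And>x. q' x \<le> q (x + y) - q y"
proof -
  let ?S = "\<lambda>x. (\<lambda>t. q (x + t *\<^sub>R y) - t * q y) ` {0..}"
  define q' where "q' x = Inf (?S x)" for x
  have lower: "- q (- x) \<le> q (x + t *\<^sub>R y) - t * q y" if "0 \<le> t" for x t
    using sublinear_add[OF q, of "x + t *\<^sub>R y" "- x"] sublinear_scaleR[OF q that, of y] by simp
  then have bdd: "bdd_below (?S x)" for x by (auto intro!: bdd_belowI[where m = "- q (- x)"])
  have le: "q' x \<le> q (x + t *\<^sub>R y) - t * q y" if "0 \<le> t" for x t
    unfolding q'_def using that by (intro cInf_lower bdd) auto
  have greatest: "c \<le> q' x" if "\<And>t. 0 \<le> t \<Longrightarrow> c \<le> q (x + t *\<^sub>R y) - t * q y" for c x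
    unfolding q'_def using that by (intro cInf_greatest) auto
  show thesis
  proof
    show "sublinear q'"
    proof (rule sublinearI)
      fix x z
      have "q' (x + z) - q' x \<le> q' z"
      proof (rule greatest)
        fix t :: real assume t: "0 \<le> t"
        have "q' (x + z) - (q (z + t *\<^sub>R y) - t * q y) \<le> q' x"
        proof (rule greatest)
          fix s :: real assume s: "0 \<le> s"
          have "q' (x + z) \<le> q ((x + s *\<^sub>R y) + (z + t *\<^sub>R y)) - (s + t) * q y"
            using le[of "s + t" "x + z"] s t by (simp add: algebra_simps)
          also have "\<dots> \<le> q (x + s *\<^sub>R y) + q (z + t *\<^sub>R y) - (s + t) * q y"
            using sublinear_add[OF q] by simp
          finally show "q' (x + z) - (q (z + t *\<^sub>R y) - t * q y) \<le> q (x + s *\<^sub>R y) - s * q y"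
            by (simp add: algebra_simps)
        qed
        then show "q' (x + z) - q' x \<le> q (z + t *\<^sub>R y) - t * q y" by simp
      qed
      then show "q' (x + z) \<le> q' x + q' z" by simp
    next
      fix c :: real and x assume c: "0 < c"
      have "q' (c *\<^sub>R x) / c \<le> q' x"
      proof (rule greatest)
        fix t :: real assume t: "0 \<le> t"
        have "q' (c *\<^sub>R x) \<le> q (c *\<^sub>R (x + t *\<^sub>R y)) - (c * t) * q y"
          using le[of "c * t" "c *\<^sub>R x"] t c by (simp add: algebra_simps)
        also have "\<dots> = c * (q (x + t *\<^sub>R y) - t * q y)"
          using sublinear_scaleR[OF q, of c "x + t *\<^sub>R y"] c by (simp add: right_diff_distrib)
        finally show "q' (c *\<^sub>R x) / c \<le> q (x + t *\<^sub>R y) - t * q y" using c by (simp add: field_simps)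
      qed
      then show "q' (c *\<^sub>R x) \<le> c * q' x" using c by (simp add: field_simps)
    next
      have "?S 0 = {0}" by (auto simp: sublinear_scaleR[OF q] image_iff intro: exI[of _ 0])
      then show "q' 0 = 0" by (simp add: q'_def)
    qed
  qed (use le[of 0] le[of 1] in auto)
qed

text \<open>Supplies the bounds of chains for Zorn's lemma. The infimum is finite because every
  member lies above \<open>- p (- x)\<close>. It is subadditive because of two members of the chain
  the smaller one can serve both summands.\<close>

lemma sublinear_chain_Inf:
  assumes C: "C \<noteq> {}" "\<And>q. q \<in> C \<Longrightarrow> sublinear q" "\<And>q x. q \<in> C \<Longrightarrow> q x \<le> p x"
    and chain: "\<And>q r. q \<in> C \<Longrightarrow> r \<in> C \<Longrightarrow> (\<forall>x. q x \<le> r x) \<or> (\<forall>x. r x \<le> q x)"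
  shows "sublinear (\<lambda>x. INF q\<in>C. q x)" and "\<And>q x. q \<in> C \<Longrightarrow> (INF q\<in>C. q x) \<le> q x"
proof -
  have bdd: "bdd_below ((\<lambda>q. q x) ` C)" for x
  proof (rule bdd_belowI2)
    fix q assume "q \<in> C"
    then show "- p (- x) \<le> q x" using C sublinear_minus_le[of q x] by (meson neg_le_iff_le order_trans)
  qed
  show le: "(INF q\<in>C. q x) \<le> q x" if "q \<in> C" for q x
    using bdd that by (rule cINF_lower)
  let ?u = "\<lambda>x. INF q\<in>C. q x"
  show "sublinear ?u"
  proof (rule sublinearI)
    fix x y
    have *: "?u (x + y) \<le> q x + r y" if "q \<in> C" "r \<in> C" for q r
      using chain[OF that]
    proof
      assume "\<forall>x. q x \<le> r x"
      then show ?thesis using le[OF that(1), of "x + y"] sublinear_add[OF C(2)[OF that(1)], of x y]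
        by (meson add_left_mono order_trans)
    next
      assume "\<forall>x. r x \<le> q x"
      then show ?thesis using le[OF that(2), of "x + y"] sublinear_add[OF C(2)[OF that(2)], of x y]
        by (meson add_right_mono order_trans)
    qed
    have "?u (x + y) - ?u x \<le> ?u y"
    proof (rule cINF_greatest[OF C(1)])
      fix r assume r: "r \<in> C"
      have "?u (x + y) - r y \<le> ?u x"
        by (rule cINF_greatest[OF C(1)]) (use *[OF _ r] in \<open>simp add: algebra_simps\<close>)
      then show "?u (x + y) - ?u x \<le> r y" by simp
    qed
    then show "?u (x + y) \<le> ?u x + ?u y" by simp
  next
    fix c :: real and x assume c: "0 < c"
    have "?u (c *\<^sub>R x) / c \<le> ?u x"
    proof (rule cINF_greatest[OF C(1)])
      fix q assume q: "q \<in> C"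
      show "?u (c *\<^sub>R x) / c \<le> q x"
        using le[OF q, of "c *\<^sub>R x"] c by (simp add: sublinear_scaleR[OF C(2)[OF q]] field_simps)
    qed
    then show "?u (c *\<^sub>R x) \<le> c * ?u x" using c by (simp add: field_simps)
  next
    have "(\<lambda>q. q 0) ` C = {0}" using C(1) sublinear_0[OF C(2)] by force
    then show "?u 0 = 0" by simp
  qed
qed

text \<open>Hahn--Banach without extending functionals: a minimal sublinear functional is linear.\<close>

lemma sublinear_dominates_linear:
  fixes p :: "'a::real_vector \<Rightarrow> real"
  assumes p: "sublinear p"
  obtains u where "linear u" "\<And>x. u x \<le> p x"
proof -
  define A where "A = {q. sublinear q \<and> (\<forall>x. q x \<le> p x)}"
  \<comment> \<open>The order is reversed, so that the maximal element delivered by Zorn's lemma is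
    a minimal functional.\<close>
  define P where "P = (\<lambda>q r :: 'a \<Rightarrow> real. \<forall>x. r x \<le> q x)"
  have "\<exists>m\<in>A. \<forall>a\<in>A. P m a \<longrightarrow> a = m"
  proof (rule predicate_Zorn)
    show "partial_order_on A (relation_of P A)"
      unfolding P_def
      by (rule partial_order_on_relation_ofI) (auto intro!: ext intro: order_trans antisym)
    fix C assume C: "C \<in> Chains (relation_of P A)"
    then have CA: "C \<subseteq> A" by (auto simp: Chains_def relation_of_def)
    show "\<exists>u\<in>A. \<forall>a\<in>C. P a u"
    proof (cases "C = {}")
      case True
      then show ?thesis using p by (auto simp: A_def)
    next
      case False
      have sub: "\<And>q. q \<in> C \<Longrightarrow> sublinear q" and le: "\<And>q x. q \<in> C \<Longrightarrow> q x \<le> p x"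
        using CA by (auto simp: A_def)
      have ch: "(\<forall>x. q x \<le> r x) \<or> (\<forall>x. r x \<le> q x)" if "q \<in> C" "r \<in> C" for q r
        using C that by (auto simp: Chains_def relation_of_def P_def)
      have inf: "sublinear (\<lambda>x. INF q\<in>C. q x)" "\<And>q x. q \<in> C \<Longrightarrow> (INF q\<in>C. q x) \<le> q x"
        using sublinear_chain_Inf[of C p] False sub le ch by blast+
      let ?u = "\<lambda>x. INF q\<in>C. q x"
      obtain q where "q \<in> C" using False by auto
      then have "?u x \<le> p x" for x using inf(2)[of q x] le[of q x] by linarith
      then have "?u \<in> A" using inf(1) by (auto simp: A_def)
      moreover have "\<forall>a\<in>C. P a ?u" using inf(2) by (auto simp: P_def)
      ultimately show ?thesis by blast
    qed
  qed
  then obtain m where m: "m \<in> A" "\<And>a. a \<in> A \<Longrightarrow> P m a \<Longrightarrow> a = m" by blast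
  then have sub: "sublinear m" and mp: "m x \<le> p x" for x by (auto simp: A_def)
  have add: "m (x + y) = m x + m y" for x y
  proof -
    obtain q' where q': "sublinear q'" "\<And>x. q' x \<le> m x" "\<And>x. q' x \<le> m (x + y) - m y"
      using sublinear_decrease[OF sub, of y] by blast
    have "q' \<in> A" using q'(1,2) mp by (auto simp: A_def intro: order_trans)
    moreover have "P m q'" using q'(2) by (simp add: P_def)
    ultimately have "q' = m" by (rule m(2))
    then show ?thesis using q'(3)[of x] sublinear_add[OF sub, of x y] by auto
  qed
  have minus: "m (- x) = - m x" for x
    using add[of x "- x"] sublinear_0[OF sub] by simp
  have "m (c *\<^sub>R x) = c *\<^sub>R m x" for c x
  proof (cases "0 \<le> c")
    case False
    then have "m ((- c) *\<^sub>R x) = (- c) * m x" by (intro sublinear_scaleR[OF sub]) simp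
    then show ?thesis using minus[of "c *\<^sub>R x"] by simp
  qed (simp add: sublinear_scaleR[OF sub])
  then have "linear m" using add by (intro linearI) auto
  then show thesis using mp that by blast
qed

text \<open>Lowering the norm in the direction \<open>x\<close> gives a sublinear \<open>q\<close>
  with \<open>q (- x) \<le> - norm x\<close>. Any linear functional below \<open>q\<close> is then
  at least \<open>norm x\<close> at \<open>x\<close>, and at most that since \<open>q\<close> stays
  below the norm.\<close>

lemma norming_functional:
  fixes x :: "'a::real_normed_vector"
  obtains u :: "'a \<Rightarrow> real" where "bounded_linear u" "\<And>y. u y \<le> norm y" "u x = norm x"
proof -
  have "sublinear (norm :: 'a \<Rightarrow> real)" by (auto simp: sublinear_def norm_triangle_ineq)
  then obtain q where q: "sublinear q" "\<And>y. q y \<le> norm y" "\<And>y. q y \<le> norm (y + x) - norm x"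
    using sublinear_decrease[of norm x] by blast
  obtain u where u: "linear u" "\<And>y. u y \<le> q y" using sublinear_dominates_linear[OF q(1)] by blast
  have le: "u y \<le> norm y" for y using u(2) q(2) order_trans by blast
  have "\<bar>u y\<bar> \<le> norm y" for y
    using le[of y] le[of "- y"] linear_neg[OF u(1), of y] by simp
  then have "bounded_linear u"
    using u(1) by (intro bounded_linear_intro[where K = 1]) (auto simp: linear_add linear_cmul)
  moreover have "u x = norm x"
    using u(2)[of "- x"] q(3)[of "- x"] linear_neg[OF u(1), of x] le[of x] by simp
  ultimately show thesis using that le by blast
qed

section \<open>Baire category and families of closed operators\<close>

lemma Baire_nat_cover:
  fixes F :: "nat \<Rightarrow> 'a::complete_space set"
  assumes "\<And>n. closed (F n)" and "(\<Union>n. F n) = UNIV"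
  obtains n where "interior (F n) \<noteq> {}"
proof -
  have "interior (\<Union>(range F)) = {}" if "\<And>n. interior (F n) = {}"
    using Met_TC.metric_Baire_category_alt[of "range F"] that assms(1)
    by (auto simp: complete_UNIV)
  then show thesis using that assms(2) by fastforce
qed

text \<open>The open mapping argument: an element of the ball is summed up from elements on which the
  family is bounded, and closedness identifies the image of the sum.\<close>

lemma closed_graph_uniform_bound:
  fixes L :: "'i \<Rightarrow> 'a::banach \<Rightarrow> 'b::banach"
  assumes lin: "\<And>i. i \<in> I \<Longrightarrow> linear (L i)"
    and clos: "\<And>i X x y. i \<in> I \<Longrightarrow> X \<longlonglongrightarrow> x \<Longrightarrow> (\<lambda>n. L i (X n)) \<longlonglongrightarrow> y \<Longrightarrow> L i x = y"
    and ptw: "\<And>x. \<exists>C. \<forall>i\<in>I. norm (L i x) \<le> C"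
  obtains C where "C > 0" "\<And>i x. i \<in> I \<Longrightarrow> norm (L i x) \<le> C * norm x"
proof -
  define V where "V n = {x. \<forall>i\<in>I. norm (L i x) \<le> real n}" for n
  have "x \<in> (\<Union>n. closure (V n))" for x
  proof -
    obtain C where C: "\<forall>i\<in>I. norm (L i x) \<le> C" using ptw by blast
    obtain n where "C \<le> real n" using real_arch_simple by blast
    then have "x \<in> V n" using C unfolding V_def by force
    then show ?thesis using closure_subset by blast
  qed
  then have "(\<Union>n. closure (V n)) = UNIV" by blast
  then obtain n where "interior (closure (V n)) \<noteq> {}"
    by (rule Baire_nat_cover[rotated]) auto
  then obtain a r where r: "r > 0" and ball: "ball a r \<subseteq> closure (V n)"
    by (meson ex_in_conv mem_interior)
  \<comment> \<open>Approximating \<open>a + z\<close> and \<open>a - z\<close> and halving the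
    difference cancels the unknown centre \<open>a\<close>; the set \<open>V n\<close> is symmetric
    and convex, so the result stays in it.\<close>
  have approx: "\<exists>x\<in>V n. norm (z - x) < e" if z: "norm z < r" and e: "e > 0" for z e
  proof -
    have "a + z \<in> closure (V n)" "a - z \<in> closure (V n)"
      using z by (auto intro!: subsetD[OF ball] simp: dist_norm)
    then obtain x y where x: "x \<in> V n" "dist x (a + z) < e" and y: "y \<in> V n" "dist y (a - z) < e"
      using e by (meson closure_approachable)
    define w where "w = (1/2) *\<^sub>R (x - y)"
    have "norm (L i w) \<le> real n" if i: "i \<in> I" for i
    proof -
      have "norm (L i w) = norm (L i x - L i y) / 2"
        by (simp add: w_def linear_cmul[OF lin[OF i]] linear_diff[OF lin[OF i]])
      also have "\<dots> \<le> (norm (L i x) + norm (L i y)) / 2" using norm_triangle_ineq4 by simp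
      also have "\<dots> \<le> real n" using x(1) y(1) i by (fastforce simp: V_def)
      finally show ?thesis .
    qed
    moreover have "norm (z - w) < e"
    proof -
      have "z - w = (1/2) *\<^sub>R (((a + z) - x) - ((a - z) - y))"
        by (simp add: w_def algebra_simps flip: scaleR_add_left)
      then have "norm (z - w) \<le> (norm ((a + z) - x) + norm ((a - z) - y)) / 2"
        using norm_triangle_ineq4[of "(a + z) - x" "(a - z) - y"] by (simp only: norm_scaleR) simp
      then show ?thesis using x(2) y(2) by (simp add: dist_norm norm_minus_commute)
    qed
    ultimately show ?thesis by (auto simp: V_def)
  qed
  have step: "\<exists>x. (\<forall>i\<in>I. norm (L i x) \<le> n / 2^k) \<and> norm (z - x) < r / 2^Suc k"
    if z: "norm z < r / 2^k" for z k
  proof -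
    have "norm (2^k *\<^sub>R z) < r" using z by (simp add: field_simps)
    then obtain x where x: "x \<in> V n" "norm (2^k *\<^sub>R z - x) < r / 2"
      using approx[of "2^k *\<^sub>R z" "r/2"] r by auto
    have "norm (z - (1/2^k) *\<^sub>R x) = norm ((1/2^k) *\<^sub>R (2^k *\<^sub>R z - x))" by (simp add: algebra_simps)
    also have "\<dots> = norm (2^k *\<^sub>R z - x) / 2^k" by (simp only: norm_scaleR) simp
    also have "\<dots> < r / 2^Suc k" using x(2) by (simp add: field_simps)
    finally have "norm (z - (1/2^k) *\<^sub>R x) < r / 2^Suc k" .
    moreover have "\<forall>i\<in>I. norm (L i ((1/2^k) *\<^sub>R x)) \<le> n / 2^k"
      using x(1) by (auto simp: V_def linear_cmul[OF lin] divide_right_mono)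
    ultimately show ?thesis by blast
  qed
  have bound: "norm (L i z) \<le> 2 * n" if z: "norm z < r" and i: "i \<in> I" for z i
  proof -
    \<comment> \<open>\<open>w k\<close> is the remainder of \<open>z\<close> after \<open>k\<close>
      corrections. The corrections \<open>w k - w (Suc k)\<close> have images bounded by a geometric
      series, whose sum is 2 n.\<close>
    have "\<exists>w. \<forall>k. (norm (w k) < r / 2^k \<and> (k = 0 \<longrightarrow> w k = z)) \<and>
        (\<forall>i\<in>I. norm (L i (w k - w (Suc k))) \<le> n / 2^k)"
    proof (rule dependent_nat_choice[where P = "\<lambda>k w. norm w < r / 2^k \<and> (k = 0 \<longrightarrow> w = z)"
          and Q = "\<lambda>k w y. \<forall>i\<in>I. norm (L i (w - y)) \<le> n / 2^k"])
      show "\<exists>w. norm w < r / 2^0 \<and> ((0::nat) = 0 \<longrightarrow> w = z)" using z by auto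
      fix w :: 'a and k :: nat assume "norm w < r / 2^k \<and> (k = 0 \<longrightarrow> w = z)"
      then obtain x where x: "\<forall>i\<in>I. norm (L i x) \<le> n / 2^k" "norm (w - x) < r / 2^Suc k"
        using step by blast
      have "w - (w - x) = x" by simp
      then show "\<exists>y. (norm y < r / 2^Suc k \<and> (Suc k = 0 \<longrightarrow> y = z)) \<and>
          (\<forall>i\<in>I. norm (L i (w - y)) \<le> n / 2^k)"
        using x by (intro exI[of _ "w - x"]) simp
    qed
    then obtain w where w': "\<forall>k. (norm (w k) < r / 2^k \<and> (k = 0 \<longrightarrow> w k = z)) \<and>
        (\<forall>i\<in>I. norm (L i (w k - w (Suc k))) \<le> n / 2^k)" by (elim exE)
    have w: "\<And>k. norm (w k) < r / 2^k" "w 0 = z" using w' by simp_all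
    have wL: "\<And>k i. i \<in> I \<Longrightarrow> norm (L i (w k - w (Suc k))) \<le> n / 2^k" using w' by simp
    define g where "g k = real n * (1/2)^k" for k
    have geo: "g sums (2 * real n)"
      using sums_mult[OF geometric_sums[of "1/2::real"], of "real n"] by (simp add: g_def[abs_def] mult.commute)
    have wLi: "norm (L i (w k - w (Suc k))) \<le> g k" for k
      using wL[OF i, of k] by (simp add: g_def power_divide)
    then have summ: "summable (\<lambda>k. L i (w k - w (Suc k)))"
      by (intro summable_comparison_test'[OF sums_summable[OF geo], of 0])
    have "(\<Sum>j<k. L i (w j - w (Suc j))) = L i (z - w k)" for k
      by (simp only: linear_sum[OF lin[OF i], symmetric] sum_lessThan_telescope' w(2))
    then have lim: "(\<lambda>k. L i (z - w k)) \<longlonglongrightarrow> (\<Sum>k. L i (w k - w (Suc k)))"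
      using summable_LIMSEQ[OF summ] by simp
    have "w \<longlonglongrightarrow> 0"
    proof (rule Lim_null_comparison)
      show "\<forall>\<^sub>F k in sequentially. norm (w k) \<le> r * (1/2)^k"
        using less_imp_le[OF w(1)] by (simp add: power_divide)
      show "(\<lambda>k. r * (1/2)^k) \<longlonglongrightarrow> 0" by (intro tendsto_mult_right_zero LIMSEQ_power_zero) simp
    qed
    then have "(\<lambda>k. z - w k) \<longlonglongrightarrow> z" using tendsto_diff[OF tendsto_const[of z]] by fastforce
    then have "L i z = (\<Sum>k. L i (w k - w (Suc k)))" using clos[OF i _ lim] by blast
    also have "norm \<dots> \<le> suminf g"
      by (rule norm_suminf_le[OF wLi sums_summable[OF geo]])
    also have "\<dots> = 2 * n" using sums_unique[OF geo] by simp
    finally show ?thesis .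
  qed
  show thesis
  proof
    show "4 * real n / r + 1 > 0" using r by (simp add: add_nonneg_pos)
    fix i x assume i: "i \<in> I"
    show "norm (L i x) \<le> (4 * real n / r + 1) * norm x"
    proof (cases "x = 0")
      case True
      then show ?thesis by (simp add: linear_0[OF lin[OF i]])
    next
      case False
      let ?c = "r / (2 * norm x)"
      have c: "?c > 0" using r False by simp
      have "norm (?c *\<^sub>R x) < r" using r False by simp
      from bound[OF this i] have "?c * norm (L i x) \<le> 2 * n"
        using r by (simp add: linear_cmul[OF lin[OF i]])
      then have "norm (L i x) \<le> (4 * real n / r) * norm x" using r False by (simp add: field_simps)
      then show ?thesis by (simp add: distrib_right add_increasing2)
    qed
  qed
qed

section \<open>The positive cone of a Banach lattice\<close>

lemma lat_abs_nonneg: "0 \<le> lat_abs (x::'a::{ordered_real_vector,lattice})"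
proof -
  have "x + - x \<le> lat_abs x + lat_abs x" unfolding lat_abs_def by (intro add_mono) auto
  then have "0 \<le> (2::real) *\<^sub>R lat_abs x" by (simp add: scaleR_2)
  then have "(1/2) *\<^sub>R (0::'a) \<le> (1/2) *\<^sub>R ((2::real) *\<^sub>R lat_abs x)"
    by (intro scaleR_left_mono) auto
  then show ?thesis by simp
qed

text \<open>The negative part \<open>sup (- x) 0\<close> of the limit is dominated by
  \<open>lat_abs (X n - x)\<close>, because \<open>- x \<le> X n - x\<close>. The lattice norm turns
  this into a bound by \<open>norm (X n - x)\<close>, which tends to 0.\<close>

lemma closed_positive_cone:
  assumes "banach_lattice TYPE('a::{banach,ordered_real_vector,lattice})"
  shows "closed {x::'a. 0 \<le> x}"
proof (rule closed_sequential_limits[THEN iffD2], intro allI impI, elim conjE)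
  fix X :: "nat \<Rightarrow> 'a" and x assume X: "\<forall>n. X n \<in> {x. 0 \<le> x}" and lim: "X \<longlonglongrightarrow> x"
  let ?m = "sup (- x) 0"
  have abs_id: "lat_abs y = y" if "0 \<le> y" for y :: 'a
  proof -
    have "- y \<le> y" using that neg_le_0_iff_le order_trans by blast
    then show ?thesis by (simp add: lat_abs_def sup_absorb1)
  qed
  have "norm ?m \<le> norm (X n - x)" for n
  proof -
    have "- x \<le> X n - x" using X by (simp add: le_diff_eq)
    then have "- x \<le> lat_abs (X n - x)" unfolding lat_abs_def by (simp add: le_supI1)
    then have "?m \<le> lat_abs (X n - x)" using lat_abs_nonneg by simp
    moreover have "lat_abs ?m = ?m" by (rule abs_id) simp
    ultimately show ?thesis using assms unfolding banach_lattice_def by metis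
  qed
  then have "norm ?m \<le> 0"
    using tendsto_norm[OF tendsto_diff[OF lim tendsto_const[of x]]]
    by (intro LIMSEQ_le_const[of "\<lambda>n. norm (X n - x)"]) auto
  then have "sup (- x) 0 = 0" by simp
  then have "- x \<le> 0" by (metis sup.cobounded1)
  then show "x \<in> {x. 0 \<le> x}" by simp
qed

section \<open>Henstock--Kurzweil integrals and weak derivatives\<close>

lemma has_integral_gaugeE:
  assumes "(f has_integral I) (cbox a b)" "0 < e"
  obtains \<gamma> where "gauge \<gamma>" "\<And>\<D>. \<D> tagged_division_of cbox a b \<Longrightarrow> \<gamma> fine \<D> \<Longrightarrow>
    norm ((\<Sum>(x, k)\<in>\<D>. measure lborel k *\<^sub>R f x) - I) < e"
proof -
  have "\<exists>\<gamma>. gauge \<gamma> \<and> (\<forall>\<D>. \<D> tagged_division_of cbox a b \<and> \<gamma> fine \<D> \<longrightarrow>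
      norm ((\<Sum>(x, k)\<in>\<D>. measure lborel k *\<^sub>R f x) - I) < e)"
    by (rule assms(1)[unfolded has_integral, rule_format, OF assms(2)])
  then show thesis by (elim exE conjE) (rule that, assumption, simp)
qed

text \<open>Riemann sums have nonnegative weights and hence lie in the cone; the integral is a limit
  of them.\<close>

lemma has_integral_in_convex_cone:
  fixes f :: "real \<Rightarrow> 'a::real_normed_vector"
  assumes K: "closed K" "0 \<in> K" "\<And>x y. x \<in> K \<Longrightarrow> y \<in> K \<Longrightarrow> x + y \<in> K"
      "\<And>c x. 0 \<le> c \<Longrightarrow> x \<in> K \<Longrightarrow> c *\<^sub>R x \<in> K"
    and int: "(f has_integral I) {a..b}" and f: "\<And>t. t \<in> {a..b} \<Longrightarrow> f t \<in> K"
  shows "I \<in> K"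
proof -
  have "\<exists>y\<in>K. dist y I < e" if "e > 0" for e
  proof -
    from int have int': "(f has_integral I) (cbox a b)" by simp
    obtain \<gamma> where \<gamma>: "gauge \<gamma>"
      "\<And>\<D>. \<D> tagged_division_of cbox a b \<Longrightarrow> \<gamma> fine \<D> \<Longrightarrow> norm ((\<Sum>(x, k)\<in>\<D>. measure lborel k *\<^sub>R f x) - I) < e"
      by (rule has_integral_gaugeE[OF int' \<open>e > 0\<close>]) (rule that, assumption, simp)
    obtain \<D> where \<D>: "\<D> tagged_division_of cbox a b" "\<gamma> fine \<D>"
      using fine_division_exists[OF \<gamma>(1)] by blast
    have in_ab: "x \<in> {a..b}" if "(x, k) \<in> \<D>" for x k
      using tagged_division_ofD(2,3)[OF \<D>(1) that] by auto
    have sum_K: "sum g P \<in> K" if "finite P" "\<And>i. i \<in> P \<Longrightarrow> g i \<in> K"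
      for g and P :: "(real \<times> real set) set"
      using that by (induction P rule: finite_induct) (auto intro!: K)
    have "finite \<D>" using \<D>(1) by blast
    then have "(\<Sum>(x, k)\<in>\<D>. measure lborel k *\<^sub>R f x) \<in> K"
      by (rule sum_K) (auto intro!: K f dest: in_ab)
    then show ?thesis using \<gamma>(2)[OF \<D>] by (auto simp: dist_norm)
  qed
  then have "I \<in> closure K" by (simp add: closure_approachable)
  then show ?thesis using K(1) by simp
qed

text \<open>Verifies the Cauchy criterion for Riemann sums: on a common fine division the sums of
  \<open>f\<close> and \<open>q\<close> differ by at most the sum of the majorant \<open>e\<close>.
  Measurability of \<open>f\<close> is thereby bypassed.\<close>

lemma integrable_if_L1_approx:
  fixes f :: "real \<Rightarrow> 'a::banach"
  assumes "\<And>\<epsilon>. \<epsilon> > 0 \<Longrightarrow> \<exists>q e. q integrable_on {a..b} \<and> e integrable_on {a..b} \<and> integral {a..b} e < \<epsilon> \<and>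
     (\<forall>t\<in>{a..b}. norm (f t - q t) \<le> e t)"
  shows "f integrable_on {a..b}"
proof -
  have "f integrable_on cbox a b"
    unfolding integrable_Cauchy
  proof (intro allI impI)
    fix \<epsilon> :: real assume "\<epsilon> > 0"
    \<comment> \<open>Each of the two divisions contributes less than \<open>3 * d\<close>: one
      \<open>d\<close> from \<open>q\<close>, and \<open>2 * d\<close> from the sum of
      \<open>e\<close>, which is within \<open>d\<close> of an integral smaller than
      \<open>d\<close>.\<close>
    define d where "d = \<epsilon> / 6"
    have d: "d > 0" using \<open>\<epsilon> > 0\<close> by (simp add: d_def)
    obtain q e where q: "q integrable_on cbox a b" and e: "e integrable_on cbox a b"
      and small: "integral (cbox a b) e < d" and le: "\<And>t. t \<in> {a..b} \<Longrightarrow> norm (f t - q t) \<le> e t"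
      using assms[OF d] by auto
    obtain \<gamma>1 where \<gamma>1: "gauge \<gamma>1" "\<And>\<D>. \<D> tagged_division_of cbox a b \<Longrightarrow> \<gamma>1 fine \<D> \<Longrightarrow>
        norm ((\<Sum>(x, k)\<in>\<D>. measure lborel k *\<^sub>R q x) - integral (cbox a b) q) < d"
      by (rule has_integral_gaugeE[OF integrable_integral[OF q] d]) (rule that, assumption, simp)
    obtain \<gamma>2 where \<gamma>2: "gauge \<gamma>2" "\<And>\<D>. \<D> tagged_division_of cbox a b \<Longrightarrow> \<gamma>2 fine \<D> \<Longrightarrow>
        norm ((\<Sum>(x, k)\<in>\<D>. measure lborel k *\<^sub>R e x) - integral (cbox a b) e) < d"
      by (rule has_integral_gaugeE[OF integrable_integral[OF e] d]) (rule that, assumption, simp)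
    let ?\<gamma> = "\<lambda>x. \<gamma>1 x \<inter> \<gamma>2 x"
    have close: "norm ((\<Sum>(x, k)\<in>\<D>. measure lborel k *\<^sub>R f x) - integral (cbox a b) q) < 3 * d"
      if \<D>: "\<D> tagged_division_of cbox a b" "?\<gamma> fine \<D>" for \<D>
    proof -
      have fine: "\<gamma>1 fine \<D>" "\<gamma>2 fine \<D>" using \<D>(2) by (simp_all add: fine_Int)
      have in_ab: "x \<in> {a..b}" if "(x, k) \<in> \<D>" for x k
        using tagged_division_ofD(2,3)[OF \<D>(1) that] by auto
      have "norm ((\<Sum>(x, k)\<in>\<D>. measure lborel k *\<^sub>R f x) - (\<Sum>(x, k)\<in>\<D>. measure lborel k *\<^sub>R q x))
          = norm (\<Sum>(x, k)\<in>\<D>. measure lborel k *\<^sub>R (f x - q x))"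
        by (simp add: sum_subtractf[symmetric] split_def scaleR_diff_right)
      also have "\<dots> \<le> (\<Sum>(x, k)\<in>\<D>. measure lborel k *\<^sub>R e x)"
        by (rule sum_norm_le) (use in_ab in \<open>auto intro!: mult_left_mono le\<close>)
      also have "\<dots> < 2 * d" using \<gamma>2(2)[OF \<D>(1) fine(2)] small by (auto simp: abs_if split: if_splits)
      finally show ?thesis using \<gamma>1(2)[OF \<D>(1) fine(1)]
        norm_diff_triangle_less by fastforce
    qed
    show "\<exists>\<gamma>. gauge \<gamma> \<and> (\<forall>\<D>1 \<D>2. \<D>1 tagged_division_of cbox a b \<and> \<gamma> fine \<D>1 \<and>
        \<D>2 tagged_division_of cbox a b \<and> \<gamma> fine \<D>2 \<longrightarrow>
        norm ((\<Sum>(x,K)\<in>\<D>1. measure lborel K *\<^sub>R f x) - (\<Sum>(x,K)\<in>\<D>2. measure lborel K *\<^sub>R f x)) < \<epsilon>)"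
    proof (rule exI[of _ ?\<gamma>], intro conjI allI impI; (elim conjE)?)
      show "gauge ?\<gamma>" using \<gamma>1(1) \<gamma>2(1) by (rule gauge_Int)
      fix \<D>1 \<D>2
      assume 1: "\<D>1 tagged_division_of cbox a b" "?\<gamma> fine \<D>1"
        and 2: "\<D>2 tagged_division_of cbox a b" "?\<gamma> fine \<D>2"
      show "norm ((\<Sum>(x,K)\<in>\<D>1. measure lborel K *\<^sub>R f x) - (\<Sum>(x,K)\<in>\<D>2. measure lborel K *\<^sub>R f x)) < \<epsilon>"
        (is "norm (?A - ?B) < \<epsilon>")
      proof -
        have "norm (?A - ?B) \<le> norm (?A - integral (cbox a b) q) + norm (?B - integral (cbox a b) q)"
          using norm_triangle_ineq4[of "?A - integral (cbox a b) q" "?B - integral (cbox a b) q"] by simp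
        also have "\<dots> < \<epsilon>" using close[OF 1] close[OF 2] unfolding d_def by linarith
        finally show ?thesis .
      qed
    qed
  qed
  then show ?thesis by simp
qed

section \<open>Approximation by continuously differentiable functions in L^1\<close>

text \<open>Differentiability is required on the whole line because \<open>conv_C1\<close>
  differentiates \<open>f (t + h - s)\<close> in \<open>h\<close> on both sides of 0, where the
  argument leaves the interval of integration.\<close>

definition C1_fun :: "(real \<Rightarrow> 'a::real_normed_vector) \<Rightarrow> (real \<Rightarrow> 'a) \<Rightarrow> bool" where
  "C1_fun q q' \<longleftrightarrow> (\<forall>t. (q has_vector_derivative q' t) (at t)) \<and> continuous_on UNIV q'"

lemma C1_fun_has_derivative: "C1_fun q q' \<Longrightarrow> (q has_vector_derivative q' t) (at t within S)"
  unfolding C1_fun_def by (meson has_vector_derivative_at_within)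

lemma C1_fun_continuous: "C1_fun q q' \<Longrightarrow> continuous_on S q"
  by (rule continuous_on_vector_derivative) (rule C1_fun_has_derivative)

lemma C1_fun_continuous': "C1_fun q q' \<Longrightarrow> continuous_on S q'"
  unfolding C1_fun_def using continuous_on_subset by blast

lemma C1_fun_zero: "C1_fun (\<lambda>t. 0) (\<lambda>t. 0)"
  by (auto simp: C1_fun_def)

lemma C1_fun_add: "C1_fun q q' \<Longrightarrow> C1_fun r r' \<Longrightarrow> C1_fun (\<lambda>t. q t + r t) (\<lambda>t. q' t + r' t)"
  unfolding C1_fun_def by (auto intro!: derivative_intros continuous_intros)

lemma C1_fun_linear:
  assumes "bounded_linear L" "C1_fun q q'" shows "C1_fun (\<lambda>t. L (q t)) (\<lambda>t. L (q' t))"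
proof -
  have "((\<lambda>t. L (q t)) has_vector_derivative L (q' t)) (at t)" for t
    using assms(2) by (intro bounded_linear.has_vector_derivative[OF assms(1)]) (simp add: C1_fun_def)
  moreover have "continuous_on UNIV (\<lambda>t. L (q' t))"
    using assms(2) by (intro bounded_linear.continuous_on[OF assms(1)]) (simp add: C1_fun_def)
  ultimately show ?thesis by (simp add: C1_fun_def)
qed

text \<open>This is the closure of the C^1 functions in L^1, expressed by a real majorant
  \<open>e\<close> of the pointwise distance so that it makes sense before \<open>f\<close> is known
  to be integrable.\<close>

definition C1_approximable :: "real \<Rightarrow> real \<Rightarrow> (real \<Rightarrow> 'a::real_normed_vector) \<Rightarrow> bool" where
  "C1_approximable a b f \<longleftrightarrow> (\<forall>\<epsilon>>0. \<exists>q q' e. C1_fun q q' \<and> e integrable_on {a..b} \<and>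
     integral {a..b} e < \<epsilon> \<and> (\<forall>t\<in>{a..b}. norm (f t - q t) \<le> e t))"

lemma C1_approximableD:
  assumes "C1_approximable a b f" "\<epsilon> > 0"
  obtains q q' e where "C1_fun q q'" "e integrable_on {a..b}" "integral {a..b} e < \<epsilon>"
    "\<And>t. t \<in> {a..b} \<Longrightarrow> norm (f t - q t) \<le> e t"
  using assms unfolding C1_approximable_def by blast

lemma C1_approximable_zero: "C1_approximable a b (\<lambda>t. 0)"
  unfolding C1_approximable_def
proof (intro allI impI)
  fix \<epsilon> :: real assume "\<epsilon> > 0"
  then show "\<exists>q q' e. C1_fun q q' \<and> e integrable_on {a..b} \<and> integral {a..b} e < \<epsilon> \<and>
      (\<forall>t\<in>{a..b}. norm ((0::'a) - q t) \<le> e t)"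
    by (intro exI[of _ "\<lambda>t. 0"]) (simp add: C1_fun_zero integrable_0)
qed

lemma C1_approximable_add:
  assumes "C1_approximable a b f" "C1_approximable a b g"
  shows "C1_approximable a b (\<lambda>t. f t + g t)"
  unfolding C1_approximable_def
proof (intro allI impI)
  fix \<epsilon> :: real assume "\<epsilon> > 0"
  then have "\<epsilon> / 2 > 0" by simp
  obtain q q' e where q: "C1_fun q q'" "e integrable_on {a..b}" "integral {a..b} e < \<epsilon> / 2"
      "\<And>t. t \<in> {a..b} \<Longrightarrow> norm (f t - q t) \<le> e t"
    using C1_approximableD[OF assms(1) \<open>\<epsilon> / 2 > 0\<close>] by blast
  obtain r r' d where r: "C1_fun r r'" "d integrable_on {a..b}" "integral {a..b} d < \<epsilon> / 2"
      "\<And>t. t \<in> {a..b} \<Longrightarrow> norm (g t - r t) \<le> d t"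
    using C1_approximableD[OF assms(2) \<open>\<epsilon> / 2 > 0\<close>] by blast
  have "norm (f t + g t - (q t + r t)) \<le> e t + d t" if "t \<in> {a..b}" for t
    using norm_triangle_ineq[of "f t - q t" "g t - r t"] q(4)[OF that] r(4)[OF that]
    by (simp add: algebra_simps)
  moreover have "integral {a..b} (\<lambda>t. e t + d t) < \<epsilon>"
    using q r by (simp add: integral_add)
  ultimately show "\<exists>q q' e. C1_fun q q' \<and> e integrable_on {a..b} \<and> integral {a..b} e < \<epsilon> \<and>
      (\<forall>t\<in>{a..b}. norm (f t + g t - q t) \<le> e t)"
    using C1_fun_add[OF q(1) r(1)] integrable_add[OF q(2) r(2)] by blast
qed

lemma C1_approximable_sum:
  "finite A \<Longrightarrow> (\<And>i. i \<in> A \<Longrightarrow> C1_approximable a b (f i)) \<Longrightarrow> C1_approximable a b (\<lambda>t. \<Sum>i\<in>A. f i t)"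
  by (induction A rule: finite_induct) (auto intro: C1_approximable_zero C1_approximable_add)

lemma C1_approximable_cong:
  assumes "\<And>t. t \<in> {a..b} \<Longrightarrow> f t = g t" shows "C1_approximable a b f \<longleftrightarrow> C1_approximable a b g"
  using assms unfolding C1_approximable_def by simp

text \<open>The indicator is an almost everywhere limit of continuous functions. Truncated to [0, 1]
  they converge in L^1 by dominated convergence, and a polynomial uniformly close to one of them is
  C^1.\<close>

lemma C1_approximable_indicator:
  assumes A: "A \<in> sets lebesgue"
  shows "C1_approximable a b (\<lambda>t. indicator A t *\<^sub>R c)"
  unfolding C1_approximable_def
proof (intro allI impI)
  fix \<epsilon> :: real assume \<epsilon>: "\<epsilon> > 0"
  define \<delta> where "\<delta> = \<epsilon> / (norm c + 1)"
  have \<delta>: "\<delta> > 0" using \<epsilon> by (simp add: \<delta>_def add_nonneg_pos)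
  have "indicat_real A measurable_on UNIV" using A by (rule indicator_measurable_on)
  then obtain N g where N: "negligible N" and g: "\<And>n. continuous_on UNIV (g n)"
    and lim: "\<And>x. x \<notin> N \<Longrightarrow> (\<lambda>n. g n x) \<longlonglongrightarrow> indicat_real A x"
    unfolding measurable_on_def by auto
  define h where "h n x = max 0 (min 1 (g n x))" for n x
  have hc: "continuous_on S (h n)" for n S
    unfolding h_def by (intro continuous_intros continuous_on_subset[OF g]) auto
  have hlim: "(\<lambda>n. h n x) \<longlonglongrightarrow> indicat_real A x" if "x \<notin> N" for x
  proof -
    have "(\<lambda>n. max 0 (min 1 (g n x))) \<longlonglongrightarrow> max 0 (min 1 (indicat_real A x))"
      by (intro tendsto_intros lim[OF that])
    then show ?thesis by (simp add: h_def indicator_def split: if_splits)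
  qed
  define k where "k n x = \<bar>indicat_real A x - h n x\<bar>" for n x
  have bound: "norm (k n x) \<le> 1" for n x by (auto simp: k_def h_def indicator_def)
  have "A \<inter> {a..b} \<in> lmeasurable" using A fmeasurable_Int_fmeasurable[of "{a..b}" lebesgue A] by (simp add: Int_commute)
  then have indA: "indicat_real A absolutely_integrable_on {a..b}"
    by (intro nonnegative_absolutely_integrable_1) (auto simp: integrable_on_indicator)
  have ha: "h n absolutely_integrable_on {a..b}" for n
    by (rule absolutely_integrable_continuous_real[OF hc])
  have k_int: "k n integrable_on {a..b}" for n
    using absolutely_integrable_norm[OF set_integral_diff(1)[OF indA ha[of n]]]
    by (simp add: k_def[abs_def] o_def absolutely_integrable_on_def)
  have k'_int: "(\<lambda>x. if x \<in> N then 0 else k n x) integrable_on {a..b}" for n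
    by (rule integrable_spike[OF k_int[of n] N]) auto
  have "(\<lambda>n. integral {a..b} (\<lambda>x. if x \<in> N then 0 else k n x)) \<longlonglongrightarrow> integral {a..b} (\<lambda>x. 0::real)"
  proof (rule dominated_convergence(2)[where h = "\<lambda>x. 1"])
    fix x :: real
    show "(\<lambda>n. if x \<in> N then 0 else k n x) \<longlonglongrightarrow> 0"
    proof (cases "x \<in> N")
      case False
      from tendsto_diff[OF tendsto_const[of "indicat_real A x"] hlim[OF this]]
      have "(\<lambda>n. indicat_real A x - h n x) \<longlonglongrightarrow> 0" by simp
      then show ?thesis using False tendsto_rabs_zero by (fastforce simp: k_def)
    qed simp
  qed (use bound k'_int in \<open>auto intro: k'_int\<close>)
  moreover have "integral {a..b} (\<lambda>x. if x \<in> N then 0 else k n x) = integral {a..b} (k n)" for n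
    by (rule integral_spike[OF N]) auto
  ultimately have "(\<lambda>n. integral {a..b} (k n)) \<longlonglongrightarrow> 0" by simp
  then have "\<forall>\<^sub>F n in sequentially. integral {a..b} (k n) < \<delta> / 2"
    using \<delta> by (intro order_tendstoD) auto
  then obtain n where n: "integral {a..b} (k n) < \<delta> / 2"
    using eventually_happens' sequentially_bot by blast
  \<comment> \<open>Half of the error budget \<open>\<delta>\<close> is reserved for the uniform
    polynomial error over the interval; adding 1 to the length keeps the denominator positive when
    the interval degenerates.\<close>
  define \<rho> where "\<rho> = \<delta> / (2 * (1 + \<bar>b - a\<bar>))"
  have \<rho>: "\<rho> > 0" using \<delta> unfolding \<rho>_def by (intro divide_pos_pos mult_pos_pos add_pos_nonneg) auto
  obtain \<phi> where \<phi>: "real_polynomial_function \<phi>" "\<And>x. x \<in> {a..b} \<Longrightarrow> \<bar>h n x - \<phi> x\<bar> < \<rho>"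
    using Stone_Weierstrass_real_polynomial_function[OF compact_Icc hc \<rho>] by blast
  obtain \<phi>' where \<phi>': "real_polynomial_function \<phi>'" "\<And>x. (\<phi> has_real_derivative \<phi>' x) (at x)"
    using has_real_derivative_polynomial_function[OF \<phi>(1)] by blast
  define e where "e x = (k n x + \<rho>) * norm c" for x
  have "C1_fun (\<lambda>t. \<phi> t *\<^sub>R c) (\<lambda>t. \<phi>' t *\<^sub>R c)"
    unfolding C1_fun_def
    using \<phi>'(2) continuous_on_polymonial_function[of \<phi>'] \<phi>'(1)
    by (auto intro!: derivative_eq_intros continuous_intros
        simp: has_real_derivative_iff_has_vector_derivative real_polynomial_function_eq)
  moreover have ei: "e integrable_on {a..b}"
    unfolding e_def by (intro integrable_on_mult_left integrable_add k_int) auto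
  moreover have "integral {a..b} e < \<epsilon>"
  proof -
    have "integral {a..b} e = integral {a..b} (\<lambda>x. k n x + \<rho>) * norm c"
      unfolding e_def by (rule integral_mult_left)
    also have "integral {a..b} (\<lambda>x. k n x + \<rho>) = integral {a..b} (k n) + integral {a..b} (\<lambda>x. \<rho>)"
      by (intro integral_add k_int) auto
    also have "integral {a..b} (\<lambda>x. \<rho>) \<le> \<delta> / 2"
    proof -
      have "integral {a..b} (\<lambda>x. \<rho>) \<le> \<bar>b - a\<bar> * \<rho>"
        using \<rho> by (cases "a \<le> b") (auto simp: content_real)
      also have "\<dots> \<le> (1 + \<bar>b - a\<bar>) * \<rho>" using \<rho> by (intro mult_right_mono) auto
      also have "\<dots> = \<delta> / 2" unfolding \<rho>_def by (simp add: field_simps add_nonneg_eq_0_iff)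
      finally show ?thesis .
    qed
    finally have "integral {a..b} e \<le> \<delta> * norm c"
      using n by (smt (verit, best) mult_right_mono norm_ge_zero field_sum_of_halves)
    also have "\<dots> < \<delta> * (norm c + 1)" using \<delta> by simp
    also have "\<dots> = \<epsilon>" by (simp add: \<delta>_def add_nonneg_eq_0_iff)
    finally show ?thesis .
  qed
  moreover have "norm (indicator A t *\<^sub>R c - \<phi> t *\<^sub>R c) \<le> e t" if "t \<in> {a..b}" for t
  proof -
    have "norm (indicator A t *\<^sub>R c - \<phi> t *\<^sub>R c) = \<bar>indicat_real A t - \<phi> t\<bar> * norm c"
      by (simp flip: scaleR_diff_left)
    also have "\<dots> \<le> e t"
      unfolding e_def k_def using \<phi>(2)[OF that] by (intro mult_right_mono) auto
    finally show ?thesis .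
  qed
  ultimately show "\<exists>q q' e. C1_fun q q' \<and> e integrable_on {a..b} \<and> integral {a..b} e < \<epsilon> \<and>
      (\<forall>t\<in>{a..b}. norm (indicator A t *\<^sub>R c - q t) \<le> e t)"
    by blast
qed

lemma C1_approximable_simple:
  assumes s: "simple_function (restrict_space lborel {a..b}) s"
  shows "C1_approximable a b s"
proof -
  let ?F = "s ` {a..b}" and ?A = "\<lambda>c. s -` {c} \<inter> {a..b}"
  have fin: "finite ?F" using simple_functionD(1)[OF s] by (simp add: space_restrict_space)
  have "?A c \<in> sets (restrict_space lborel {a..b})" for c
    using simple_functionD(2)[OF s, of "{c}"] by (simp add: space_restrict_space)
  then have A: "?A c \<in> sets lebesgue" for c
    by (auto simp: sets_restrict_space_iff intro!: sets_completionI_sets)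
  have "C1_approximable a b (\<lambda>t. \<Sum>c\<in>?F. indicator (?A c) t *\<^sub>R c)"
    by (intro C1_approximable_sum fin C1_approximable_indicator A)
  moreover have "s t = (\<Sum>c\<in>?F. indicator (?A c) t *\<^sub>R c)" if "t \<in> {a..b}" for t
  proof -
    have "(\<Sum>c\<in>?F. indicator (?A c) t *\<^sub>R c) = (\<Sum>c\<in>?F. if c = s t then c else 0)"
      using that by (intro sum.cong) (auto simp: indicator_def)
    then show ?thesis using fin that by simp
  qed
  ultimately show ?thesis by (rule C1_approximable_cong[THEN iffD2, rotated])
qed

text \<open>L^p is contained in L^1 on a bounded interval since x \<le> 1 + x^p. Strong
  measurability provides simple functions converging almost everywhere, but without domination, so
  they are cut off before the dominated convergence theorem is used.\<close>

lemma Lp_on_C1_approximable: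
  fixes g :: "real \<Rightarrow> 'a::real_normed_vector"
  assumes Lp: "Lp_on p {a..b} g" and p: "1 \<le> p"
  shows "C1_approximable a b g"
  unfolding C1_approximable_def
proof (intro allI impI)
  fix \<epsilon> :: real assume \<epsilon>: "\<epsilon> > 0"
  let ?S = "{a..b}"
  let ?M = "restrict_space lborel ?S"
  obtain s where s: "\<And>n. simple_function ?M (s n)"
    and AE_lim: "AE t in lborel. t \<in> ?S \<longrightarrow> (\<lambda>n. s n t) \<longlonglongrightarrow> g t"
    using Lp unfolding Lp_on_def strongly_measurable_on_def by auto
  obtain N where N: "N \<in> null_sets lborel" and "{t. \<not> (t \<in> ?S \<longrightarrow> (\<lambda>n. s n t) \<longlonglongrightarrow> g t)} \<subseteq> N"
    using AE_lim by (auto simp: eventually_ae_filter)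
  then have lim: "(\<lambda>n. s n t) \<longlonglongrightarrow> g t" if "t \<in> ?S - N" for t using that by auto
  have [measurable]: "N \<in> sets borel" using N by auto
  have negN: "negligible N" using N negligible_iff_null_sets null_sets_completionI by blast
  have real_simple: "(\<lambda>t. if t \<in> ?S - N then h t else 0) \<in> borel_measurable borel"
    if h: "simple_function ?M h" for h :: "real \<Rightarrow> real"
  proof -
    have "h \<in> borel_measurable ?M" using h by (rule borel_measurable_simple_function)
    then have "(\<lambda>x. indicator ?S x *\<^sub>R h x) \<in> borel_measurable lborel"
      by (subst (asm) borel_measurable_restrict_space_iff) auto
    then have [measurable]: "(\<lambda>x. indicator ?S x *\<^sub>R h x) \<in> borel_measurable borel" by simp
    have "(\<lambda>t. if t \<in> ?S - N then h t else 0) = (\<lambda>t. if t \<in> N then 0 else indicator ?S t *\<^sub>R h t)"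
      by (auto simp: indicator_def)
    then show ?thesis by simp
  qed
  \<comment> \<open>With the value 0 on the exceptional set, convergence holds at every point and
    \<open>G\<close> is a limit of Borel functions. Only real functions such as \<open>G\<close> and
    \<open>E\<close> need to be measurable.\<close>
  define G where "G t = (if t \<in> ?S - N then norm (g t) else 0)" for t
  have G_meas [measurable]: "G \<in> borel_measurable borel"
  proof (rule borel_measurable_LIMSEQ_metric)
    show "(\<lambda>t. if t \<in> ?S - N then norm (s n t) else 0) \<in> borel_measurable borel" for n
      by (rule real_simple) (rule simple_function_compose1[OF s])
    show "(\<lambda>n. if t \<in> ?S - N then norm (s n t) else 0) \<longlonglongrightarrow> G t" for t
      unfolding G_def using tendsto_norm[OF lim[of t]] by (cases "t \<in> ?S - N") (simp_all del: Diff_iff)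
  qed
  have G_nonneg: "0 \<le> G t" for t by (simp add: G_def)
  have AE_N: "AE t in lborel. t \<notin> N" using N by (rule AE_not_in)
  have "(\<integral>\<^sup>+t. ennreal (G t) \<partial>lborel) \<le> (\<integral>\<^sup>+t. indicator ?S t + ennreal (G t powr p) \<partial>lborel)"
  proof (rule nn_integral_mono)
    fix t
    have "G t \<le> 1 + G t powr p"
    proof (cases "G t \<le> 1")
      case False
      then have "G t powr 1 \<le> G t powr p" using p by (intro powr_mono) auto
      then show ?thesis using False by simp
    qed (simp add: add_increasing2)
    then have "ennreal (G t) \<le> ennreal (indicator ?S t + G t powr p)"
      by (intro ennreal_leI) (cases "t \<in> ?S", auto simp: G_def)
    then show "ennreal (G t) \<le> indicator ?S t + ennreal (G t powr p)"
      by (subst (asm) ennreal_plus) (auto simp: ennreal_indicator)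
  qed
  also have "\<dots> = (\<integral>\<^sup>+t. indicator ?S t \<partial>lborel) + (\<integral>\<^sup>+t. ennreal (G t powr p) \<partial>lborel)"
    by (rule nn_integral_add) auto
  also have "(\<integral>\<^sup>+t. ennreal (G t powr p) \<partial>lborel) = (\<integral>\<^sup>+t\<in>?S. ennreal (norm (g t) powr p) \<partial>lborel)"
    by (rule nn_integral_cong_AE) (use AE_N in eventually_elim, auto simp: G_def indicator_def)
  also have "(\<integral>\<^sup>+t. indicator ?S t \<partial>lborel) + \<dots> < \<infinity>"
    using Lp unfolding Lp_on_def by (simp add: emeasure_lborel_Icc_eq)
  finally have G_fin: "(\<integral>\<^sup>+t. ennreal (G t) \<partial>lborel) < \<infinity>" .
  have G_int: "G integrable_on UNIV"
    by (rule nn_integral_integrable_on[OF G_meas G_nonneg G_fin])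
  \<comment> \<open>Simple functions are discarded where they exceed twice the size of
    \<open>g\<close>. This forces the error below \<open>3 * G\<close>, and it does not disturb
    convergence: where \<open>g t\<close> is nonzero the cut is eventually inactive, and where it
    vanishes \<open>r n t\<close> is 0.\<close>
  define r where "r n t = (if norm (s n t) \<le> 2 * G t then s n t else 0)" for n t
  have P_meas: "{t \<in> space ?M. norm (s n t) \<le> 2 * G t} \<in> sets ?M" for n
  proof -
    have [measurable]: "(\<lambda>t. norm (s n t)) \<in> borel_measurable ?M"
      by (rule borel_measurable_simple_function) (rule simple_function_compose1[OF s])
    have [measurable]: "G \<in> borel_measurable ?M"
      by (rule measurable_restrict_space1) (use G_meas in simp)
    show ?thesis by measurable
  qed
  have r: "simple_function ?M (r n)" for n
    unfolding r_def by (rule simple_function_If[OF s _ P_meas]) simp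
  define E where "E n t = (if t \<in> ?S - N then norm (g t - r n t) else 0)" for n t
  have E_meas: "E n \<in> borel_measurable borel" for n
  proof (rule borel_measurable_LIMSEQ_metric)
    show "(\<lambda>t. if t \<in> ?S - N then norm (s m t - r n t) else 0) \<in> borel_measurable borel" for m
      by (rule real_simple) (rule simple_function_compose2[OF s r])
    show "(\<lambda>m. if t \<in> ?S - N then norm (s m t - r n t) else 0) \<longlonglongrightarrow> E n t" for t
      unfolding E_def using tendsto_norm[OF tendsto_diff[OF lim[of t] tendsto_const]]
      by (cases "t \<in> ?S - N") (simp_all del: Diff_iff)
  qed
  have E_le: "E n t \<le> 3 * G t" for n t
  proof -
    have "norm (g t - r n t) \<le> norm (g t) + norm (r n t)" by (rule norm_triangle_ineq4)
    also have "norm (r n t) \<le> 2 * G t" using G_nonneg by (auto simp: r_def)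
    finally show ?thesis using G_nonneg by (auto simp: E_def G_def)
  qed
  have E_int: "E n integrable_on UNIV" for n
  proof (rule nn_integral_integrable_on[OF E_meas])
    show "0 \<le> E n t" for t by (simp add: E_def)
    have "(\<integral>\<^sup>+t. ennreal (E n t) \<partial>lborel) \<le> (\<integral>\<^sup>+t. ennreal 3 * ennreal (G t) \<partial>lborel)"
    proof (rule nn_integral_mono)
      fix t show "ennreal (E n t) \<le> ennreal 3 * ennreal (G t)"
        using ennreal_leI[OF E_le[of n t]] G_nonneg[of t] by (simp add: ennreal_mult)
    qed
    also have "\<dots> = ennreal 3 * (\<integral>\<^sup>+t. ennreal (G t) \<partial>lborel)" by (rule nn_integral_cmult) simp
    also have "\<dots> < \<infinity>" using G_fin by (simp add: ennreal_mult_less_top)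
    finally show "(\<integral>\<^sup>+t. ennreal (E n t) \<partial>lborel) < \<infinity>" .
  qed
  have E_intS: "E n integrable_on ?S" for n using E_int integrable_on_subinterval by blast
  have "(\<lambda>n. integral ?S (E n)) \<longlonglongrightarrow> integral ?S (\<lambda>t. 0::real)"
  proof (rule dominated_convergence(2)[where h = "\<lambda>t. 3 * G t"])
    show "E n integrable_on ?S" for n by (rule E_intS)
    have "G integrable_on ?S" using G_int integrable_on_subinterval by blast
    then show "(\<lambda>t. 3 * G t) integrable_on ?S" by (rule integrable_on_mult_right)
    show "norm (E n t) \<le> 3 * G t" for n t using E_le[of n t] by (simp add: E_def)
    fix t
    show "(\<lambda>n. E n t) \<longlonglongrightarrow> 0"
    proof (cases "t \<in> ?S - N")
      case True
      then have Gt: "G t = norm (g t)" by (simp add: G_def)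
      show ?thesis
      proof (cases "g t = 0")
        case True
        then have "E n t = 0" for n using Gt by (auto simp: E_def r_def)
        then show ?thesis by simp
      next
        case False
        then have "\<forall>\<^sub>F n in sequentially. norm (s n t) < 2 * norm (g t)"
          using tendsto_norm[OF lim[OF True]] by (intro order_tendstoD(2)) auto
        then have "\<forall>\<^sub>F n in sequentially. norm (g t - s n t) = E n t"
          by eventually_elim (use True in \<open>simp add: E_def r_def Gt\<close>)
        moreover have "(\<lambda>n. norm (g t - s n t)) \<longlonglongrightarrow> 0"
          using tendsto_norm[OF tendsto_diff[OF tendsto_const lim[OF True]], of "g t"] by simp
        ultimately show ?thesis by (rule Lim_transform_eventually[rotated])
      qed
    next
      case False
      then have "E n t = 0" for n unfolding E_def by (rule if_not_P)
      then show ?thesis by simp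
    qed
  qed
  then have "\<forall>\<^sub>F n in sequentially. integral ?S (E n) < \<epsilon> / 2"
    using \<epsilon> by (intro order_tendstoD) auto
  then obtain n where n: "integral ?S (E n) < \<epsilon> / 2"
    using eventually_happens' sequentially_bot by blast
  obtain q q' d where q: "C1_fun q q'" "d integrable_on ?S" "integral ?S d < \<epsilon> / 2"
      "\<And>t. t \<in> ?S \<Longrightarrow> norm (r n t - q t) \<le> d t"
    by (rule C1_approximableD[OF C1_approximable_simple[OF r, of n], of "\<epsilon> / 2"]) (use \<epsilon> in auto)
  \<comment> \<open>On the null set the majorant is set to the actual error, since the approximation
    property asks for the inequality at every point.\<close>
  define e where "e t = (if t \<in> N then norm (g t - q t) else E n t + d t)" for t
  have sum_int: "(\<lambda>t. E n t + d t) integrable_on ?S" by (intro integrable_add E_intS q)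
  have "e integrable_on ?S"
    by (rule integrable_spike[OF sum_int negN]) (simp add: e_def)
  moreover have "integral ?S e = integral ?S (\<lambda>t. E n t + d t)"
    by (rule integral_spike[OF negN]) (simp add: e_def)
  then have "integral ?S e < \<epsilon>" using n q by (simp add: integral_add E_intS)
  moreover have "norm (g t - q t) \<le> e t" if "t \<in> ?S" for t
    using norm_triangle_ineq[of "g t - r n t" "r n t - q t"] q(4)[OF that] that
    by (simp add: e_def E_def)
  ultimately show "\<exists>q q' e. C1_fun q q' \<and> e integrable_on ?S \<and> integral ?S e < \<epsilon> \<and>
      (\<forall>t\<in>?S. norm (g t - q t) \<le> e t)"
    using q(1) by blast
qed

section \<open>Smooth steps as test functions\<close>

text \<open>The derivatives are carried as a witness sequence. An antiderivative then merely
  prepends a term, and \<open>smooth_deriv\<close> converts back to the iterated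
  \<open>deriv\<close> demanded by \<open>test_function\<close>.\<close>

definition smooth :: "(real \<Rightarrow> real) \<Rightarrow> bool" where
  "smooth f \<longleftrightarrow> (\<exists>F. F 0 = f \<and> (\<forall>k x. (F k has_real_derivative F (Suc k) x) (at x)))"

lemma smooth_deriv:
  assumes "smooth f"
  shows "((deriv ^^ k) f has_real_derivative (deriv ^^ Suc k) f x) (at x)"
proof -
  obtain F where F: "F 0 = f" "\<And>k x. (F k has_real_derivative F (Suc k) x) (at x)"
    using assms unfolding smooth_def by blast
  have "(deriv ^^ k) f = F k" for k
  proof (induction k)
    case (Suc k)
    have "deriv (F k) = F (Suc k)" using F(2) by (intro ext DERIV_imp_deriv)
    then show ?case using Suc by simp
  qed (simp add: F(1))
  then show ?thesis using F(2) by metis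
qed

lemma smooth_antiderivative:
  assumes "smooth f" "\<And>x. (g has_real_derivative f x) (at x)"
  shows "smooth g"
proof -
  obtain F where F: "F 0 = f" "\<And>k x. (F k has_real_derivative F (Suc k) x) (at x)"
    using assms(1) unfolding smooth_def by blast
  have "((case_nat g F) k has_real_derivative (case_nat g F) (Suc k) x) (at x)" for k x
    using assms(2) F by (cases k) auto
  then show ?thesis unfolding smooth_def by (intro exI[of _ "case_nat g F"]) auto
qed

lemma smooth_affine_comb:
  assumes "smooth f" "smooth g"
  shows "smooth (\<lambda>x. c * f (m * x + u) + d * g (m * x + v))"
proof -
  obtain F where F: "F 0 = f" "\<And>k x. (F k has_real_derivative F (Suc k) x) (at x)"
    using assms(1) unfolding smooth_def by blast
  obtain H where H: "H 0 = g" "\<And>k x. (H k has_real_derivative H (Suc k) x) (at x)"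
    using assms(2) unfolding smooth_def by blast
  let ?K = "\<lambda>k x. m ^ k * (c * F k (m * x + u) + d * H k (m * x + v))"
  have "(?K k has_real_derivative ?K (Suc k) x) (at x)" for k x
    by (auto intro!: derivative_eq_intros DERIV_chain2[OF F(2)] DERIV_chain2[OF H(2)] simp: algebra_simps)
  then show ?thesis unfolding smooth_def by (intro exI[of _ ?K]) (simp add: F H)
qed

text \<open>The derivatives of the bump \<open>exp (- 1 / (x * (1 - x)))\<close> on \<open>(0, 1)\<close> stay in this family.\<close>

definition bump_fun :: "real poly \<Rightarrow> nat \<Rightarrow> real \<Rightarrow> real" where
  "bump_fun P k x = (if 0 < x \<and> x < 1
     then poly P x / (x * (1 - x)) ^ k * exp (- 1 / (x * (1 - x))) else 0)"

text \<open>With w = x (1 - x), coded as \<open>[:0, 1, -1:]\<close>, and w' = 1 - 2 x, this is P'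
  w^2 + P w' - k P w' w: the numerator of the derivative of P w^(-k) exp(- 1 / w) over the
  denominator w^(k+2).\<close>

definition bump_deriv_poly :: "real poly \<Rightarrow> nat \<Rightarrow> real poly" where
  "bump_deriv_poly P k = pderiv P * [:0, 1, -1:]\<^sup>2 + P * [:1, -2:] - of_nat k * P * [:1, -2:] * [:0, 1, -1:]"

text \<open>Raise 1 + y \<le> exp y with y = 1 / (n w) to the n-th power and take reciprocals. The
  exponential thus beats any pole in w.\<close>

lemma exp_neg_inverse_le:
  fixes w :: real assumes "0 < w" "0 < n"
  shows "exp (- 1 / w) \<le> (real n * w) ^ n"
proof -
  have "1 / (real n * w) \<le> exp (1 / (real n * w))"
    using exp_ge_add_one_self[of "1 / (real n * w)"] by linarith
  then have "(1 / (real n * w)) ^ n \<le> exp (1 / (real n * w)) ^ n" using assms by (intro power_mono) auto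
  also have "\<dots> = exp (1 / w)" using assms by (simp flip: exp_of_nat_mult)
  finally have "1 / exp (1 / w) \<le> 1 / (1 / (real n * w)) ^ n" using assms by (intro divide_left_mono) auto
  moreover have "1 / (1 / (real n * w)) ^ n = (real n * w) ^ n" by (simp add: power_one_over)
  moreover have "exp (- 1 / w) = 1 / exp (1 / w)" by (simp add: exp_minus divide_inverse)
  ultimately show ?thesis by simp
qed

lemma has_derivative_zero_if_quadratic:
  fixes f :: "real \<Rightarrow> real"
  assumes "\<And>y. \<bar>f y\<bar> \<le> C * (y - x)\<^sup>2"
  shows "(f has_real_derivative 0) (at x)"
  unfolding has_field_derivative_iff
proof (rule Lim_null_comparison)
  have fx: "f x = 0" using assms[of x] by simp
  show "\<forall>\<^sub>F y in at x. norm ((f y - f x) / (y - x)) \<le> \<bar>C\<bar> * \<bar>y - x\<bar>"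
  proof (rule always_eventually, rule allI)
    fix y
    show "norm ((f y - f x) / (y - x)) \<le> \<bar>C\<bar> * \<bar>y - x\<bar>"
    proof (cases "y = x")
      case False
      have "\<bar>f y\<bar> \<le> \<bar>C\<bar> * (y - x)\<^sup>2"
        using assms[of y] by (smt (verit) mult_right_mono zero_le_power2)
      also have "\<dots> = \<bar>C\<bar> * \<bar>y - x\<bar> * \<bar>y - x\<bar>" by (simp add: power2_eq_square)
      finally show ?thesis using False by (simp add: fx field_simps)
    qed simp
  qed
  show "((\<lambda>y. \<bar>C\<bar> * \<bar>y - x\<bar>) \<longlongrightarrow> 0) (at x)"
    by (auto intro!: tendsto_eq_intros)
qed

text \<open>The exponential bound with exponent \<open>k + 2\<close> cancels the pole of order
  \<open>k\<close> and leaves (x (1 - x))^2. Quadratic decay at both endpoints is what makes the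
  derivative vanish there.\<close>

lemma bump_fun_quadratic_bound:
  obtains C where "\<And>x. \<bar>bump_fun P k x\<bar> \<le> C * x\<^sup>2" "\<And>x. \<bar>bump_fun P k x\<bar> \<le> C * (x - 1)\<^sup>2"
proof -
  have "compact (poly P ` {0..1})"
    by (intro compact_continuous_image continuous_intros) auto
  then obtain B where B: "B > 0" "\<And>x. x \<in> {0..1} \<Longrightarrow> \<bar>poly P x\<bar> \<le> B"
    unfolding compact_eq_bounded_closed bounded_pos by auto
  define C where "C = B * real (k + 2) ^ (k + 2)"
  have C: "0 \<le> C" using B by (simp add: C_def)
  have main: "\<bar>bump_fun P k x\<bar> \<le> C * (x * (1 - x))\<^sup>2" for x
  proof (cases "0 < x \<and> x < 1")
    case True
    let ?w = "x * (1 - x)"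
    have w: "0 < ?w" using True by simp
    have "\<bar>bump_fun P k x\<bar> = \<bar>poly P x\<bar> / ?w ^ k * exp (- 1 / ?w)"
      using True w by (simp add: bump_fun_def abs_mult)
    also have "\<dots> \<le> B / ?w ^ k * (real (k + 2) * ?w) ^ (k + 2)"
      using exp_neg_inverse_le[OF w, of "k + 2"] B True w
      by (intro mult_mono divide_right_mono) auto
    also have "\<dots> = C * ?w\<^sup>2"
    proof -
      have "B / w ^ k * (c * w) ^ (k + 2) = B * c ^ (k + 2) * w\<^sup>2" if "w > 0" for c w :: real
        using that by (simp add: power_mult_distrib power_add power2_eq_square)
      from this[OF w] show ?thesis by (simp only: C_def)
    qed
    finally show ?thesis .
  next
    case False
    then have "bump_fun P k x = 0" by (auto simp: bump_fun_def)
    then show ?thesis using C by simp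
  qed
  have "(x * (1 - x))\<^sup>2 \<le> x\<^sup>2" "(x * (1 - x))\<^sup>2 \<le> (x - 1)\<^sup>2" if "0 < x" "x < 1" for x :: real
    using that by (auto intro!: power2_le_imp_le simp: power2_commute[of x 1] power_mult_distrib
        mult_le_cancel_right1 power_le_one mult_left_le mult_left_le_one_le)
  then have "\<bar>bump_fun P k x\<bar> \<le> C * x\<^sup>2 \<and> \<bar>bump_fun P k x\<bar> \<le> C * (x - 1)\<^sup>2" for x
  proof (cases "0 < x \<and> x < 1")
    case True
    assume *: "\<And>x::real. 0 < x \<Longrightarrow> x < 1 \<Longrightarrow> (x * (1 - x))\<^sup>2 \<le> x\<^sup>2"
      "\<And>x::real. 0 < x \<Longrightarrow> x < 1 \<Longrightarrow> (x * (1 - x))\<^sup>2 \<le> (x - 1)\<^sup>2"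
    show ?thesis using main[of x] mult_left_mono[OF *(1) C, of x] mult_left_mono[OF *(2) C, of x] True
      by linarith
  next
    case False
    then have "bump_fun P k x = 0" by (auto simp: bump_fun_def)
    then show ?thesis using C by simp
  qed
  then show thesis using that by blast
qed

text \<open>The pole order grows by 2 because the derivative of exp(- 1 / w) contributes w' / w^2.
  At the two gluing points the quadratic bound takes the place of a computation.\<close>

lemma bump_fun_derivative:
  "(bump_fun P k has_real_derivative bump_fun (bump_deriv_poly P k) (k + 2) x) (at x)"
proof -
  obtain C where C: "\<And>x. \<bar>bump_fun P k x\<bar> \<le> C * x\<^sup>2" "\<And>x. \<bar>bump_fun P k x\<bar> \<le> C * (x - 1)\<^sup>2"
    by (rule bump_fun_quadratic_bound[of P k]) (rule that)
  consider "0 < x \<and> x < 1" | "x < 0" | "x = 0" | "x = 1" | "1 < x" by linarith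
  then show ?thesis
  proof cases
    case 1
    let ?f = "\<lambda>x. poly P x / (x * (1 - x)) ^ k * exp (- 1 / (x * (1 - x)))"
    have w: "0 < x * (1 - x)" using 1 by simp
    have "(?f has_real_derivative bump_fun (bump_deriv_poly P k) (k + 2) x) (at x)"
    proof -
      define W where "W y = y * (1 - y)" for y :: real
      define w where "w = W x"
      have w0: "w \<noteq> 0" using w unfolding w_def W_def by linarith
      have dW: "(W has_real_derivative 1 - 2 * x) (at x)"
        unfolding W_def by (auto intro!: derivative_eq_intros)
      have "((\<lambda>y. poly P y / W y ^ k * exp (- 1 / W y)) has_real_derivative
          ((poly (pderiv P) x * w ^ k - poly P x * (real k * w ^ (k - 1) * (1 - 2 * x))) / (w ^ k * w ^ k) * exp (- 1 / w)
           + poly P x / w ^ k * (exp (- 1 / w) * ((1 - 2 * x) / w\<^sup>2)))) (at x)"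
      proof -
        have "((\<lambda>y. poly P y / W y ^ k) has_real_derivative
            (poly (pderiv P) x * w ^ k - poly P x * (real k * w ^ (k - 1) * (1 - 2 * x))) / (w ^ k * w ^ k)) (at x)"
          using w0 dW unfolding w_def by (auto intro!: derivative_eq_intros poly_DERIV)
        moreover have "((\<lambda>y. exp (- 1 / W y)) has_real_derivative exp (- 1 / w) * ((1 - 2 * x) / w\<^sup>2)) (at x)"
          using w0 dW unfolding w_def by (auto intro!: derivative_eq_intros simp: power2_eq_square field_simps)
        ultimately show ?thesis
          by (rule DERIV_cong[OF DERIV_mult]) (simp add: w_def mult_ac)
      qed
      then have "(?f has_real_derivative
          ((poly (pderiv P) x * w ^ k - poly P x * (real k * w ^ (k - 1) * (1 - 2 * x))) / (w ^ k * w ^ k) * exp (- 1 / w)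
           + poly P x / w ^ k * (exp (- 1 / w) * ((1 - 2 * x) / w\<^sup>2)))) (at x)"
        by (simp only: W_def)
      moreover have "((poly (pderiv P) x * w ^ k - poly P x * (real k * w ^ (k - 1) * (1 - 2 * x))) / (w ^ k * w ^ k) * exp (- 1 / w)
           + poly P x / w ^ k * (exp (- 1 / w) * ((1 - 2 * x) / w\<^sup>2))) =
          (poly (pderiv P) x * w\<^sup>2 + poly P x * (1 - 2 * x) - real k * poly P x * (1 - 2 * x) * w) / w ^ (k + 2) * exp (- 1 / w)"
        using w0 by (cases k) (simp_all add: field_simps power_add power2_eq_square)
      moreover have "bump_fun (bump_deriv_poly P k) (k + 2) x =
          (poly (pderiv P) x * w\<^sup>2 + poly P x * (1 - 2 * x) - real k * poly P x * (1 - 2 * x) * w) / w ^ (k + 2) * exp (- 1 / w)"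
        using 1 by (simp add: bump_fun_def bump_deriv_poly_def w_def W_def algebra_simps)
      ultimately show ?thesis by simp
    qed
    then show ?thesis
      by (rule has_field_derivative_transform_within_open[where S = "{0<..<1}"])
        (use 1 in \<open>auto simp: bump_fun_def\<close>)
  next
    case 2
    then have "((\<lambda>_. 0::real) has_real_derivative bump_fun (bump_deriv_poly P k) (k + 2) x) (at x)"
      by (simp add: bump_fun_def)
    then show ?thesis
      by (rule has_field_derivative_transform_within_open[where S = "{..<0}"])
        (use 2 in \<open>auto simp: bump_fun_def\<close>)
  next
    case 3
    then show ?thesis using has_derivative_zero_if_quadratic[of "bump_fun P k" C 0] C(1)
      by (simp add: bump_fun_def)
  next
    case 4
    then show ?thesis using has_derivative_zero_if_quadratic[of "bump_fun P k" C 1] C(2)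
      by (simp add: bump_fun_def)
  next
    case 5
    then have "((\<lambda>_. 0::real) has_real_derivative bump_fun (bump_deriv_poly P k) (k + 2) x) (at x)"
      by (simp add: bump_fun_def)
    then show ?thesis
      by (rule has_field_derivative_transform_within_open[where S = "{1<..}"])
        (use 5 in \<open>auto simp: bump_fun_def\<close>)
  qed
qed

lemma smooth_bump_fun: "smooth (bump_fun P k)"
proof -
  define Q where "Q = rec_nat P (\<lambda>n R. bump_deriv_poly R (k + 2 * n))"
  have "((\<lambda>x. bump_fun (Q n) (k + 2 * n) x) has_real_derivative bump_fun (Q (Suc n)) (k + 2 * Suc n) x) (at x)" for n x
    using bump_fun_derivative[of "Q n" "k + 2 * n" x] by (simp add: Q_def)
  then show ?thesis unfolding smooth_def
    by (intro exI[of _ "\<lambda>n. bump_fun (Q n) (k + 2 * n)"]) (simp add: Q_def)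
qed

text \<open>\<open>B\<close> is the primitive of the bump that vanishes at 0. It is not normalised
  to \<open>B 1 = 1\<close>, so \<open>B 1\<close> appears later as a factor on both sides of
  estimates.\<close>

lemma smooth_step:
  obtains b B :: "real \<Rightarrow> real" where "smooth b" "smooth B" "\<And>x. (B has_real_derivative b x) (at x)"
    "\<And>x. 0 \<le> b x" "\<And>x. x \<notin> {0<..<1} \<Longrightarrow> b x = 0" "\<And>x. x \<le> 0 \<Longrightarrow> B x = 0" "\<And>x. 1 \<le> x \<Longrightarrow> B x = B 1"
    "mono B" "0 < B 1"
proof -
  let ?b = "bump_fun 1 0"
  have sm: "smooth ?b" by (rule smooth_bump_fun)
  have cont: "isCont ?b x" for x using bump_fun_derivative by (rule DERIV_isCont)
  obtain B0 where "\<And>x. -\<infinity> < ereal x \<Longrightarrow> ereal x < \<infinity> \<Longrightarrow> (B0 has_vector_derivative ?b x) (at x)"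
    using einterval_antiderivative[of "-\<infinity>" \<infinity> ?b] cont by auto
  then have B0: "(B0 has_real_derivative ?b x) (at x)" for x
    by (simp add: has_real_derivative_iff_has_vector_derivative)
  define B where "B x = B0 x - B0 0" for x
  have B: "(B has_real_derivative ?b x) (at x)" for x
    unfolding B_def using B0 by (auto intro!: derivative_eq_intros)
  have nonneg: "0 \<le> ?b x" for x by (simp add: bump_fun_def)
  have mono: "mono B"
    by (rule monoI) (use B nonneg in \<open>blast intro: DERIV_nonneg_imp_nondecreasing\<close>)
  have B_cont: "continuous_on S B" for S
    by (rule DERIV_continuous_on) (rule has_field_derivative_at_within[OF B])
  have flat: "B x = B y" if "x \<le> y" "y \<le> 0 \<or> 1 \<le> x" for x y
  proof (cases "x = y")
    case False
    show ?thesis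
    proof (rule DERIV_isconst_end[symmetric, OF _ B_cont])
      show "x < y" using False that by simp
      fix z assume "x < z" "z < y"
      then have "?b z = 0" using that by (auto simp: bump_fun_def)
      then show "(B has_real_derivative 0) (at z)" using B[of z] by simp
    qed
  qed simp
  show thesis
  proof (rule that[of ?b B])
    show "?b x = 0" if "x \<notin> {0<..<1}" for x using that by (auto simp: bump_fun_def)
    show "B x = 0" if "x \<le> 0" for x using flat[OF that] by (simp add: B_def)
    show "B x = B 1" if "1 \<le> x" for x using flat[OF that] by simp
    have "B 0 < B 1"
    proof (rule DERIV_pos_imp_increasing_open[of 0 1 B])
      fix x :: real assume "0 < x" "x < 1"
      then have "0 < ?b x" by (simp add: bump_fun_def)
      then show "\<exists>y. (B has_real_derivative y) (at x) \<and> 0 < y" using B by blast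
    qed (simp_all add: B_cont)
    then show "0 < B 1" by (simp add: B_def)
  qed (rule sm smooth_antiderivative[OF sm B] B nonneg mono)+
qed

section \<open>Weak derivatives and primitives\<close>

text \<open>A quantitative du Bois-Reymond lemma. The test function is a smoothed indicator of
  [s, t]; its derivative is a difference of two bumps, and integrating \<open>w\<close> against them
  gives averages of \<open>w\<close> near \<open>s\<close> and near \<open>t\<close>, up to the
  common mass \<open>B 1\<close>.\<close>

lemma weak_derivative_increment:
  fixes w :: "real \<Rightarrow> 'a::banach"
  assumes cont: "continuous_on {0..\<tau>} w"
    and weak: "\<And>\<phi> c. test_function \<tau> \<phi> \<Longrightarrow> (\<And>x. \<bar>\<phi> x\<bar> \<le> c) \<Longrightarrow>
      norm (integral {0..\<tau>} (\<lambda>x. deriv \<phi> x *\<^sub>R w x)) \<le> c * \<delta>"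
    and st: "0 < s" "s < t" "t < \<tau>"
  shows "norm (w s - w t) \<le> \<delta>"
proof (rule field_le_epsilon)
  fix \<eta>' :: real assume "\<eta>' > 0"
  define \<eta> where "\<eta> = \<eta>' / 2"
  have \<eta>: "\<eta> > 0" using \<open>\<eta>' > 0\<close> by (simp add: \<eta>_def)
  obtain b B :: "real \<Rightarrow> real" where b: "smooth b" "smooth B" "\<And>x. (B has_real_derivative b x) (at x)"
    and b0: "\<And>x. 0 \<le> b x" "\<And>x. x \<notin> {0<..<1} \<Longrightarrow> b x = 0"
    and B01: "\<And>x. x \<le> 0 \<Longrightarrow> B x = 0" "\<And>x. 1 \<le> x \<Longrightarrow> B x = B 1" "mono B" "0 < B 1"
    using smooth_step by blast
  have near: "\<exists>d>0. \<forall>x\<in>{0..\<tau>}. \<bar>x - r\<bar> < d \<longrightarrow> norm (w x - w r) \<le> \<eta>" if "r \<in> {0..\<tau>}" for r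
    using cont[unfolded continuous_on_iff, rule_format, OF that \<eta>]
    by (auto simp: dist_norm less_imp_le)
  obtain d1 where d1: "d1 > 0" "\<forall>x\<in>{0..\<tau>}. \<bar>x - s\<bar> < d1 \<longrightarrow> norm (w x - w s) \<le> \<eta>"
    using near[of s] st by auto
  obtain d2 where d2: "d2 > 0" "\<forall>x\<in>{0..\<tau>}. \<bar>x - t\<bar> < d2 \<longrightarrow> norm (w x - w t) \<le> \<eta>"
    using near[of t] st by auto
  \<comment> \<open>The bumps live on [s, s + \<epsilon>] and [t, t + \<epsilon>]. The width must
    keep both inside the region where \<open>w\<close> varies by at most \<open>\<eta>\<close>, and
    the second one strictly before \<open>\<tau>\<close>.\<close>
  define \<epsilon> where "\<epsilon> = min (min d1 d2) (\<tau> - t) / 2"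
  have \<epsilon>: "0 < \<epsilon>" "\<epsilon> < d1" "\<epsilon> < d2" "t + \<epsilon> < \<tau>" using d1 d2 st by (auto simp: \<epsilon>_def min_def field_simps)
  have cb: "continuous_on S b" for S
  proof -
    obtain F where "F 0 = b" "\<And>k x. (F k has_real_derivative F (Suc k) x) (at x)"
      using b(1) unfolding smooth_def by blast
    then have "(b has_real_derivative F 1 x) (at x)" for x by (metis One_nat_def)
    then show ?thesis by (intro DERIV_continuous_on) (rule has_field_derivative_at_within)
  qed
  \<comment> \<open>The rescaled bump at \<open>r\<close>, which is the derivative of B((x - r) /
    \<epsilon>) and therefore has total mass \<open>B 1\<close>.\<close>
  define \<beta> where "\<beta> r x = b ((x - r) / \<epsilon>) / \<epsilon>" for r x
  have cont_\<beta>: "continuous_on S (\<beta> r)" for S r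
    unfolding \<beta>_def using \<epsilon>(1) by (intro continuous_intros continuous_on_compose2[OF cb]) auto
  have dB: "((\<lambda>x. B ((x - r) / \<epsilon>)) has_real_derivative \<beta> r x) (at x)" for r x
  proof -
    have "((\<lambda>x. (x - r) / \<epsilon>) has_real_derivative 1 / \<epsilon>) (at x)"
      using \<epsilon>(1) by (auto intro!: derivative_eq_intros)
    from DERIV_chain2[OF b(3) this] show ?thesis by (simp add: \<beta>_def)
  qed
  have mean: "norm (integral {0..\<tau>} (\<lambda>x. \<beta> r x *\<^sub>R w x) - B 1 *\<^sub>R w r) \<le> B 1 * \<eta>"
    if r: "0 \<le> r" "r + \<epsilon> \<le> \<tau>" and close: "\<And>x. x \<in> {0..\<tau>} \<Longrightarrow> \<bar>x - r\<bar> \<le> \<epsilon> \<Longrightarrow> norm (w x - w r) \<le> \<eta>" for r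
  proof -
    have "(\<beta> r has_integral (B ((\<tau> - r) / \<epsilon>) - B ((0 - r) / \<epsilon>))) {0..\<tau>}"
      using r \<epsilon>(1) by (intro fundamental_theorem_of_calculus)
        (auto simp flip: has_real_derivative_iff_has_vector_derivative intro: has_field_derivative_at_within[OF dB])
    moreover have "B ((\<tau> - r) / \<epsilon>) = B 1" using r \<epsilon>(1) by (intro B01) (simp add: field_simps)
    moreover have "B ((0 - r) / \<epsilon>) = 0" using r \<epsilon>(1) by (intro B01) (simp add: field_simps)
    ultimately have \<beta>: "(\<beta> r has_integral B 1) {0..\<tau>}" by simp
    have int1: "(\<lambda>x. \<beta> r x *\<^sub>R w x) integrable_on {0..\<tau>}"
      by (intro integrable_continuous_real continuous_intros cont_\<beta> cont)
    have i1: "((\<lambda>x. \<beta> r x *\<^sub>R w x - \<beta> r x *\<^sub>R w r) has_integral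
        integral {0..\<tau>} (\<lambda>x. \<beta> r x *\<^sub>R w x) - B 1 *\<^sub>R w r) {0..\<tau>}"
      by (intro has_integral_diff integrable_integral int1 has_integral_scaleR_left \<beta>)
    have i2: "((\<lambda>x. \<beta> r x * \<eta>) has_integral B 1 * \<eta>) {0..\<tau>}"
      by (rule has_integral_mult_left[OF \<beta>])
    have le: "norm (\<beta> r x *\<^sub>R w x - \<beta> r x *\<^sub>R w r) \<le> \<beta> r x * \<eta>" if x: "x \<in> {0..\<tau>}" for x
    proof (cases "\<bar>x - r\<bar> \<le> \<epsilon>")
      case True
      have "0 \<le> \<beta> r x" using b0 \<epsilon>(1) by (simp add: \<beta>_def)
      then show ?thesis using close[OF x True] by (simp add: mult_left_mono flip: scaleR_diff_right)
    next
      case False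
      then have "(x - r) / \<epsilon> \<notin> {0<..<1}" using \<epsilon>(1) by (auto simp: field_simps)
      then have "\<beta> r x = 0" by (simp add: \<beta>_def b0(2))
      then show ?thesis by simp
    qed
    show ?thesis
      using integral_norm_bound_integral[OF has_integral_integrable[OF i1] has_integral_integrable[OF i2] le]
      by (simp only: integral_unique[OF i1] integral_unique[OF i2])
  qed
  define \<phi> where "\<phi> x = B ((x - s) / \<epsilon>) - B ((x - t) / \<epsilon>)" for x
  have d\<phi>: "(\<phi> has_real_derivative \<beta> s x - \<beta> t x) (at x)" for x
    unfolding \<phi>_def by (intro derivative_intros dB)
  have "smooth (\<lambda>x. 1 * B ((1 / \<epsilon>) * x + (- s / \<epsilon>)) + (- 1) * B ((1 / \<epsilon>) * x + (- t / \<epsilon>)))"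
    by (rule smooth_affine_comb[OF b(2) b(2)])
  then have "smooth \<phi>" by (simp add: \<phi>_def[abs_def] diff_divide_distrib)
  moreover have "\<phi> x = 0" if "x \<notin> {s..t + \<epsilon>}" for x
  proof (cases "x < s")
    case True
    then have "(x - s) / \<epsilon> \<le> 0" "(x - t) / \<epsilon> \<le> 0" using st \<epsilon>(1) by (auto simp: field_simps)
    then show ?thesis by (simp add: \<phi>_def B01)
  next
    case False
    then have ge: "1 \<le> (x - s) / \<epsilon>" "1 \<le> (x - t) / \<epsilon>" using st \<epsilon>(1) that by (auto simp: field_simps)
    show ?thesis using B01(2)[OF ge(1)] B01(2)[OF ge(2)] by (simp add: \<phi>_def)
  qed
  ultimately have test: "test_function \<tau> \<phi>"
    unfolding test_function_def using smooth_deriv \<epsilon>(4) st(1) by blast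
  have "\<bar>\<phi> x\<bar> \<le> B 1" for x
  proof -
    have B_range: "0 \<le> B y \<and> B y \<le> B 1" for y
      using monoD[OF B01(3)] B01(1,2) by (metis linorder_le_cases order_refl)
    have "B ((x - t) / \<epsilon>) \<le> B ((x - s) / \<epsilon>)"
      using st \<epsilon>(1) by (intro monoD[OF B01(3)] divide_right_mono) auto
    then show ?thesis using B_range[of "(x - t) / \<epsilon>"] B_range[of "(x - s) / \<epsilon>"] by (simp add: \<phi>_def)
  qed
  then have "norm (integral {0..\<tau>} (\<lambda>x. deriv \<phi> x *\<^sub>R w x)) \<le> B 1 * \<delta>" by (rule weak[OF test])
  moreover have "deriv \<phi> x = \<beta> s x - \<beta> t x" for x by (rule DERIV_imp_deriv[OF d\<phi>])
  moreover have int: "(\<lambda>x. \<beta> r x *\<^sub>R w x) integrable_on {0..\<tau>}" for r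
    by (intro integrable_continuous_real continuous_intros cont_\<beta> cont)
  let ?I = "\<lambda>r. integral {0..\<tau>} (\<lambda>x. \<beta> r x *\<^sub>R w x)"
  have "integral {0..\<tau>} (\<lambda>x. (\<beta> s x - \<beta> t x) *\<^sub>R w x) = ?I s - ?I t"
    by (simp add: scaleR_diff_left integral_diff int)
  ultimately have 1: "norm (?I s - ?I t) \<le> B 1 * \<delta>" by simp
  have 2: "norm (?I s - B 1 *\<^sub>R w s) \<le> B 1 * \<eta>" using st \<epsilon> d1 by (intro mean) auto
  have 3: "norm (?I t - B 1 *\<^sub>R w t) \<le> B 1 * \<eta>" using st \<epsilon> d2 by (intro mean) auto
  have "B 1 * norm (w s - w t) = norm (B 1 *\<^sub>R w s - B 1 *\<^sub>R w t)"
    using B01(4) by (simp flip: scaleR_diff_right)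
  also have "\<dots> = norm ((?I s - ?I t) - (?I s - B 1 *\<^sub>R w s) + (?I t - B 1 *\<^sub>R w t))" by simp
  also have "\<dots> \<le> norm (?I s - ?I t) + norm (?I s - B 1 *\<^sub>R w s) + norm (?I t - B 1 *\<^sub>R w t)"
    by (rule order_trans[OF norm_triangle_ineq add_right_mono[OF norm_triangle_ineq4]])
  also have "\<dots> \<le> B 1 * (\<delta> + 2 * \<eta>)" using 1 2 3 by (simp add: algebra_simps)
  finally show "norm (w s - w t) \<le> \<delta> + \<eta>'" using B01(4) by (simp add: \<eta>_def)
qed

text \<open>The primitive is needed on the whole line. For each sign of \<open>t\<close> one of the
  two integrals in \<open>r\<close> vanishes; near a given point the base point is moved to
  \<open>- K\<close> so that a single integral is differentiated.\<close>

lemma C1_fun_antiderivative: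
  fixes q :: "real \<Rightarrow> 'a::banach"
  assumes "C1_fun q q'"
  obtains r where "C1_fun r q" "r 0 = 0" "\<And>t. 0 \<le> t \<Longrightarrow> r t = integral {0..t} q"
proof -
  have c: "continuous_on S q" for S by (rule C1_fun_continuous[OF assms])
  have qi: "q integrable_on {x..y}" for x y by (rule integrable_continuous_real[OF c])
  define r where "r t = integral {0..t} q - integral {t..0} q" for t
  have r_eq: "r t = integral {-K..t} q - integral {-K..0} q" if "\<bar>t\<bar> \<le> K" for t K
  proof (cases "0 \<le> t")
    case True
    then have "integral {t..0} q = 0" by (cases "t = 0") auto
    moreover have "integral {-K..0} q + integral {0..t} q = integral {-K..t} q"
      using that True by (intro Henstock_Kurzweil_Integration.integral_combine qi) auto
    ultimately show ?thesis by (simp add: r_def algebra_simps)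
  next
    case False
    moreover have "integral {-K..t} q + integral {t..0} q = integral {-K..0} q"
      using that False by (intro Henstock_Kurzweil_Integration.integral_combine qi) auto
    ultimately show ?thesis by (simp add: r_def algebra_simps)
  qed
  have "(r has_vector_derivative q x) (at x)" for x
  proof -
    let ?K = "\<bar>x\<bar> + 1"
    have "((\<lambda>t. integral {-?K..t} q) has_vector_derivative q x) (at x within {-?K..?K})"
      by (rule integral_has_vector_derivative[OF c]) auto
    then have "((\<lambda>t. integral {-?K..t} q) has_vector_derivative q x) (at x)"
      by (subst (asm) at_within_interior) auto
    then have "((\<lambda>t. integral {-?K..t} q - integral {-?K..0} q) has_vector_derivative q x) (at x)"
      by (auto intro!: derivative_eq_intros)
    then show ?thesis
    proof (rule has_vector_derivative_transform_within_open[where S = "{-?K<..<?K}"])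
      fix y assume "y \<in> {-?K<..<?K}"
      then show "integral {-?K..y} q - integral {-?K..0} q = r y"
        by (intro r_eq[symmetric]) auto
    qed auto
  qed
  then have "C1_fun r q" using c by (simp add: C1_fun_def)
  moreover have "r t = integral {0..t} q" if "0 \<le> t" for t
    using that by (cases "t = 0") (auto simp: r_def)
  ultimately show thesis using that by (auto simp: r_def)
qed

text \<open>Says that \<open>v\<close> is the primitive of \<open>g\<close> vanishing at 0, without
  integrating \<open>g\<close>: functions \<open>q\<close> close to \<open>g\<close> in L^1 have
  primitives \<open>r\<close> uniformly close to \<open>v\<close>.\<close>

definition C1_approximable_primitive :: "real \<Rightarrow> (real \<Rightarrow> 'a::real_normed_vector) \<Rightarrow> (real \<Rightarrow> 'a) \<Rightarrow> bool" where
  "C1_approximable_primitive \<tau> g v \<longleftrightarrow> (\<forall>\<epsilon>>0. \<exists>r q q' e. C1_fun r q \<and> C1_fun q q' \<and> r 0 = 0 \<and> e integrable_on {0..\<tau>} \<and>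
     integral {0..\<tau>} e < \<epsilon> \<and> (\<forall>t\<in>{0..\<tau>}. norm (g t - q t) \<le> e t) \<and> (\<forall>t\<in>{0..\<tau>}. norm (v t - r t) \<le> \<epsilon>))"

text \<open>If \<open>r\<close> is the primitive of an approximation \<open>q\<close> of the weak
  derivative \<open>g\<close>, then \<open>v - r\<close> has weak derivative \<open>g - q\<close>,
  which is small in L^1. Its increments are therefore small, and it vanishes at 0.\<close>

lemma W1p0_pos_C1_approx:
  fixes v :: "real \<Rightarrow> 'a::{banach,ordered_real_vector}"
  assumes v: "W1p0_pos p \<tau> v" and p: "1 \<le> p" and \<tau>: "0 < \<tau>"
  obtains g where "C1_approximable_primitive \<tau> g v"
proof -
  obtain g where g: "Lp_on p {0..\<tau>} g" and
    weak: "\<And>\<phi>. test_function \<tau> \<phi> \<Longrightarrow>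
      integral {0..\<tau>} (\<lambda>t. deriv \<phi> t *\<^sub>R v t) = - integral {0..\<tau>} (\<lambda>t. \<phi> t *\<^sub>R g t)"
    and vc: "continuous_on {0..\<tau>} v" and v0: "v 0 = 0"
    using v unfolding W1p0_pos_def by blast
  have approx: "C1_approximable 0 \<tau> g" by (rule Lp_on_C1_approximable[OF g p])
  \<comment> \<open>The weak identity is stated with \<open>integral\<close>, which has a default
    value on functions that are not integrable. Integrability must be known before the two sides can
    be combined with the integrals of \<open>q\<close>.\<close>
  have \<phi>g: "(\<lambda>t. \<phi> t *\<^sub>R g t) integrable_on {0..\<tau>}"
    if \<phi>: "continuous_on {0..\<tau>} \<phi>" "\<And>x. \<bar>\<phi> x\<bar> \<le> c" for \<phi> :: "real \<Rightarrow> real" and c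
  proof (rule integrable_if_L1_approx)
    fix \<epsilon> :: real assume "\<epsilon> > 0"
    have c: "0 \<le> c" using \<phi>(2)[of 0] by simp
    then have "\<epsilon> / (c + 1) > 0" using \<open>\<epsilon> > 0\<close> by simp
    then obtain q q' e where q: "C1_fun q q'" "e integrable_on {0..\<tau>}" "integral {0..\<tau>} e < \<epsilon> / (c + 1)"
        "\<And>t. t \<in> {0..\<tau>} \<Longrightarrow> norm (g t - q t) \<le> e t"
      by (rule C1_approximableD[OF approx]) (rule that)
    have "0 \<le> integral {0..\<tau>} e" using q(4) norm_ge_zero order_trans by (intro integral_nonneg q(2)) blast
    then have "(c + 1) * integral {0..\<tau>} e < \<epsilon>" "c * integral {0..\<tau>} e \<le> (c + 1) * integral {0..\<tau>} e"
      using q(3) c by (auto simp: field_simps)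
    then have "integral {0..\<tau>} (\<lambda>t. c * e t) < \<epsilon>" by simp
    moreover have "norm (\<phi> t *\<^sub>R g t - \<phi> t *\<^sub>R q t) \<le> c * e t" if "t \<in> {0..\<tau>}" for t
      using q(4)[OF that] \<phi>(2)[of t] c by (simp add: mult_mono flip: scaleR_diff_right)
    moreover have "(\<lambda>t. \<phi> t *\<^sub>R q t) integrable_on {0..\<tau>}"
      by (intro integrable_continuous_real continuous_intros \<phi> C1_fun_continuous[OF q(1)])
    moreover have "(\<lambda>t. c * e t) integrable_on {0..\<tau>}" by (rule integrable_on_mult_right[OF q(2)])
    ultimately show "\<exists>q e. q integrable_on {0..\<tau>} \<and> e integrable_on {0..\<tau>} \<and> integral {0..\<tau>} e < \<epsilon> \<and>
        (\<forall>t\<in>{0..\<tau>}. norm (\<phi> t *\<^sub>R g t - q t) \<le> e t)"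
      by blast
  qed
  show thesis
  proof (rule that[of g], unfold C1_approximable_primitive_def, intro allI impI)
    fix \<epsilon> :: real assume "\<epsilon> > 0"
    then obtain q q' e where q: "C1_fun q q'" "e integrable_on {0..\<tau>}" "integral {0..\<tau>} e < \<epsilon>"
        "\<And>t. t \<in> {0..\<tau>} \<Longrightarrow> norm (g t - q t) \<le> e t"
      by (rule C1_approximableD[OF approx]) (rule that)
    obtain r where r: "C1_fun r q" "r 0 = 0" by (rule C1_fun_antiderivative[OF q(1)]) (rule that)
    let ?w = "\<lambda>t. v t - r t"
    have wc: "continuous_on {0..\<tau>} ?w" by (intro continuous_intros vc C1_fun_continuous[OF r(1)])
    have bound: "norm (integral {0..\<tau>} (\<lambda>x. deriv \<phi> x *\<^sub>R ?w x)) \<le> c * integral {0..\<tau>} e"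
      if test: "test_function \<tau> \<phi>" and c: "\<And>x. \<bar>\<phi> x\<bar> \<le> c" for \<phi> c
    proof -
      have d: "((deriv ^^ k) \<phi> has_real_derivative (deriv ^^ Suc k) \<phi> x) (at x)" for k x
        using test unfolding test_function_def by blast
      have d0: "(\<phi> has_real_derivative deriv \<phi> x) (at x)" for x using d[of 0 x] by simp
      have d1: "(deriv \<phi> has_real_derivative deriv (deriv \<phi>) x) (at x)" for x using d[of 1 x] by simp
      have c0: "continuous_on S \<phi>" for S by (rule DERIV_continuous_on) (rule has_field_derivative_at_within[OF d0])
      have c1: "continuous_on S (deriv \<phi>)" for S
        by (rule DERIV_continuous_on) (rule has_field_derivative_at_within[OF d1])
      obtain a b where ab: "0 < a" "b < \<tau>" "\<And>t. t \<notin> {a..b} \<Longrightarrow> \<phi> t = 0"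
        using test unfolding test_function_def by blast
      have zero: "\<phi> 0 = 0" "\<phi> \<tau> = 0" using ab by auto
      \<comment> \<open>Integration by parts for the smooth pair \<open>r\<close>, \<open>q\<close>;
        the test function vanishes at both ends, so no boundary terms remain.\<close>
      have "((\<lambda>x. \<phi> x *\<^sub>R q x + deriv \<phi> x *\<^sub>R r x) has_integral (\<phi> \<tau> *\<^sub>R r \<tau> - \<phi> 0 *\<^sub>R r 0)) {0..\<tau>}"
        using \<tau> by (intro fundamental_theorem_of_calculus)
          (auto intro!: has_vector_derivative_scaleR has_field_derivative_at_within[OF d0] C1_fun_has_derivative[OF r(1)])
      then have "integral {0..\<tau>} (\<lambda>x. \<phi> x *\<^sub>R q x + deriv \<phi> x *\<^sub>R r x) = 0"
        by (simp add: zero integral_unique)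
      moreover have i1: "(\<lambda>x. \<phi> x *\<^sub>R q x) integrable_on {0..\<tau>}"
        by (intro integrable_continuous_real continuous_intros c0 C1_fun_continuous[OF q(1)])
      moreover have i2: "(\<lambda>x. deriv \<phi> x *\<^sub>R r x) integrable_on {0..\<tau>}"
        by (intro integrable_continuous_real continuous_intros c1 C1_fun_continuous[OF r(1)])
      moreover have i3: "(\<lambda>x. deriv \<phi> x *\<^sub>R v x) integrable_on {0..\<tau>}"
        by (intro integrable_continuous_real continuous_intros c1 vc)
      ultimately have "integral {0..\<tau>} (\<lambda>x. \<phi> x *\<^sub>R q x) = - integral {0..\<tau>} (\<lambda>x. deriv \<phi> x *\<^sub>R r x)"
        by (simp add: integral_add eq_neg_iff_add_eq_0)
      then have "integral {0..\<tau>} (\<lambda>x. deriv \<phi> x *\<^sub>R ?w x)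
          = integral {0..\<tau>} (\<lambda>x. \<phi> x *\<^sub>R q x) - integral {0..\<tau>} (\<lambda>x. \<phi> x *\<^sub>R g x)"
        using weak[OF test] i2 i3 by (simp add: scaleR_diff_right integral_diff)
      also have "\<dots> = integral {0..\<tau>} (\<lambda>x. \<phi> x *\<^sub>R q x - \<phi> x *\<^sub>R g x)"
        by (intro integral_diff[symmetric] i1 \<phi>g[OF c0 c])
      also have "norm \<dots> \<le> integral {0..\<tau>} (\<lambda>x. c * e x)"
      proof (rule integral_norm_bound_integral)
        show "(\<lambda>x. \<phi> x *\<^sub>R q x - \<phi> x *\<^sub>R g x) integrable_on {0..\<tau>}"
          by (intro integrable_diff i1 \<phi>g[OF c0 c])
        show "(\<lambda>x. c * e x) integrable_on {0..\<tau>}" by (rule integrable_on_mult_right[OF q(2)])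
        fix x assume x: "x \<in> {0..\<tau>}"
        have "norm (\<phi> x *\<^sub>R q x - \<phi> x *\<^sub>R g x) = \<bar>\<phi> x\<bar> * norm (g x - q x)"
          by (simp add: norm_minus_commute flip: scaleR_diff_right)
        also have "\<dots> \<le> c * e x" using q(4)[OF x] c[of x] by (intro mult_mono) auto
        finally show "norm (\<phi> x *\<^sub>R q x - \<phi> x *\<^sub>R g x) \<le> c * e x" .
      qed
      finally show ?thesis by simp
    qed
    have inner: "norm (?w s - ?w t) \<le> \<epsilon>" if "0 < s" "s < t" "t < \<tau>" for s t
    proof -
      have "norm (?w s - ?w t) \<le> integral {0..\<tau>} e"
        by (rule weak_derivative_increment[OF wc _ that]) (rule bound)
      then show ?thesis using q(3) by linarith
    qed
    \<comment> \<open>The increment bound holds only between interior points; letting the left point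
      tend to 0 brings in the initial value 0.\<close>
    have start: "norm (?w t) \<le> \<epsilon>" if t: "0 < t" "t < \<tau>" for t
    proof -
      have "((\<lambda>s. norm (?w s - ?w t)) \<longlongrightarrow> norm (?w 0 - ?w t)) (at 0 within {0..\<tau>})"
        using wc \<tau> unfolding continuous_on_def
        by (intro tendsto_norm tendsto_diff[OF _ tendsto_const]) simp
      then have "((\<lambda>s. norm (?w s - ?w t)) \<longlongrightarrow> norm (?w 0 - ?w t)) (at_right 0)"
        using \<tau> by (simp add: at_within_Icc_at_right)
      moreover have "\<forall>\<^sub>F s in at_right 0. norm (?w s - ?w t) \<le> \<epsilon>"
        using eventually_at_right_real[OF t(1)] by eventually_elim (use t in \<open>auto intro!: inner\<close>)
      ultimately have "norm (?w 0 - ?w t) \<le> \<epsilon>" by (rule tendsto_upperbound) simp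
      then show ?thesis by (simp add: v0 r(2) norm_minus_commute)
    qed
    have all: "norm (?w t) \<le> \<epsilon>" if "t \<in> {0..\<tau>}" for t
    proof -
      from that have "0 \<le> t" "t \<le> \<tau>" by auto
      then consider "t = 0" | "0 < t" "t < \<tau>" | "t = \<tau>" by linarith
      then show ?thesis
      proof cases
        case 1
        then show ?thesis using \<open>\<epsilon> > 0\<close> by (simp add: v0 r(2))
      next
        case 3
        have "((\<lambda>s. norm (?w s)) \<longlongrightarrow> norm (?w \<tau>)) (at \<tau> within {0..\<tau>})"
          using wc \<tau> unfolding continuous_on_def by (intro tendsto_norm) simp
        then have "((\<lambda>s. norm (?w s)) \<longlongrightarrow> norm (?w \<tau>)) (at_left \<tau>)"
          using \<tau> by (simp add: at_within_Icc_at_left)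
        moreover have "\<forall>\<^sub>F s in at_left \<tau>. norm (?w s) \<le> \<epsilon>"
          using eventually_at_left_real[OF \<tau>] by eventually_elim (auto intro!: start)
        ultimately show ?thesis unfolding 3 by (rule tendsto_upperbound) simp
      qed (rule start)
    qed
    show "\<exists>r q q' e. C1_fun r q \<and> C1_fun q q' \<and> r 0 = 0 \<and> e integrable_on {0..\<tau>} \<and>
       integral {0..\<tau>} e < \<epsilon> \<and> (\<forall>t\<in>{0..\<tau>}. norm (g t - q t) \<le> e t) \<and> (\<forall>t\<in>{0..\<tau>}. norm (v t - r t) \<le> \<epsilon>)"
      using r q all by blast
  qed
qed

section \<open>Semigroups and convolutions\<close>

lemma has_vector_derivative_at_right_quotient:
  assumes "(f has_vector_derivative c) (at (0::real))"
  shows "((\<lambda>h. (1 / h) *\<^sub>R (f h - f 0)) \<longlongrightarrow> c) (at_right 0)"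
proof -
  have "(f has_derivative (\<lambda>h. h *\<^sub>R c)) (at_right 0)"
    using has_vector_derivative_at_within[OF assms] by (simp add: has_vector_derivative_def)
  then have "((\<lambda>h. (1 / norm (h - 0)) *\<^sub>R (f h - (f 0 + (h - 0) *\<^sub>R c))) \<longlongrightarrow> 0) (at_right 0)"
    unfolding has_derivative_within by blast
  from tendsto_add[OF this tendsto_const[of c]]
  have "((\<lambda>h. (1 / norm h) *\<^sub>R (f h - (f 0 + h *\<^sub>R c)) + c) \<longlongrightarrow> c) (at_right 0)" by simp
  then show ?thesis
    by (rule Lim_transform_eventually)
      (use eventually_at_right_less[of 0] in eventually_elim, simp add: scaleR_diff_right scaleR_add_right)
qed

locale bounded_C0_semigroup =
  fixes T :: "real \<Rightarrow> 'a::banach \<Rightarrow> 'a" and D :: "'a set" and A :: "'a \<Rightarrow> 'a" and M w :: real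
  assumes C0: "C0_semigroup T" and gen: "generator T D A"
    and M_pos: "0 < M" and growth: "\<And>t x. 0 \<le> t \<Longrightarrow> norm (T t x) \<le> M * exp (w * t) * norm x"
begin

text \<open>The absolute value makes the bound increasing, so \<open>K t\<close> controls the norms
  of \<open>T s\<close> for all \<open>s\<close> in [0, t] at once, whatever the sign of
  \<open>w\<close>.\<close>

definition K :: "real \<Rightarrow> real" where "K t = M * exp (\<bar>w\<bar> * t)"

lemma K_pos: "0 < K t"
  using M_pos by (simp add: K_def)

lemma linear_T: "0 \<le> t \<Longrightarrow> bounded_linear (T t)"
  and T_0: "T 0 x = x"
  and T_add: "0 \<le> s \<Longrightarrow> 0 \<le> t \<Longrightarrow> T (s + t) x = T s (T t x)"
  and T_right: "((\<lambda>t. T t x) \<longlongrightarrow> x) (at_right 0)"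
  using C0 unfolding C0_semigroup_def by blast+

lemma T_bound:
  assumes "0 \<le> t" "t \<le> \<tau>" shows "norm (T t x) \<le> K \<tau> * norm x"
proof -
  have "w * t \<le> \<bar>w\<bar> * \<tau>" using assms by (intro mult_mono) auto
  then have "M * exp (w * t) * norm x \<le> K \<tau> * norm x"
    unfolding K_def using M_pos by (intro mult_right_mono mult_left_mono) auto
  then show ?thesis using growth[OF assms(1), of x] by linarith
qed

lemma T_diff: "0 \<le> t \<Longrightarrow> T t (x - y) = T t x - T t y"
  and T_scaleR: "0 \<le> t \<Longrightarrow> T t (c *\<^sub>R x) = c *\<^sub>R T t x"
  and T_sum: "0 \<le> t \<Longrightarrow> T t (x + y) = T t x + T t y"
  using linear_T[of t] by (simp_all add: linear_simps)

text \<open>Only right continuity at 0 is given. For times a < b the difference factors as T(a) (T(b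
  - a) x - x) with the smaller time outside, so a bound of the semigroup up to \<open>t + 1\<close>
  gives continuity from both sides.\<close>

lemma orbit_continuous: "continuous_on {0..} (\<lambda>t. T t x)"
  unfolding continuous_on_iff
proof (intro ballI allI impI)
  fix t e :: real assume t: "t \<in> {0..}" and e: "0 < e"
  let ?K = "K (t + 1)"
  have "\<forall>\<^sub>F h in at_right 0. dist (T h x) x < e / ?K"
    using T_right[of x] e K_pos[of "t + 1"] by (intro tendstoD) auto
  then obtain d where d: "d > 0" "\<And>h. 0 < h \<Longrightarrow> h < d \<Longrightarrow> norm (T h x - x) < e / ?K"
    by (auto simp: eventually_at_right_field dist_norm)
  have step: "norm (T b x - T a x) < e" if "0 \<le> a" "a \<le> t + 1" "a < b" "b - a < d" for a b
  proof -
    have "T b x - T a x = T a (T (b - a) x - x)"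
      using T_add[of a "b - a" x] that by (simp add: T_diff)
    then have "norm (T b x - T a x) \<le> ?K * norm (T (b - a) x - x)" using T_bound that by simp
    also have "\<dots> < e" using d(2)[of "b - a"] that K_pos[of "t + 1"] by (simp add: field_simps)
    finally show ?thesis .
  qed
  show "\<exists>d>0. \<forall>s\<in>{0..}. dist s t < d \<longrightarrow> dist (T s x) (T t x) < e"
  proof (intro exI[of _ "min d 1"] conjI ballI impI)
    fix s assume s: "s \<in> {0..}" "dist s t < min d 1"
    consider "s < t" | "s = t" | "t < s" by linarith
    then show "dist (T s x) (T t x) < e"
    proof cases
      case 1
      then show ?thesis using step[of s t] s t by (simp add: dist_norm norm_minus_commute)
    next
      case 3
      then show ?thesis using step[of t s] s t by (simp add: dist_norm)
    qed (use e in simp)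
  qed (use d in simp)
qed

lemma T_tendsto:
  assumes f: "(f \<longlongrightarrow> a) F" and g: "(g \<longlongrightarrow> b) F" and a: "0 \<le> a" and pos: "\<forall>\<^sub>F x in F. 0 \<le> f x"
  shows "((\<lambda>x. T (f x) (g x)) \<longlongrightarrow> T a b) F"
proof -
  have "((\<lambda>x. T (f x) (g x - b)) \<longlongrightarrow> 0) F"
  proof (rule Lim_null_comparison)
    have "\<forall>\<^sub>F x in F. f x < a + 1" using f by (rule order_tendstoD) simp
    with pos show "\<forall>\<^sub>F x in F. norm (T (f x) (g x - b)) \<le> K (a + 1) * norm (g x - b)"
      by eventually_elim (rule T_bound, auto)
    have "((\<lambda>x. norm (g x - b)) \<longlongrightarrow> 0) F" using g by (simp add: LIM_zero_iff tendsto_norm_zero)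
    then show "((\<lambda>x. K (a + 1) * norm (g x - b)) \<longlongrightarrow> 0) F" by (rule tendsto_mult_right_zero)
  qed
  moreover have "((\<lambda>x. T (f x) b) \<longlongrightarrow> T a b) F"
    by (rule continuous_on_tendsto_compose[OF orbit_continuous f]) (use a pos in auto)
  ultimately have "((\<lambda>x. T (f x) (g x - b) + T (f x) b) \<longlongrightarrow> 0 + T a b) F" by (rule tendsto_add)
  then have "((\<lambda>x. T (f x) (g x - b) + T (f x) b) \<longlongrightarrow> T a b) F" by simp
  moreover have "\<forall>\<^sub>F x in F. T (f x) (g x - b) + T (f x) b = T (f x) (g x)"
    using pos by eventually_elim (simp add: T_diff)
  ultimately show ?thesis by (rule Lim_transform_eventually)
qed

lemma T_continuous_on [continuous_intros]:
  assumes "continuous_on S f" "continuous_on S g" "\<And>x. x \<in> S \<Longrightarrow> 0 \<le> f x"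
  shows "continuous_on S (\<lambda>x. T (f x) (g x))"
  unfolding continuous_on_def
proof
  fix x assume x: "x \<in> S"
  have "\<forall>\<^sub>F y in at x within S. 0 \<le> f y"
    using assms(3) by (simp add: eventually_at_topological) blast
  then show "((\<lambda>x. T (f x) (g x)) \<longlongrightarrow> T (f x) (g x)) (at x within S)"
    using assms x by (intro T_tendsto) (auto simp: continuous_on_def)
qed

section \<open>Convolution with the semigroup\<close>

definition conv :: "(real \<Rightarrow> 'a) \<Rightarrow> real \<Rightarrow> 'a" where
  "conv f t = integral {0..t} (\<lambda>s. T (t - s) (f s))"

lemma conv_integrable:
  "continuous_on {a..b} f \<Longrightarrow> b \<le> t \<Longrightarrow> (\<lambda>s. T (t - s) (f s)) integrable_on {a..b}"
  by (intro integrable_continuous_real continuous_intros) auto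

lemma conv_reflect:
  assumes "continuous_on {0..t} f" "0 \<le> t"
  shows "conv f t = integral {0..t} (\<lambda>s. T s (f (t - s)))"
proof -
  have "((\<lambda>s. T (t - s) (f s)) has_integral conv f t) (cbox 0 t)"
    unfolding conv_def using conv_integrable[OF assms(1) order_refl] by (simp add: integrable_integral)
  from has_integral_affinity[OF this, of "-1" t]
  have "((\<lambda>s. T s (f (t - s))) has_integral conv f t) ((\<lambda>x. t - x) ` {0..t})" by (simp add: add.commute)
  moreover have "(\<lambda>x. t - x) ` {0..t} = {0..t}" using assms(2) by (auto simp: image_iff intro: bexI[of _ "t - _"])
  ultimately show ?thesis by (simp add: integral_unique)
qed

lemma conv_add:
  assumes "continuous_on {0..t} f" "continuous_on {0..t} g"
  shows "conv (\<lambda>s. f s + g s) t = conv f t + conv g t"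
proof -
  have "conv (\<lambda>s. f s + g s) t = integral {0..t} (\<lambda>s. T (t - s) (f s) + T (t - s) (g s))"
    unfolding conv_def by (rule integral_cong) (simp add: T_sum)
  also have "\<dots> = conv f t + conv g t"
    unfolding conv_def by (intro integral_add conv_integrable assms order_refl)
  finally show ?thesis .
qed

lemma conv_scaleR: "conv (\<lambda>s. c *\<^sub>R f s) t = c *\<^sub>R conv f t"
proof -
  have "conv (\<lambda>s. c *\<^sub>R f s) t = integral {0..t} (\<lambda>s. c *\<^sub>R T (t - s) (f s))"
    unfolding conv_def by (rule integral_cong) (simp add: T_scaleR)
  then show ?thesis by (simp add: conv_def)
qed

lemma conv_diff:
  assumes "continuous_on {0..t} f" "continuous_on {0..t} g"
  shows "conv (\<lambda>s. f s - g s) t = conv f t - conv g t"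
  using conv_add[OF assms(1) continuous_on_minus[OF assms(2)]] conv_scaleR[of "-1" g t] by simp

lemma conv_bounded_linear:
  assumes L: "bounded_linear L" and comm: "\<And>t x. 0 \<le> t \<Longrightarrow> L (T t x) = T t (L x)"
    and f: "continuous_on {0..t} f"
  shows "conv (\<lambda>s. L (f s)) t = L (conv f t)"
proof -
  have "conv (\<lambda>s. L (f s)) t = integral {0..t} (\<lambda>s. L (T (t - s) (f s)))"
    unfolding conv_def by (rule integral_cong) (simp add: comm)
  also have "\<dots> = L (conv f t)"
    unfolding conv_def using integral_linear[OF conv_integrable[OF f order_refl] L] by (simp add: o_def)
  finally show ?thesis .
qed

lemma norm_conv_le:
  assumes f: "continuous_on {0..t} f" and N: "N integrable_on {0..t}"
    and le: "\<And>s. s \<in> {0..t} \<Longrightarrow> norm (f s) \<le> N s"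
  shows "norm (conv f t) \<le> K t * integral {0..t} N"
proof -
  have "norm (conv f t) \<le> integral {0..t} (\<lambda>s. K t * N s)"
    unfolding conv_def
  proof (rule integral_norm_bound_integral[OF conv_integrable[OF f order_refl]])
    show "(\<lambda>s. K t * N s) integrable_on {0..t}" by (rule integrable_on_mult_right[OF N])
    fix s assume s: "s \<in> {0..t}"
    then have "norm (T (t - s) (f s)) \<le> K t * norm (f s)" by (intro T_bound) auto
    also have "\<dots> \<le> K t * N s" using le[OF s] K_pos[of t] by simp
    finally show "norm (T (t - s) (f s)) \<le> K t * N s" .
  qed
  then show ?thesis by simp
qed

text \<open>The upper limit of integration varies with \<open>t\<close>. Replacing \<open>s\<close>
  by \<open>min s t\<close> fixes the domain: beyond \<open>t\<close> the integrand is the constant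
  \<open>f t\<close>, whose contribution is subtracted again.\<close>

lemma conv_continuous:
  assumes f: "continuous_on {0..\<tau>} f"
  shows "continuous_on {0..\<tau>} (conv f)"
proof -
  let ?q = "\<lambda>t s. T (t - min s t) (f (min s t))"
  have "continuous_on {0..\<tau>} (\<lambda>t. integral (cbox 0 \<tau>) (?q t))"
  proof (rule integral_continuous_on_param)
    have "continuous_on ({0..\<tau>} \<times> {0..\<tau>}) (\<lambda>z. T (fst z - min (snd z) (fst z)) (f (min (snd z) (fst z))))"
      by (intro continuous_intros continuous_on_compose2[OF f]) (auto simp: min_def)
    then show "continuous_on ({0..\<tau>} \<times> cbox 0 \<tau>) (\<lambda>(t, s). ?q t s)" by (simp add: split_def)
  qed
  then have "continuous_on {0..\<tau>} (\<lambda>t. integral {0..\<tau>} (?q t) - (\<tau> - t) *\<^sub>R f t)"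
    using f by (intro continuous_intros) auto
  moreover have "integral {0..\<tau>} (?q t) - (\<tau> - t) *\<^sub>R f t = conv f t" if t: "t \<in> {0..\<tau>}" for t
  proof -
    have "continuous_on {0..\<tau>} (?q t)"
      using t by (intro continuous_intros continuous_on_compose2[OF f]) (auto simp: min_def)
    then have "integral {0..t} (?q t) + integral {t..\<tau>} (?q t) = integral {0..\<tau>} (?q t)"
      using t by (intro Henstock_Kurzweil_Integration.integral_combine integrable_continuous_real) auto
    moreover have "integral {0..t} (?q t) = conv f t"
      unfolding conv_def by (rule integral_cong) (simp add: min_def)
    moreover have "integral {t..\<tau>} (?q t) = integral {t..\<tau>} (\<lambda>s. f t)"
      by (rule integral_cong) (auto simp: min_def T_0)
    ultimately show ?thesis using t by (simp add: content_real algebra_simps)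
  qed
  ultimately show ?thesis by (rule continuous_on_eq)
qed

text \<open>Joint continuity of (a, b) \<mapsto> T(a) f(b) makes the integrand uniformly close to
  its limit on a shrinking interval. The general arguments \<open>\<alpha>\<close> and
  \<open>\<beta>\<close> cover both boundary terms of \<open>conv_C1\<close>, where the roles of
  \<open>s\<close> and \<open>t + h - s\<close> are exchanged.\<close>

lemma average_tendsto:
  fixes f :: "real \<Rightarrow> 'a"
  assumes f: "continuous_on UNIV f" and a: "0 \<le> a" and t: "0 \<le> t"
    and \<alpha>: "\<And>s h. 0 < h \<Longrightarrow> s \<in> {t..t + h} \<Longrightarrow> 0 \<le> \<alpha> s h \<and> \<bar>\<alpha> s h - a\<bar> \<le> h"
    and \<beta>: "\<And>s h. 0 < h \<Longrightarrow> s \<in> {t..t + h} \<Longrightarrow> \<bar>\<beta> s h - b\<bar> \<le> h"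
    and int: "\<And>h. 0 < h \<Longrightarrow> (\<lambda>s. T (\<alpha> s h) (f (\<beta> s h))) integrable_on {t..t + h}"
  shows "((\<lambda>h. (1 / h) *\<^sub>R integral {t..t + h} (\<lambda>s. T (\<alpha> s h) (f (\<beta> s h)))) \<longlongrightarrow> T a (f b)) (at_right 0)"
proof (rule tendstoI)
  fix e :: real assume e: "0 < e"
  have "continuous_on ({0..} \<times> UNIV) (\<lambda>z. T (fst z) (f (snd z)))"
    by (intro continuous_intros continuous_on_compose2[OF f]) auto
  then obtain d where d: "d > 0"
    "\<And>z. z \<in> {0..} \<times> UNIV \<Longrightarrow> dist z (a, b) < d \<Longrightarrow> dist (T (fst z) (f (snd z))) (T a (f b)) < e / 2"
    unfolding continuous_on_iff using a e by (metis (no_types, lifting) SigmaI UNIV_I atLeast_iff fst_conv half_gt_zero snd_conv)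
  have "\<forall>\<^sub>F h in at_right 0. h \<in> {0<..<d/2}"
    using d(1) by (intro eventually_at_right_real) simp
  then show "\<forall>\<^sub>F h in at_right 0. dist ((1 / h) *\<^sub>R integral {t..t + h} (\<lambda>s. T (\<alpha> s h) (f (\<beta> s h)))) (T a (f b)) < e"
  proof eventually_elim
    fix h assume h: "h \<in> {0<..<d/2}"
    let ?q = "\<lambda>s. T (\<alpha> s h) (f (\<beta> s h))"
    have close: "norm (?q s - T a (f b)) \<le> e / 2" if s: "s \<in> {t..t + h}" for s
    proof -
      have "dist (\<alpha> s h, \<beta> s h) (a, b) \<le> dist (\<alpha> s h) a + dist (\<beta> s h) b"
        unfolding dist_Pair_Pair by (rule sqrt_sum_squares_le_sum) auto
      also have "\<dots> < d" using \<alpha>[of h s] \<beta>[of h s] h s by (auto simp: dist_real_def)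
      finally show ?thesis
        using d(2)[of "(\<alpha> s h, \<beta> s h)"] \<alpha>[of h s] h s by (simp add: dist_norm less_imp_le)
    qed
    have "integral {t..t + h} ?q - h *\<^sub>R T a (f b) = integral {t..t + h} (\<lambda>s. ?q s - T a (f b))"
      using h int[of h] by (subst integral_diff) (auto simp: content_real)
    also have "norm \<dots> \<le> integral {t..t + h} (\<lambda>s. e / 2)"
      using h int[of h] close by (intro integral_norm_bound_integral) (auto intro: integrable_diff)
    finally have "norm (integral {t..t + h} ?q - h *\<^sub>R T a (f b)) \<le> h * (e / 2)"
      using h by (simp add: content_real)
    moreover have "norm ((1 / h) *\<^sub>R integral {t..t + h} ?q - T a (f b)) =
        norm (integral {t..t + h} ?q - h *\<^sub>R T a (f b)) / h"
    proof -
      have "(1 / h) *\<^sub>R integral {t..t + h} ?q - T a (f b) = (1 / h) *\<^sub>R (integral {t..t + h} ?q - h *\<^sub>R T a (f b))"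
        using h by (simp add: scaleR_diff_right)
      then show ?thesis using h by (simp only: norm_scaleR) simp
    qed
    ultimately have "norm ((1 / h) *\<^sub>R integral {t..t + h} ?q - T a (f b)) \<le> e / 2"
      using h by (simp add: pos_divide_le_eq mult.commute)
    then show "dist ((1 / h) *\<^sub>R integral {t..t + h} ?q) (T a (f b)) < e" using e by (simp add: dist_norm)
  qed
qed

section \<open>The generator\<close>

lemma generator_iff: "x \<in> D \<and> A x = y \<longleftrightarrow> ((\<lambda>h. (1 / h) *\<^sub>R (T h x - x)) \<longlongrightarrow> y) (at_right 0)"
  using gen tendsto_unique[OF trivial_limit_at_right_real] unfolding generator_def by metis

lemma generator_lim: "x \<in> D \<Longrightarrow> ((\<lambda>h. (1 / h) *\<^sub>R (T h x - x)) \<longlongrightarrow> A x) (at_right 0)"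
  using gen unfolding generator_def by blast

lemma eventually_nonneg_at_right: "\<forall>\<^sub>F h::real in at_right 0. 0 \<le> h"
  by (auto simp: eventually_at_right_field intro: exI[of _ 1])

lemma D_scaleR: "x \<in> D \<Longrightarrow> c *\<^sub>R x \<in> D \<and> A (c *\<^sub>R x) = c *\<^sub>R A x"
  unfolding generator_iff
proof -
  assume "x \<in> D"
  then have "((\<lambda>h. c *\<^sub>R ((1 / h) *\<^sub>R (T h x - x))) \<longlongrightarrow> c *\<^sub>R A x) (at_right 0)"
    by (intro tendsto_scaleR tendsto_const generator_lim)
  then show "((\<lambda>h. (1 / h) *\<^sub>R (T h (c *\<^sub>R x) - c *\<^sub>R x)) \<longlongrightarrow> c *\<^sub>R A x) (at_right 0)"
    by (rule Lim_transform_eventually)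
      (use eventually_nonneg_at_right in eventually_elim, simp add: T_scaleR scaleR_diff_right mult.commute)
qed

lemma generator_bounded_linear:
  assumes x: "x \<in> D" and L: "bounded_linear L" and comm: "\<And>t y. 0 \<le> t \<Longrightarrow> L (T t y) = T t (L y)"
  shows "L x \<in> D \<and> A (L x) = L (A x)"
  unfolding generator_iff
proof -
  have "((\<lambda>h. L ((1 / h) *\<^sub>R (T h x - x))) \<longlongrightarrow> L (A x)) (at_right 0)"
    by (rule bounded_linear.tendsto[OF L generator_lim[OF x]])
  then show "((\<lambda>h. (1 / h) *\<^sub>R (T h (L x) - L x)) \<longlongrightarrow> L (A x)) (at_right 0)"
    by (rule Lim_transform_eventually)
      (use eventually_nonneg_at_right in eventually_elim, simp add: linear_simps[OF L] comm)
qed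

lemma T_commute: "0 \<le> t \<Longrightarrow> 0 \<le> s \<Longrightarrow> T t (T s y) = T s (T t y)"
  by (metis T_add add.commute)

lemma generator_T: "x \<in> D \<Longrightarrow> 0 \<le> t \<Longrightarrow> T t x \<in> D \<and> A (T t x) = T t (A x)"
  by (rule generator_bounded_linear[OF _ linear_T]) (auto intro: T_commute)

text \<open>Writing \<open>conv f (t + h)\<close> once with the difference placed on
  \<open>f\<close> and once with it placed on \<open>T\<close> gives T(h) y - y = (P(h) - P(0)) +
  Q(h) - R(h) for \<open>y = conv f t\<close>. After division by \<open>h\<close> these three parts
  tend to \<open>conv f' t\<close>, \<open>T t (f 0)\<close> and \<open>f t\<close>; the derivative
  falls on \<open>f\<close>, so no value of \<open>f\<close> has to lie in \<open>D\<close>.\<close>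

lemma conv_C1:
  assumes f: "C1_fun f f'" and t: "0 \<le> t"
  shows "conv f t \<in> D \<and> A (conv f t) = conv f' t + T t (f 0) - f t"
  unfolding generator_iff
proof -
  have fc: "continuous_on S f" and f'c: "continuous_on S f'" for S
    using C1_fun_continuous[OF f] C1_fun_continuous'[OF f] by auto
  have fc': "continuous_on S (\<lambda>s. f (g s))" if "continuous_on S g" for S :: "'c::topological_space set" and g
    by (rule continuous_on_compose2[OF fc that]) auto
  let ?P = "\<lambda>h. integral {0..t} (\<lambda>s. T s (f (t + h - s)))"
  let ?Q = "\<lambda>h. integral {t..t + h} (\<lambda>s. T s (f (t + h - s)))"
  let ?R = "\<lambda>h. integral {t..t + h} (\<lambda>s. T (t + h - s) (f s))"
  have "((\<lambda>h. integral (cbox 0 t) (\<lambda>s. T s (f (t + h - s)))) has_vector_derivative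
      integral (cbox 0 t) (\<lambda>s. T s (f' (t + 0 - s)))) (at 0 within UNIV)"
  proof (rule leibniz_rule_vector_derivative)
    fix h s assume s: "s \<in> cbox 0 t"
    have "((\<lambda>h. f (t + h - s)) has_vector_derivative f' (t + h - s)) (at h)"
    proof -
      have "((\<lambda>h. t + h - s) has_vector_derivative 1) (at h)" by (auto intro!: derivative_eq_intros)
      from vector_diff_chain_at[OF this, of f "f' (t + h - s)"] C1_fun_has_derivative[OF f, of "t + h - s" UNIV]
      show ?thesis by (simp add: o_def)
    qed
    then show "((\<lambda>h. T s (f (t + h - s))) has_vector_derivative T s (f' (t + h - s))) (at h within UNIV)"
      using s by (intro bounded_linear.has_vector_derivative[OF linear_T]) auto
  next
    show "(\<lambda>s. T s (f (t + h - s))) integrable_on cbox 0 t" for h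
      unfolding cbox_interval by (intro integrable_continuous_real continuous_intros fc') auto
    have "continuous_on (UNIV \<times> cbox 0 t) (\<lambda>z. T (snd z) (f' (t + fst z - snd z)))"
      by (intro continuous_intros continuous_on_compose2[OF f'c]) auto
    then show "continuous_on (UNIV \<times> cbox 0 t) (\<lambda>(h, s). T s (f' (t + h - s)))"
      by (simp add: split_def)
  qed auto
  moreover have "integral (cbox 0 t) (\<lambda>s. T s (f' (t + 0 - s))) = conv f' t"
    using conv_reflect[OF f'c t] by simp
  ultimately have "(?P has_vector_derivative conv f' t) (at 0)" by simp
  then have "((\<lambda>h. (1 / h) *\<^sub>R (?P h - ?P 0)) \<longlongrightarrow> conv f' t) (at_right 0)"
    by (rule has_vector_derivative_at_right_quotient)
  moreover have "((\<lambda>h. (1 / h) *\<^sub>R ?Q h) \<longlongrightarrow> T t (f 0)) (at_right 0)"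
    by (rule average_tendsto[OF fc t t])
      (use t in \<open>auto intro!: integrable_continuous_real continuous_intros fc'\<close>)
  moreover have "((\<lambda>h. (1 / h) *\<^sub>R ?R h) \<longlongrightarrow> T 0 (f t)) (at_right 0)"
    by (rule average_tendsto[OF fc order_refl t])
      (use t in \<open>auto intro!: integrable_continuous_real continuous_intros fc'\<close>)
  ultimately have "((\<lambda>h. (1 / h) *\<^sub>R (?P h - ?P 0) + (1 / h) *\<^sub>R ?Q h - (1 / h) *\<^sub>R ?R h) \<longlongrightarrow>
      conv f' t + T t (f 0) - f t) (at_right 0)"
    by (intro tendsto_intros) (simp_all add: T_0)
  moreover have "\<forall>\<^sub>F h in at_right 0. (1 / h) *\<^sub>R (?P h - ?P 0) + (1 / h) *\<^sub>R ?Q h - (1 / h) *\<^sub>R ?R h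
      = (1 / h) *\<^sub>R (T h (conv f t) - conv f t)"
    using eventually_at_right_less[of 0]
  proof eventually_elim
    case (elim h)
    have "conv f (t + h) = ?P h + ?Q h"
      using elim t
      by (subst conv_reflect[OF fc], simp, subst Henstock_Kurzweil_Integration.integral_combine)
        (auto intro!: integrable_continuous_real continuous_intros fc')
    moreover have "conv f (t + h) = integral {0..t} (\<lambda>s. T (t + h - s) (f s)) + ?R h"
      unfolding conv_def using elim t
      by (subst Henstock_Kurzweil_Integration.integral_combine)
        (auto intro!: integrable_continuous_real continuous_intros fc')
    moreover have "integral {0..t} (\<lambda>s. T (t + h - s) (f s)) = T h (conv f t)"
    proof -
      have "integral {0..t} (\<lambda>s. T (t + h - s) (f s)) = integral {0..t} (\<lambda>s. T h (T (t - s) (f s)))"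
        by (rule integral_cong) (use elim T_add in \<open>auto simp: algebra_simps simp flip: T_add\<close>)
      also have "\<dots> = T h (conv f t)"
        unfolding conv_def using integral_linear[OF conv_integrable[OF fc order_refl] linear_T[of h]] elim
        by (simp add: o_def)
      finally show ?thesis .
    qed
    moreover have "?P 0 = conv f t" using conv_reflect[OF fc t] by simp
    ultimately have "T h (conv f t) - conv f t = (?P h - ?P 0) + ?Q h - ?R h" by (simp add: algebra_simps)
    then show ?case by (simp only: scaleR_add_right scaleR_diff_right)
  qed
  ultimately show "((\<lambda>h. (1 / h) *\<^sub>R (T h (conv f t) - conv f t)) \<longlongrightarrow> conv f' t + T t (f 0) - f t) (at_right 0)"
    by (rule Lim_transform_eventually)
qed

lemma conv_const:
  assumes "0 \<le> t"
  shows "conv (\<lambda>_. x) t \<in> D \<and> A (conv (\<lambda>_. x) t) = T t x - x"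
proof -
  have "C1_fun (\<lambda>_. x) (\<lambda>_. 0)" by (auto simp: C1_fun_def)
  moreover have "conv (\<lambda>_. 0) t = 0" using conv_scaleR[of 0 "\<lambda>_. 0" t] by simp
  ultimately show ?thesis using conv_C1[of "\<lambda>_. x" "\<lambda>_. 0", OF _ assms] by simp
qed

lemma average_conv_const: "((\<lambda>h. (1 / h) *\<^sub>R conv (\<lambda>_. x) h) \<longlongrightarrow> x) (at_right 0)"
proof -
  have "((\<lambda>h. (1 / h) *\<^sub>R integral {0..0 + h} (\<lambda>s. T (0 + h - s) x)) \<longlongrightarrow> T 0 x) (at_right 0)"
    by (rule average_tendsto[where f = "\<lambda>_. x" and \<beta> = "\<lambda>s h. 0" and b = 0]) (auto intro!: integrable_continuous_real continuous_intros)
  then show ?thesis by (simp add: conv_def T_0)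
qed

lemma D_dense: "closure D = UNIV"
proof -
  have "x \<in> closure D" for x
  proof (rule Lim_in_closed_set[OF closed_closure _ _ average_conv_const])
    show "\<forall>\<^sub>F h in at_right 0. (1 / h) *\<^sub>R conv (\<lambda>_. x) h \<in> closure D"
      using eventually_nonneg_at_right
      by eventually_elim (use conv_const D_scaleR closure_subset in blast)
  qed simp
  then show ?thesis by blast
qed

text \<open>The generator applied to \<open>conv (\<lambda>_. x) t\<close> is computed twice: by
  \<open>conv_const\<close>, and by pulling the difference quotient under the integral, where it
  converges to \<open>A x\<close>.\<close>

lemma T_minus_id_conv:
  assumes x: "x \<in> D" and t: "0 \<le> t"
  shows "T t x - x = conv (\<lambda>_. A x) t"
proof -
  let ?y = "conv (\<lambda>_. x) t"
  have "((\<lambda>h. (1 / h) *\<^sub>R (T h ?y - ?y)) \<longlongrightarrow> T t x - x) (at_right 0)"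
    using conv_const[OF t, of x] generator_iff by blast
  moreover have "((\<lambda>h. (1 / h) *\<^sub>R (T h ?y - ?y)) \<longlongrightarrow> conv (\<lambda>_. A x) t) (at_right 0)"
  proof (rule Lim_transform)
    let ?z = "\<lambda>h. (1 / h) *\<^sub>R (T h x - x)"
    show "((\<lambda>h. conv (\<lambda>_. A x) t) \<longlongrightarrow> conv (\<lambda>_. A x) t) (at_right 0)" by simp
    show "((\<lambda>h. (1 / h) *\<^sub>R (T h ?y - ?y) - conv (\<lambda>_. A x) t) \<longlongrightarrow> 0) (at_right 0)"
    proof (rule Lim_null_comparison)
      show "\<forall>\<^sub>F h in at_right 0. norm ((1 / h) *\<^sub>R (T h ?y - ?y) - conv (\<lambda>_. A x) t)
          \<le> K t * (t * norm (?z h - A x))"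
        using eventually_nonneg_at_right
      proof eventually_elim
        case (elim h)
        have "T h ?y = conv (\<lambda>_. T h x) t"
          using conv_bounded_linear[OF linear_T[OF elim] T_commute[OF elim], of t "\<lambda>_. x"] by simp
        then have "(1 / h) *\<^sub>R (T h ?y - ?y) - conv (\<lambda>_. A x) t = conv (\<lambda>_. ?z h - A x) t"
          by (simp add: conv_diff conv_scaleR)
        also have "norm \<dots> \<le> K t * integral {0..t} (\<lambda>_. norm (?z h - A x))"
          by (rule norm_conv_le) auto
        finally show ?case using t by (simp add: content_real)
      qed
      have "((\<lambda>h. norm (?z h - A x)) \<longlongrightarrow> 0) (at_right 0)"
        using generator_lim[OF x] by (simp add: LIM_zero_iff tendsto_norm_zero)
      then show "((\<lambda>h. K t * (t * norm (?z h - A x))) \<longlongrightarrow> 0) (at_right 0)"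
        by (intro tendsto_mult_right_zero)
    qed
  qed
  ultimately show ?thesis using tendsto_unique[OF trivial_limit_at_right_real] by blast
qed

lemma norm_T_minus_id_le:
  assumes x: "x \<in> D" and t: "0 \<le> t"
  shows "norm (T t x - x) \<le> K t * t * norm (A x)"
proof -
  have "norm (conv (\<lambda>_. A x) t) \<le> K t * integral {0..t} (\<lambda>_. norm (A x))"
    by (rule norm_conv_le) auto
  then show ?thesis using t by (simp add: T_minus_id_conv[OF x t] content_real mult.assoc)
qed

text \<open>The integrated identity T(h) x - x = conv (A x) h survives the limit, since it contains
  \<open>A\<close> only under a bounded convolution; dividing by \<open>h\<close> then recovers the
  generator.\<close>

lemma generator_closed:
  assumes X: "\<And>n. X n \<in> D" and x: "X \<longlonglongrightarrow> x" and y: "(\<lambda>n. A (X n)) \<longlonglongrightarrow> y"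
  shows "x \<in> D \<and> A x = y"
  unfolding generator_iff
proof -
  have "T h x - x = conv (\<lambda>_. y) h" if h: "0 \<le> h" for h
  proof -
    have "(\<lambda>n. T h (X n) - X n) \<longlonglongrightarrow> T h x - x"
      by (intro tendsto_diff x bounded_linear.tendsto[OF linear_T[OF h]])
    moreover have "(\<lambda>n. T h (X n) - X n) \<longlonglongrightarrow> conv (\<lambda>_. y) h"
    proof (rule LIM_zero_cancel, rule Lim_null_comparison)
      show "\<forall>\<^sub>F n in sequentially. norm (T h (X n) - X n - conv (\<lambda>_. y) h) \<le> K h * (h * norm (A (X n) - y))"
      proof (rule always_eventually, rule allI)
        fix n
        have "T h (X n) - X n - conv (\<lambda>_. y) h = conv (\<lambda>_. A (X n) - y) h"
          by (simp add: T_minus_id_conv[OF X h] conv_diff)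
        also have "norm \<dots> \<le> K h * integral {0..h} (\<lambda>_. norm (A (X n) - y))"
          by (rule norm_conv_le) auto
        finally show "norm (T h (X n) - X n - conv (\<lambda>_. y) h) \<le> K h * (h * norm (A (X n) - y))"
          using h by (simp add: content_real)
      qed
      have "(\<lambda>n. norm (A (X n) - y)) \<longlonglongrightarrow> 0" using y by (simp add: LIM_zero_iff tendsto_norm_zero)
      then show "(\<lambda>n. K h * (h * norm (A (X n) - y))) \<longlonglongrightarrow> 0" by (intro tendsto_mult_right_zero)
    qed
    ultimately show ?thesis by (rule LIMSEQ_unique)
  qed
  then show "((\<lambda>h. (1 / h) *\<^sub>R (T h x - x)) \<longlongrightarrow> y) (at_right 0)"
    using average_conv_const[of y]
    by (rule_tac Lim_transform_eventually[rotated])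
      (use eventually_nonneg_at_right in eventually_elim, auto)
qed

text \<open>The \<open>L\<^sup>1\<close> bound that extends \<open>conv_C1\<close> to \<open>L\<^sup>1\<close> limits when \<open>f\<close> takes values in the Favard class.\<close>

lemma norm_A_conv_le:
  assumes y: "conv f t \<in> D" and f: "continuous_on {0..t} f" and t: "0 \<le> t" and h0: "0 < h0"
    and favard: "\<And>s h. s \<in> {0..t} \<Longrightarrow> 0 < h \<Longrightarrow> h < h0 \<Longrightarrow> norm (T h (f s) - f s) \<le> h * N s"
    and N: "N integrable_on {0..t}"
  shows "norm (A (conv f t)) \<le> K t * integral {0..t} N"
proof (rule tendsto_upperbound[OF tendsto_norm[OF generator_lim[OF y]]])
  show "\<forall>\<^sub>F h in at_right 0. norm ((1 / h) *\<^sub>R (T h (conv f t) - conv f t)) \<le> K t * integral {0..t} N"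
    using eventually_at_right_real[OF h0]
  proof eventually_elim
    case (elim h)
    then have h: "0 < h" "h < h0" by auto
    have c: "continuous_on {0..t} (\<lambda>s. T h (f s))" by (intro continuous_intros f) (use h in auto)
    \<comment> \<open>Since \<open>T h\<close> commutes with the convolution, the difference
      quotient of \<open>conv f t\<close> is the convolution of the quotients of \<open>f s\<close>,
      and these are bounded by \<open>N s\<close> uniformly in \<open>h\<close>.\<close>
    have "T h (conv f t) = conv (\<lambda>s. T h (f s)) t"
      using h by (intro conv_bounded_linear[symmetric] linear_T T_commute f) auto
    then have "(1 / h) *\<^sub>R (T h (conv f t) - conv f t) = conv (\<lambda>s. (1 / h) *\<^sub>R (T h (f s) - f s)) t"
      by (simp only: conv_scaleR conv_diff[OF c f])
    also have "norm \<dots> \<le> K t * integral {0..t} N"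
    proof (rule norm_conv_le[OF _ N])
      show "continuous_on {0..t} (\<lambda>s. (1 / h) *\<^sub>R (T h (f s) - f s))" by (intro continuous_intros f c)
      fix s assume "s \<in> {0..t}"
      then have "norm (T h (f s) - f s) / h \<le> N s"
        using favard[of s h] h by (simp add: pos_divide_le_eq mult.commute)
      then show "norm ((1 / h) *\<^sub>R (T h (f s) - f s)) \<le> N s"
        using h by (simp only: norm_scaleR) simp
    qed
    finally show ?case .
  qed
qed simp

section \<open>Resolvents\<close>

text \<open>A relation, so that it applies alike to the inverse at an arbitrary point of the
  resolvent set and to the Laplace transform for \<open>l > w\<close>.\<close>

definition is_resolvent :: "real \<Rightarrow> ('a \<Rightarrow> 'a) \<Rightarrow> bool" where
  "is_resolvent l R \<longleftrightarrow> bounded_linear R \<and> (\<forall>x. R x \<in> D \<and> l *\<^sub>R R x - A (R x) = x) \<and>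
     (\<forall>x\<in>D. R (l *\<^sub>R x - A x) = x)"

lemma is_resolventD:
  assumes "is_resolvent l R"
  shows "bounded_linear R" "R x \<in> D" "l *\<^sub>R R x - A (R x) = x" "x \<in> D \<Longrightarrow> R (l *\<^sub>R x - A x) = x"
  using assms by (auto simp: is_resolvent_def)

lemma resolvent_T:
  assumes R: "is_resolvent l R" and t: "0 \<le> t"
  shows "R (T t x) = T t (R x)"
proof -
  have "l *\<^sub>R T t (R x) - A (T t (R x)) = T t (l *\<^sub>R R x - A (R x))"
    using generator_T[OF is_resolventD(2)[OF R] t] t by (simp add: T_diff T_scaleR)
  then show ?thesis
    using is_resolventD(4)[OF R, of "T t (R x)"] generator_T[OF is_resolventD(2)[OF R] t]
    by (simp add: is_resolventD(3)[OF R])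
qed

text \<open>The resolvent is the Laplace transform of the semigroup. Its truncations are
  convolutions with a C^1 function, so \<open>conv_C1\<close> gives the generator on them, and
  closedness passes to the limit.\<close>

lemma resolvent_exists:
  assumes l: "w < l"
  obtains R where "is_resolvent l R" "\<And>x. norm (R x) \<le> M / (l - w) * norm x"
    "\<And>x. (\<lambda>n. integral {0..real n} (\<lambda>s. exp (- l * s) *\<^sub>R T s x)) \<longlonglongrightarrow> R x"
proof -
  define S where "S x t = integral {0..t} (\<lambda>s. exp (- l * s) *\<^sub>R T s x)" for x t
  have int: "(\<lambda>s. exp (- l * s) *\<^sub>R T s x) integrable_on {a..b}" if "0 \<le> a" for a b x
    by (intro integrable_continuous_real continuous_intros) (use that in auto)
  have S_norm: "norm (integral {a..b} (\<lambda>s. exp (- l * s) *\<^sub>R T s x))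
      \<le> M / (l - w) * norm x * exp (- (l - w) * a)" if ab: "0 \<le> a" "a \<le> b" for a b x
  proof -
    let ?c = "M * norm x"
    have hi: "((\<lambda>s. ?c * exp (- (l - w) * s)) has_integral
        (- ?c / (l - w) * exp (- (l - w) * b)) - (- ?c / (l - w) * exp (- (l - w) * a))) {a..b}"
    proof (intro fundamental_theorem_of_calculus ab)
      fix s
      have "((\<lambda>s. - ?c / d * exp (- d * s)) has_real_derivative ?c * exp (- d * s)) (at s within {a..b})"
        if "d \<noteq> 0" for d
        using that by (auto intro!: derivative_eq_intros)
      from this[of "l - w"] show "((\<lambda>s. - ?c / (l - w) * exp (- (l - w) * s)) has_vector_derivative
          ?c * exp (- (l - w) * s)) (at s within {a..b})"
        using l by (simp add: has_real_derivative_iff_has_vector_derivative)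
    qed
    have "integral {a..b} (\<lambda>s. ?c * exp (- (l - w) * s)) \<le> M / (l - w) * norm x * exp (- (l - w) * a)"
      unfolding integral_unique[OF hi] using l M_pos by simp
    moreover note has_integral_integrable[OF hi]
    moreover have "norm (exp (- l * s) *\<^sub>R T s x) \<le> ?c * exp (- (l - w) * s)" if "s \<in> {a..b}" for s
    proof -
      have "norm (exp (- l * s) *\<^sub>R T s x) \<le> exp (- l * s) * (M * exp (w * s) * norm x)"
        using growth[of s x] that ab by simp
      also have "\<dots> = ?c * exp (- (l - w) * s)" by (simp add: algebra_simps flip: exp_add)
      finally show ?thesis .
    qed
    ultimately show ?thesis using integral_norm_bound_integral[OF int[OF ab(1)]] by fastforce
  qed
  have split: "S x b - S x a = integral {a..b} (\<lambda>s. exp (- l * s) *\<^sub>R T s x)" if "0 \<le> a" "a \<le> b" for x a b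
    using Henstock_Kurzweil_Integration.integral_combine[OF that int[of 0 x b]] by (simp add: S_def algebra_simps)
  have exp0: "(\<lambda>n. exp (- c * real n)) \<longlonglongrightarrow> 0" if "0 < c" for c
  proof -
    have "(\<lambda>n. exp (- c) ^ n) \<longlonglongrightarrow> 0" using that by (intro LIMSEQ_power_zero) simp
    then show ?thesis by (simp add: mult.commute flip: exp_of_nat_mult)
  qed
  have conv_S: "convergent (\<lambda>n. S x (real n))" for x
  proof (rule Cauchy_convergent, rule CauchyI')
    fix e :: real assume e: "0 < e"
    have "(\<lambda>n. M / (l - w) * norm x * exp (- (l - w) * real n)) \<longlonglongrightarrow> 0"
      using exp0[of "l - w"] l by (intro tendsto_mult_right_zero) simp
    then have "\<forall>\<^sub>F n in sequentially. M / (l - w) * norm x * exp (- (l - w) * real n) < e"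
      using e by (rule order_tendstoD)
    then obtain N where N: "\<And>n. N \<le> n \<Longrightarrow> M / (l - w) * norm x * exp (- (l - w) * real n) < e"
      by (auto simp: eventually_sequentially)
    show "\<exists>N. \<forall>m\<ge>N. \<forall>n>m. dist (S x (real m)) (S x (real n)) < e"
    proof (intro exI[of _ N] allI impI)
      fix m n assume mn: "N \<le> m" "m < n"
      have "norm (S x (real n) - S x (real m)) \<le> M / (l - w) * norm x * exp (- (l - w) * real m)"
        using mn S_norm[of "real m" "real n" x] by (simp only: split)
      then show "dist (S x (real m)) (S x (real n)) < e"
        using N[OF mn(1)] by (simp add: dist_norm norm_minus_commute)
    qed
  qed
  define R where "R x = lim (\<lambda>n. S x (real n))" for x
  have R: "(\<lambda>n. S x (real n)) \<longlonglongrightarrow> R x" for x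
    unfolding R_def using conv_S by (simp add: convergent_LIMSEQ_iff)
  have R_norm: "norm (R x) \<le> M / (l - w) * norm x" for x
    by (rule LIMSEQ_le_const2[OF tendsto_norm[OF R]]) (use S_norm[of 0 _ x] in \<open>auto simp: S_def\<close>)
  have S_add: "S (x + y) t = S x t + S y t" for x y t
  proof -
    have "S (x + y) t = integral {0..t} (\<lambda>s. exp (- l * s) *\<^sub>R T s x + exp (- l * s) *\<^sub>R T s y)"
      unfolding S_def by (rule integral_cong) (simp add: T_sum scaleR_add_right)
    also have "\<dots> = S x t + S y t"
      unfolding S_def by (intro integral_add int order_refl)
    finally show ?thesis .
  qed
  have S_scaleR: "S (c *\<^sub>R x) t = c *\<^sub>R S x t" for x c t
  proof -
    have "S (c *\<^sub>R x) t = integral {0..t} (\<lambda>s. c *\<^sub>R (exp (- l * s) *\<^sub>R T s x))"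
      unfolding S_def by (rule integral_cong) (simp add: T_scaleR)
    also have "\<dots> = c *\<^sub>R S x t" unfolding S_def by (rule integral_cmul)
    finally show ?thesis .
  qed
  have R_lin: "bounded_linear R"
  proof (rule bounded_linear_intro)
    show "R (x + y) = R x + R y" for x y
      using LIMSEQ_unique[OF R[of "x + y"]] tendsto_add[OF R[of x] R[of y]] by (simp add: S_add)
    show "R (c *\<^sub>R x) = c *\<^sub>R R x" for c x
      using LIMSEQ_unique[OF R[of "c *\<^sub>R x"]] tendsto_scaleR[OF tendsto_const R[of x]] by (simp add: S_scaleR)
    show "norm (R x) \<le> norm x * (M / (l - w))" for x using R_norm[of x] by (simp add: mult.commute)
  qed
  have S_gen: "S x t \<in> D \<and> A (S x t) = l *\<^sub>R S x t + exp (- l * t) *\<^sub>R T t x - x" if t: "0 \<le> t" for x t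
  proof -
    \<comment> \<open>The exponent is shifted by \<open>t\<close> so that reflection
      \<open>s \<mapsto> t - s\<close> turns the weight into exp(- l s).\<close>
    let ?f = "\<lambda>s. exp (l * (s - t)) *\<^sub>R x"
    have f: "C1_fun ?f (\<lambda>s. l *\<^sub>R ?f s)"
      unfolding C1_fun_def
      by (auto intro!: derivative_eq_intros continuous_intros
          simp: has_real_derivative_iff_has_vector_derivative[symmetric])
    have "conv ?f t = integral {0..t} (\<lambda>s. T s (exp (l * (t - s - t)) *\<^sub>R x))"
      by (rule conv_reflect[OF C1_fun_continuous[OF f] t])
    also have "\<dots> = S x t"
      unfolding S_def by (rule integral_cong) (simp add: T_scaleR)
    finally have "conv ?f t = S x t" .
    moreover from this have "conv (\<lambda>s. l *\<^sub>R ?f s) t = l *\<^sub>R S x t" by (simp only: conv_scaleR)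
    ultimately show ?thesis using conv_C1[OF f t] t by (simp only: T_scaleR) simp
  qed
  have R_gen: "R x \<in> D \<and> A (R x) = l *\<^sub>R R x - x" for x
  proof (rule generator_closed[OF _ R])
    show "S x (real n) \<in> D" for n using S_gen by simp
    have "(\<lambda>n. exp (- l * real n) *\<^sub>R T (real n) x) \<longlonglongrightarrow> 0"
    proof (rule Lim_null_comparison)
      show "\<forall>\<^sub>F n in sequentially. norm (exp (- l * real n) *\<^sub>R T (real n) x) \<le> M * norm x * exp (- (l - w) * real n)"
      proof (rule always_eventually, rule allI)
        fix n
        have "norm (exp (- l * real n) *\<^sub>R T (real n) x) \<le> exp (- l * real n) * (M * exp (w * real n) * norm x)"
          using growth[of "real n" x] by simp
        also have "\<dots> = M * norm x * exp (- (l - w) * real n)" by (simp add: algebra_simps flip: exp_add)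
        finally show "norm (exp (- l * real n) *\<^sub>R T (real n) x) \<le> M * norm x * exp (- (l - w) * real n)" .
      qed
      show "(\<lambda>n. M * norm x * exp (- (l - w) * real n)) \<longlonglongrightarrow> 0"
        using exp0[of "l - w"] l by (intro tendsto_mult_right_zero) simp
    qed
    from tendsto_diff[OF tendsto_add[OF tendsto_scaleR[OF tendsto_const R[of x]] this] tendsto_const]
    show "(\<lambda>n. A (S x (real n))) \<longlonglongrightarrow> l *\<^sub>R R x - x"
      using S_gen by simp
  qed
  \<comment> \<open>Commutation with the semigroup moves \<open>A\<close> through \<open>R\<close>;
    this turns the right inverse into a left inverse on \<open>D\<close>.\<close>
  have comm: "R (T t x) = T t (R x)" if t: "0 \<le> t" for t x
  proof -
    have "S (T t x) u = T t (S x u)" if "0 \<le> u" for u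
    proof -
      have "S (T t x) u = integral {0..u} (\<lambda>s. T t (exp (- l * s) *\<^sub>R T s x))"
        unfolding S_def by (rule integral_cong) (use t T_commute in \<open>simp add: T_scaleR\<close>)
      then show ?thesis
        unfolding S_def using integral_linear[OF int[of 0 x u] linear_T[OF t]] by (simp add: o_def)
    qed
    then have "(\<lambda>n. S (T t x) (real n)) \<longlonglongrightarrow> T t (R x)"
      using bounded_linear.tendsto[OF linear_T[OF t] R[of x]] by simp
    then show ?thesis by (rule LIMSEQ_unique[OF R])
  qed
  have left: "R (l *\<^sub>R x - A x) = x" if x: "x \<in> D" for x
    using generator_bounded_linear[OF x R_lin comm] R_gen[of x]
    by (simp add: linear_simps[OF R_lin] algebra_simps)
  show thesis
  proof (rule that[of R])
    show "is_resolvent l R" unfolding is_resolvent_def using R_lin R_gen left by simp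
  qed (use R_norm R in \<open>auto simp: S_def\<close>)
qed

text \<open>For \<open>y\<close> in \<open>D\<close> the error n R(n) y - y equals R(n) A y, which
  is of order 1 / n. Density of \<open>D\<close> and the uniform bound extend the convergence to all
  \<open>x\<close>.\<close>

lemma resolvent_tendsto_id:
  assumes R: "\<And>n::nat. N0 \<le> n \<Longrightarrow> is_resolvent (real n) (R n)"
    and bound: "\<And>n x. N0 \<le> n \<Longrightarrow> norm (real n *\<^sub>R R n x) \<le> C * norm x"
  shows "(\<lambda>n. real n *\<^sub>R R n x) \<longlonglongrightarrow> x"
proof (rule LIMSEQ_I)
  fix e :: real assume e: "0 < e"
  define d where "d = e / (2 * (\<bar>C\<bar> + 1))"
  have d: "0 < d" using e by (simp add: d_def add_nonneg_pos)
  obtain y where y: "y \<in> D" "dist y x < d"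
    using D_dense d by (metis UNIV_I closure_approachable)
  have lim0: "(\<lambda>n. C * norm (A y) / real n) \<longlonglongrightarrow> 0" by (rule lim_const_over_n)
  have "\<forall>\<^sub>F n in sequentially. C * norm (A y) / real n < e / 2"
    using lim0 e by (intro order_tendstoD(2)) auto
  then obtain N1 where N1: "\<And>n. N1 \<le> n \<Longrightarrow> C * norm (A y) / real n < e / 2"
    by (auto simp: eventually_sequentially)
  have "norm (real n *\<^sub>R R n x - x) < e" if n: "max (max N0 N1) 1 \<le> n" for n
  proof -
    from n have n: "N0 \<le> n" "N1 \<le> n" "0 < real n" by auto
    note lin = is_resolventD(1)[OF R[OF n(1)]]
    have "real n *\<^sub>R R n y - y = R n (A y)"
      using is_resolventD(4)[OF R[OF n(1)] y(1)] by (simp add: linear_simps[OF lin] algebra_simps)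
    moreover have "norm (R n (A y)) \<le> C * norm (A y) / real n"
      using bound[OF n(1), of "A y"] n(3) by (simp add: field_simps)
    ultimately have 1: "norm (real n *\<^sub>R R n y - y) < e / 2"
      using N1[OF n(2)] by (metis order_le_less_trans)
    have 2: "norm (real n *\<^sub>R R n (x - y)) \<le> \<bar>C\<bar> * d"
    proof -
      have "norm (real n *\<^sub>R R n (x - y)) \<le> C * norm (x - y)" by (rule bound[OF n(1)])
      also have "\<dots> \<le> \<bar>C\<bar> * d" using y(2) by (intro mult_mono) (auto simp: dist_norm norm_minus_commute)
      finally show ?thesis .
    qed
    have "real n *\<^sub>R R n x - x = real n *\<^sub>R R n (x - y) + (real n *\<^sub>R R n y - y) + (y - x)"
      by (simp add: linear_simps[OF lin] algebra_simps)
    then have "norm (real n *\<^sub>R R n x - x) \<le>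
        norm (real n *\<^sub>R R n (x - y)) + norm (real n *\<^sub>R R n y - y) + norm (y - x)"
      by (metis (no_types, lifting) norm_triangle_ineq add_right_mono order_trans)
    also have "\<dots> < \<bar>C\<bar> * d + e / 2 + d" using 1 2 y(2) by (simp add: dist_norm)
    also have "\<dots> = (\<bar>C\<bar> + 1) * d + e / 2" by (simp add: algebra_simps)
    also have "(\<bar>C\<bar> + 1) * d = e / 2" unfolding d_def by (simp add: field_simps add_nonneg_eq_0_iff)
    finally show ?thesis by simp
  qed
  then show "\<exists>no. \<forall>n\<ge>no. norm (real n *\<^sub>R R n x - x) < e" by blast
qed

end

section \<open>Inequalities in \<open>L\<^sup>p\<close>\<close>

text \<open>A rearrangement of the weighted arithmetic-geometric inequality for x^p and \<theta>^p
  with weights 1 / p and 1 - 1 / p; the point x = 0 is treated separately.\<close>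

lemma powr_above_tangent:
  fixes x \<theta> p :: real
  assumes p: "1 \<le> p" and x: "0 \<le> x" and \<theta>: "0 < \<theta>"
  shows "\<theta> powr p + p * \<theta> powr (p - 1) * (x - \<theta>) \<le> x powr p"
proof (cases "x = 0")
  case True
  have \<theta>p: "\<theta> powr (p - 1) * \<theta> = \<theta> powr p" using \<theta> by (simp add: powr_diff)
  have "p * \<theta> powr (p - 1) * (x - \<theta>) = - (p * \<theta> powr p)"
    unfolding True \<theta>p[symmetric] by simp
  moreover have "\<theta> powr p \<le> p * \<theta> powr p" using mult_right_mono[OF p, of "\<theta> powr p"] by simp
  moreover have "x powr p = 0" using True by simp
  ultimately show ?thesis by linarith
next
  case False
  then have x: "0 < x" using x by simp
  have "(x powr p) powr (1/p) * (\<theta> powr p) powr (1 - 1/p) \<le> (1/p) * x powr p + (1 - 1/p) * \<theta> powr p"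
    using x \<theta> p by (intro Youngs_inequality_0) (auto simp: field_simps)
  moreover have "(x powr p) powr (1/p) = x" using p x by (simp add: powr_powr)
  moreover have "(\<theta> powr p) powr (1 - 1/p) = \<theta> powr (p - 1)" using p by (simp add: powr_powr algebra_simps)
  ultimately have "p * (x * \<theta> powr (p - 1)) \<le> p * ((1/p) * x powr p + (1 - 1/p) * \<theta> powr p)"
    using p by (intro mult_left_mono) auto
  also have "\<dots> = x powr p + (p - 1) * \<theta> powr p" using p by (simp add: algebra_simps)
  finally have "p * (x * \<theta> powr (p - 1)) \<le> x powr p + (p - 1) * \<theta> powr p" .
  moreover have "\<theta> powr (p - 1) * \<theta> = \<theta> powr p" using \<theta> by (simp add: powr_diff)
  then have "p * \<theta> powr (p - 1) * (x - \<theta>) = p * (x * \<theta> powr (p - 1)) - p * \<theta> powr p"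
    by (simp add: algebra_simps)
  ultimately show ?thesis unfolding left_diff_distrib by linarith
qed

text \<open>Integrate the tangent inequality at the mean value \<open>\<theta>\<close>: the linear
  term contributes nothing. A tangent needs \<open>\<theta> > 0\<close>, and the case of mean 0 is
  trivial.\<close>

lemma integral_powr_Jensen:
  fixes a :: "real \<Rightarrow> real"
  assumes p: "1 \<le> p" and t: "0 < t" and a: "continuous_on {0..t} a" "\<And>s. s \<in> {0..t} \<Longrightarrow> 0 \<le> a s"
  shows "(integral {0..t} a) powr p \<le> t powr (p - 1) * integral {0..t} (\<lambda>s. a s powr p)"
proof -
  define \<theta> where "\<theta> = integral {0..t} a / t"
  have ai: "a integrable_on {0..t}" by (rule integrable_continuous_real[OF a(1)])
  have pi: "(\<lambda>s. a s powr p) integrable_on {0..t}"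
    using p a by (intro integrable_continuous_real continuous_on_powr') auto
  have "0 \<le> integral {0..t} a" by (rule integral_nonneg[OF ai a(2)])
  then have \<theta>0: "0 \<le> \<theta>" using t by (simp add: \<theta>_def)
  have I: "integral {0..t} a = t * \<theta>" using t by (simp add: \<theta>_def)
  have "t * \<theta> powr p \<le> integral {0..t} (\<lambda>s. a s powr p)"
  proof (cases "\<theta> = 0")
    case True
    then show ?thesis by (simp add: integral_nonneg[OF pi])
  next
    case False
    let ?c = "\<theta> powr p - p * \<theta> powr (p - 1) * \<theta>" and ?d = "p * \<theta> powr (p - 1)"
    have "integral {0..t} (\<lambda>s. ?c + ?d * a s) \<le> integral {0..t} (\<lambda>s. a s powr p)"
    proof (rule integral_le[OF _ pi])
      show "(\<lambda>s. ?c + ?d * a s) integrable_on {0..t}"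
        by (intro integrable_add integrable_on_mult_right ai) auto
      fix s assume "s \<in> {0..t}"
      then show "?c + ?d * a s \<le> a s powr p"
        using powr_above_tangent[OF p a(2), of s \<theta>] False \<theta>0 by (simp add: algebra_simps)
    qed
    also have "integral {0..t} (\<lambda>s. ?c + ?d * a s) = t * ?c + ?d * (t * \<theta>)"
      using t by (subst integral_add) (auto simp: I integrable_on_mult_right ai content_real)
    also have "\<dots> = t * \<theta> powr p" by (simp add: algebra_simps)
    finally show ?thesis .
  qed
  then have "t powr (p - 1) * (t * \<theta> powr p) \<le> t powr (p - 1) * integral {0..t} (\<lambda>s. a s powr p)"
    by (intro mult_left_mono) auto
  moreover have "t powr (p - 1) * t = t powr p" using t by (simp add: powr_diff)
  then have "t powr (p - 1) * (t * \<theta> powr p) = (integral {0..t} a) powr p"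
    using t \<theta>0 by (simp add: I powr_mult mult.assoc[symmetric])
  ultimately show ?thesis by simp
qed

lemma borel_measurable_nn_indicator_continuous:
  fixes h :: "real \<Rightarrow> real"
  assumes "continuous_on {a..b} h"
  shows "(\<lambda>t. ennreal (h t) * indicator {a..b} t) \<in> borel_measurable lborel"
proof -
  have "(\<lambda>t. indicator {a..b} t *\<^sub>R h t) \<in> borel_measurable borel"
    by (rule borel_measurable_continuous_on_indicator[OF _ assms]) simp
  then have "(\<lambda>t. ennreal (indicator {a..b} t *\<^sub>R h t)) \<in> borel_measurable borel"
    by (rule measurable_compose[OF _ measurable_ennreal])
  moreover have "(\<lambda>t. ennreal (indicator {a..b} t *\<^sub>R h t)) = (\<lambda>t. ennreal (h t) * indicator {a..b} t)"
    by (auto simp: indicator_def)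
  ultimately show ?thesis unfolding measurable_lborel2 by (simp only:)
qed

lemma nn_integral_continuous_Icc:
  fixes a :: "real \<Rightarrow> real"
  assumes a: "continuous_on {x..y} a" "\<And>s. s \<in> {x..y} \<Longrightarrow> 0 \<le> a s"
  shows "(\<integral>\<^sup>+s\<in>{x..y}. ennreal (a s) \<partial>lborel) = ennreal (integral {x..y} a)"
proof -
  have "(a has_integral integral {x..y} a) {x..y}"
    by (intro integrable_integral integrable_continuous_real a)
  note nn_integral_has_integral_lebesgue[OF a(2) this]
  moreover have "(\<integral>\<^sup>+s\<in>{x..y}. ennreal (a s) \<partial>lborel) = (\<integral>\<^sup>+s. ennreal (indicator {x..y} s * a s) \<partial>lborel)"
    by (rule nn_integral_cong) (auto simp: indicator_def)
  ultimately show ?thesis by simp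
qed

text \<open>Jensen in \<open>s\<close> for each fixed \<open>t\<close> costs the factor t^(p-1), at
  most \<tau>^(p-1); Tonelli then exchanges the variables on the triangle s \<le> t. This factor is
  what makes the constant small for small \<open>\<tau>\<close> when p > 1.\<close>

lemma nn_integral_Volterra_powr_le:
  fixes k :: "real \<Rightarrow> real \<Rightarrow> 'a::banach"
  assumes p: "1 \<le> p" and \<tau>: "0 < \<tau>"
    and k: "continuous_on {z. 0 \<le> snd z \<and> snd z \<le> fst z \<and> fst z \<le> \<tau>} (\<lambda>z. k (fst z) (snd z))"
  shows "(\<integral>\<^sup>+t\<in>{0..\<tau>}. ennreal (norm (integral {0..t} (k t)) powr p) \<partial>lborel)
    \<le> ennreal (\<tau> powr (p - 1)) *
      (\<integral>\<^sup>+s\<in>{0..\<tau>}. (\<integral>\<^sup>+t\<in>{s..\<tau>}. ennreal (norm (k t s) powr p) \<partial>lborel) \<partial>lborel)"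
proof -
  let ?S = "{z::real \<times> real. 0 \<le> snd z \<and> snd z \<le> fst z \<and> fst z \<le> \<tau>}"
  \<comment> \<open>Extension by 0 from the closed triangle to the plane: continuity on the triangle
    becomes Borel measurability on the product.\<close>
  define b where "b t s = indicator ?S (t, s) * norm (k t s) powr p" for t s
  have "closed ?S" by (intro closed_Collect_conj closed_Collect_le continuous_intros)
  then have S: "?S \<in> sets borel" by (rule borel_closed)
  have "continuous_on ?S (\<lambda>z. norm (k (fst z) (snd z)) powr p)"
    using p by (intro continuous_on_powr' continuous_intros k) auto
  then have "(\<lambda>z. indicator ?S z *\<^sub>R (norm (k (fst z) (snd z)) powr p)) \<in> borel_measurable borel"
    by (rule borel_measurable_continuous_on_indicator[OF S])
  then have "(\<lambda>z. b (fst z) (snd z)) \<in> borel_measurable borel" by (simp add: b_def)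
  then have meas [measurable]: "(\<lambda>z. b (fst z) (snd z)) \<in> borel_measurable (lborel \<Otimes>\<^sub>M lborel)"
    by (simp add: lborel_prod)
  have kc: "continuous_on {0..t} (k t)" if "t \<le> \<tau>" for t
    using continuous_on_compose2[OF k, of "{0..t}" "\<lambda>s. (t, s)"] that
    by (force intro: continuous_intros)
  have "(\<integral>\<^sup>+t\<in>{0..\<tau>}. ennreal (norm (integral {0..t} (k t)) powr p) \<partial>lborel)
      \<le> (\<integral>\<^sup>+t. ennreal (\<tau> powr (p - 1)) * (\<integral>\<^sup>+s. ennreal (b t s) \<partial>lborel) \<partial>lborel)"
  proof (rule nn_integral_mono)
    fix t
    show "ennreal (norm (integral {0..t} (k t)) powr p) * indicator {0..\<tau>} t
        \<le> ennreal (\<tau> powr (p - 1)) * (\<integral>\<^sup>+s. ennreal (b t s) \<partial>lborel)"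
    proof (cases "0 < t \<and> t \<le> \<tau>")
      case True
      then have c: "continuous_on {0..t} (\<lambda>s. norm (k t s))" by (intro continuous_intros kc) simp
      have c': "continuous_on {0..t} (\<lambda>s. norm (k t s) powr p)"
        using p by (intro continuous_on_powr' c continuous_intros) auto
      have "norm (integral {0..t} (k t)) powr p \<le> (integral {0..t} (\<lambda>s. norm (k t s))) powr p"
        using p True by (intro powr_mono2 integral_norm_bound_integral integrable_continuous_real kc c) auto
      also have "\<dots> \<le> t powr (p - 1) * integral {0..t} (\<lambda>s. norm (k t s) powr p)"
        using True by (intro integral_powr_Jensen p c) auto
      also have "\<dots> \<le> \<tau> powr (p - 1) * integral {0..t} (\<lambda>s. norm (k t s) powr p)"
        using True p by (intro mult_right_mono powr_mono2 integral_nonneg integrable_continuous_real c') auto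
      finally have "ennreal (norm (integral {0..t} (k t)) powr p)
          \<le> ennreal (\<tau> powr (p - 1)) * ennreal (integral {0..t} (\<lambda>s. norm (k t s) powr p))"
        by (simp add: ennreal_leI flip: ennreal_mult')
      also have "ennreal (integral {0..t} (\<lambda>s. norm (k t s) powr p)) =
          (\<integral>\<^sup>+s\<in>{0..t}. ennreal (norm (k t s) powr p) \<partial>lborel)"
        by (rule nn_integral_continuous_Icc[OF c', symmetric]) simp
      also have "\<dots> = (\<integral>\<^sup>+s. ennreal (b t s) \<partial>lborel)"
        by (rule nn_integral_cong) (use True in \<open>auto simp: b_def indicator_def\<close>)
      finally show ?thesis using True by simp
    next
      case False
      then consider "t \<notin> {0..\<tau>}" | "t = 0" by fastforce
      then show ?thesis by cases auto
    qed
  qed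
  also have "\<dots> = ennreal (\<tau> powr (p - 1)) * (\<integral>\<^sup>+t. (\<integral>\<^sup>+s. ennreal (b t s) \<partial>lborel) \<partial>lborel)"
    by (rule nn_integral_cmult) measurable
  also have "(\<integral>\<^sup>+t. (\<integral>\<^sup>+s. ennreal (b t s) \<partial>lborel) \<partial>lborel)
      = (\<integral>\<^sup>+s. (\<integral>\<^sup>+t. ennreal (b t s) \<partial>lborel) \<partial>lborel)"
    by (rule lborel_pair.Fubini'[symmetric]) (use meas in \<open>simp add: split_def\<close>)
  also have "\<dots> = (\<integral>\<^sup>+s\<in>{0..\<tau>}. (\<integral>\<^sup>+t\<in>{s..\<tau>}. ennreal (norm (k t s) powr p) \<partial>lborel) \<partial>lborel)"
  proof (rule nn_integral_cong)
    fix s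
    have "(\<integral>\<^sup>+t. ennreal (b t s) \<partial>lborel) =
        (\<integral>\<^sup>+t. ennreal (norm (k t s) powr p) * indicator {s..\<tau>} t * indicator {0..\<tau>} s \<partial>lborel)"
      by (rule nn_integral_cong) (auto simp: b_def indicator_def)
    then show "(\<integral>\<^sup>+t. ennreal (b t s) \<partial>lborel) =
        (\<integral>\<^sup>+t\<in>{s..\<tau>}. ennreal (norm (k t s) powr p) \<partial>lborel) * indicator {0..\<tau>} s"
      by (cases "s \<in> {0..\<tau>}") auto
  qed
  finally show ?thesis .
qed

lemma nn_integral_shift_Icc:
  fixes h :: "real \<Rightarrow> real"
  assumes h: "continuous_on {0..b - s} h" "\<And>t. 0 \<le> h t"
  shows "(\<integral>\<^sup>+t\<in>{s..b}. ennreal (h (t - s)) \<partial>lborel) = (\<integral>\<^sup>+t\<in>{0..b - s}. ennreal (h t) \<partial>lborel)"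
proof -
  have "(\<lambda>t. indicator {0..b - s} t *\<^sub>R h t) \<in> borel_measurable borel"
    by (rule borel_measurable_continuous_on_indicator[OF _ h(1)]) simp
  then have meas: "(\<lambda>t. ennreal (indicator {0..b - s} t *\<^sub>R h t)) \<in> borel_measurable borel"
    by (rule measurable_compose[OF _ measurable_ennreal])
  have "(\<integral>\<^sup>+t\<in>{0..b - s}. ennreal (h t) \<partial>lborel) = (\<integral>\<^sup>+t. ennreal (indicator {0..b - s} t *\<^sub>R h t) \<partial>lborel)"
    by (rule nn_integral_cong) (auto simp: indicator_def)
  also have "\<dots> = ennreal \<bar>1\<bar> * (\<integral>\<^sup>+t. ennreal (indicator {0..b - s} (- s + 1 * t) *\<^sub>R h (- s + 1 * t)) \<partial>lborel)"
    by (rule nn_integral_real_affine[OF meas]) simp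
  also have "\<dots> = (\<integral>\<^sup>+t\<in>{s..b}. ennreal (h (t - s)) \<partial>lborel)"
    by (simp, rule nn_integral_cong) (auto simp: indicator_def algebra_simps)
  finally show ?thesis by simp
qed

text \<open>Weak convergence suffices in Fatou's lemma since the norm is weakly lower semicontinuous.\<close>

lemma nn_integral_powr_weak_limit:
  fixes f :: "nat \<Rightarrow> real \<Rightarrow> 'a::real_normed_vector"
  assumes p: "0 < p"
    and meas: "\<And>n. (\<lambda>t. ennreal (norm (f n t) powr p) * indicator S t) \<in> borel_measurable lborel"
    and lim: "\<And>t u. t \<in> S \<Longrightarrow> bounded_linear u \<Longrightarrow> (\<lambda>n. u (f n t)) \<longlonglongrightarrow> (u (g t) :: real)"
    and bound: "\<And>n. (\<integral>\<^sup>+t\<in>S. ennreal (norm (f n t) powr p) \<partial>lborel) \<le> B"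
  shows "(\<integral>\<^sup>+t\<in>S. ennreal (norm (g t) powr p) \<partial>lborel) \<le> B"
proof -
  have "(\<integral>\<^sup>+t\<in>S. ennreal (norm (g t) powr p) \<partial>lborel)
      \<le> (\<integral>\<^sup>+t. liminf (\<lambda>n. ennreal (norm (f n t) powr p) * indicator S t) \<partial>lborel)"
  proof (rule nn_integral_mono)
    fix t
    show "ennreal (norm (g t) powr p) * indicator S t \<le> liminf (\<lambda>n. ennreal (norm (f n t) powr p) * indicator S t)"
    proof (cases "t \<in> S")
      case True
      obtain u :: "'a \<Rightarrow> real" where u: "bounded_linear u" "\<And>y. u y \<le> norm y" "u (g t) = norm (g t)"
        by (rule norming_functional[of "g t"]) (rule that)
      \<comment> \<open>The positive part makes the power defined and monotone; since
        \<open>u\<close> is below the norm, its p-th power stays below that of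
        \<open>norm (f n t)\<close>.\<close>
      let ?m = "\<lambda>n. max 0 (u (f n t))"
      have "?m \<longlonglongrightarrow> max 0 (u (g t))" by (intro tendsto_intros lim[OF True u(1)])
      then have "(\<lambda>n. ?m n powr p) \<longlonglongrightarrow> norm (g t) powr p"
        using p u(3) by (intro tendsto_powr') auto
      then have "(\<lambda>n. ennreal (?m n powr p)) \<longlonglongrightarrow> ennreal (norm (g t) powr p)"
        by (rule tendsto_ennrealI)
      then have "ennreal (norm (g t) powr p) = liminf (\<lambda>n. ennreal (?m n powr p))"
        by (rule lim_imp_Liminf[OF sequentially_bot, symmetric])
      also have "\<dots> \<le> liminf (\<lambda>n. ennreal (norm (f n t) powr p))"
        using u(2) p by (intro Liminf_mono always_eventually allI ennreal_leI powr_mono2) auto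
      finally show ?thesis using True by simp
    qed simp
  qed
  also have "\<dots> \<le> liminf (\<lambda>n. \<integral>\<^sup>+t\<in>S. ennreal (norm (f n t) powr p) \<partial>lborel)"
    by (rule nn_integral_liminf[OF meas])
  also have "\<dots> \<le> limsup (\<lambda>n. \<integral>\<^sup>+t\<in>S. ennreal (norm (f n t) powr p) \<partial>lborel)"
    by (rule Liminf_le_Limsup) simp
  also have "\<dots> \<le> B" by (rule Limsup_bounded) (use bound in simp_all)
  finally show ?thesis .
qed

text \<open>The set of interior points where the property fails is open and null, hence empty; the
  endpoints follow by taking closures.\<close>

lemma continuous_AE_closed:
  fixes v :: "real \<Rightarrow> 'a::topological_space"
  assumes v: "continuous_on {a..b} v" and ab: "a < b" and C: "closed C"
    and AE: "AE t in lborel. t \<in> {a<..<b} \<longrightarrow> v t \<in> C" and t: "t \<in> {a..b}"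
  shows "v t \<in> C"
proof -
  let ?E = "{t \<in> {a<..<b}. v t \<notin> C}"
  have "continuous_on {a<..<b} v" by (rule continuous_on_subset[OF v]) auto
  then have "open ({a<..<b} \<inter> v -` (- C))"
    by (rule continuous_open_preimage) (use C in auto)
  then have op: "open ?E" by (simp add: Int_def vimage_def)
  have "?E = {}"
  proof (rule ccontr)
    assume "?E \<noteq> {}"
    then obtain x where "x \<in> ?E" by blast
    then obtain e where e: "e > 0" "ball x e \<subseteq> ?E" using op openE by blast
    obtain N where N: "N \<in> null_sets lborel" "{t. \<not> (t \<in> {a<..<b} \<longrightarrow> v t \<in> C)} \<subseteq> N"
      using AE by (auto simp: eventually_ae_filter)
    have "{x - e<..<x + e} \<subseteq> N" using e(2) N(2) by (force simp: ball_eq_greaterThanLessThan)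
    then have "emeasure lborel {x - e<..<x + e} \<le> emeasure lborel N"
      using N(1) by (intro emeasure_mono) auto
    then show False using null_setsD1[OF N(1)] e(1) by simp
  qed
  then have sub: "{a<..<b} \<subseteq> {t \<in> {a..b}. v t \<in> C}" by force
  have "closed {t \<in> {a..b}. v t \<in> C}"
    using continuous_closed_preimage[OF v closed_atLeastAtMost C] by (simp add: Int_def vimage_def)
  then have "closure {a<..<b} \<subseteq> {t \<in> {a..b}. v t \<in> C}" using sub by (rule closure_minimal[rotated])
  then show ?thesis using t ab by auto
qed

section \<open>Boundary control systems\<close>

locale boundary_system = bounded_C0_semigroup T "{x \<in> DAt. G x = 0}" At M w
  for T :: "real \<Rightarrow> 'x::banach \<Rightarrow> 'x" and DAt :: "'x set" and G :: "'x \<Rightarrow> 'v::banach"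
    and At :: "'x \<Rightarrow> 'x" and M w :: real +
  fixes Gam :: "'x \<Rightarrow> 'v"
  assumes At_closed: "closed_operator DAt At"
    and G_bounded: "graph_bounded DAt At G"
    and Gam_bounded: "graph_bounded DAt At Gam"
    and G_surj: "G ` DAt = UNIV"
begin

abbreviation D :: "'x set" where "D \<equiv> {x \<in> DAt. G x = 0}"
abbreviation Dir :: "real \<Rightarrow> 'v \<Rightarrow> 'x" where "Dir \<equiv> dirichlet_op DAt At G"

lemma DAt_add: "x \<in> DAt \<Longrightarrow> y \<in> DAt \<Longrightarrow> x + y \<in> DAt"
  and DAt_scaleR: "x \<in> DAt \<Longrightarrow> c *\<^sub>R x \<in> DAt"
  using At_closed unfolding closed_operator_def lin_subspace_def by blast+

lemma DAt_diff: "x \<in> DAt \<Longrightarrow> y \<in> DAt \<Longrightarrow> x - y \<in> DAt"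
  using DAt_add[of x "(-1) *\<^sub>R y"] DAt_scaleR[of y "-1"] by simp

lemma linear_on_dom_diff:
  assumes "linear_on_dom DAt F" "x \<in> DAt" "y \<in> DAt" shows "F (x - y) = F x - F y"
proof -
  have "F (x + (-1) *\<^sub>R y) = F x + (-1) *\<^sub>R F y"
    using assms DAt_scaleR unfolding linear_on_dom_def by metis
  then show ?thesis by simp
qed

lemma At_lin: "linear_on_dom DAt At" and G_lin: "linear_on_dom DAt G" and Gam_lin: "linear_on_dom DAt Gam"
  using At_closed G_bounded Gam_bounded unfolding closed_operator_def graph_bounded_def by blast+

lemmas At_diff = linear_on_dom_diff[OF At_lin] and G_diff = linear_on_dom_diff[OF G_lin]
  and Gam_diff = linear_on_dom_diff[OF Gam_lin]

lemma At_add: "x \<in> DAt \<Longrightarrow> y \<in> DAt \<Longrightarrow> At (x + y) = At x + At y"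
  and G_add: "x \<in> DAt \<Longrightarrow> y \<in> DAt \<Longrightarrow> G (x + y) = G x + G y"
  and Gam_add: "x \<in> DAt \<Longrightarrow> y \<in> DAt \<Longrightarrow> Gam (x + y) = Gam x + Gam y"
  and At_scaleR: "x \<in> DAt \<Longrightarrow> At (c *\<^sub>R x) = c *\<^sub>R At x"
  and G_scaleR: "x \<in> DAt \<Longrightarrow> G (c *\<^sub>R x) = c *\<^sub>R G x"
  and Gam_scaleR: "x \<in> DAt \<Longrightarrow> Gam (c *\<^sub>R x) = c *\<^sub>R Gam x"
  using At_lin G_lin Gam_lin unfolding linear_on_dom_def by auto

lemma graph_boundedE:
  fixes F :: "'x \<Rightarrow> 'c::real_normed_vector"
  assumes "graph_bounded DAt At F"
  obtains C where "0 \<le> C" "\<And>x. x \<in> DAt \<Longrightarrow> norm (F x) \<le> C * (norm x + norm (At x))"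
proof -
  obtain C where C: "\<And>x. x \<in> DAt \<Longrightarrow> norm (F x) \<le> C * (norm x + norm (At x))"
    using assms unfolding graph_bounded_def by blast
  have "norm (F x) \<le> \<bar>C\<bar> * (norm x + norm (At x))" if "x \<in> DAt" for x
    by (rule order_trans[OF C[OF that]]) (intro mult_right_mono, auto)
  then show thesis using that[of "\<bar>C\<bar>"] by simp
qed

text \<open>Operators bounded for the graph norm pass to limits only if \<open>At (X n)\<close>
  converges along with \<open>X n\<close>.\<close>

lemma graph_bounded_tendsto:
  fixes F :: "'x \<Rightarrow> 'c::real_normed_vector"
  assumes F: "graph_bounded DAt At F" and X: "\<forall>\<^sub>F n in H. X n \<in> DAt" and x: "x \<in> DAt"
    and lim: "(X \<longlongrightarrow> x) H" "((\<lambda>n. At (X n)) \<longlongrightarrow> At x) H"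
  shows "((\<lambda>n. F (X n)) \<longlongrightarrow> F x) H"
proof -
  obtain C where C: "\<And>x. x \<in> DAt \<Longrightarrow> norm (F x) \<le> C * (norm x + norm (At x))"
    by (rule graph_boundedE[OF F]) (rule that)
  have lin: "linear_on_dom DAt F" using F unfolding graph_bounded_def by blast
  show ?thesis
  proof (rule LIM_zero_cancel, rule Lim_null_comparison)
    show "\<forall>\<^sub>F n in H. norm (F (X n) - F x) \<le> C * (norm (X n - x) + norm (At (X n) - At x))"
      using X
    proof eventually_elim
      case (elim n)
      then show ?case using C[OF DAt_diff[OF elim x]] by (simp add: linear_on_dom_diff[OF lin] At_diff x)
    qed
    have "((\<lambda>n. norm (X n - x) + norm (At (X n) - At x)) \<longlongrightarrow> 0 + 0) H"
      using lim by (intro tendsto_add tendsto_norm_zero) (simp_all add: LIM_zero_iff)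
    then show "((\<lambda>n. C * (norm (X n - x) + norm (At (X n) - At x))) \<longlongrightarrow> 0) H"
      by (intro tendsto_mult_right_zero) simp
  qed
qed

section \<open>Dirichlet operators\<close>

text \<open>Two solutions differ by an element of \<open>D\<close> that is annihilated by l - A, and
  the resolvent maps 0 to 0. This gives meaning to the definite description in
  \<open>dirichlet_op\<close>.\<close>

lemma Dir_unique:
  assumes R: "is_resolvent l R" and x: "x \<in> DAt" "At x = l *\<^sub>R x" "G x = v"
  shows "Dir l v = x"
  unfolding dirichlet_op_def
proof (rule the_equality)
  fix y assume y: "y \<in> DAt \<and> At y = l *\<^sub>R y \<and> G y = v"
  then have "y - x \<in> D" using x by (simp add: DAt_diff G_diff)
  from is_resolventD(4)[OF R this] have "R 0 = y - x"
    using x y by (simp add: At_diff algebra_simps)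
  then show "y = x" by (simp add: linear_simps[OF is_resolventD(1)[OF R]])
qed (use x in simp)

text \<open>Any preimage \<open>x\<close> of \<open>v\<close> under \<open>G\<close> is corrected by
  R(l x - At x), which lies in the kernel of \<open>G\<close> and removes the defect in the
  eigenvalue equation.\<close>

lemma Dir:
  assumes R: "is_resolvent l R"
  shows "Dir l v \<in> DAt" "At (Dir l v) = l *\<^sub>R Dir l v" "G (Dir l v) = v"
proof -
  obtain x where x: "x \<in> DAt" "G x = v" using G_surj by (metis UNIV_I imageE)
  let ?u = "R (l *\<^sub>R x - At x)"
  have u: "?u \<in> DAt" "G ?u = 0" "l *\<^sub>R ?u - At ?u = l *\<^sub>R x - At x"
    using is_resolventD(2,3)[OF R, of "l *\<^sub>R x - At x"] by auto
  have *: "x - ?u \<in> DAt" "At (x - ?u) = l *\<^sub>R (x - ?u)" "G (x - ?u) = v"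
    using x u by (auto simp: DAt_diff At_diff G_diff algebra_simps)
  then show "Dir l v \<in> DAt" "At (Dir l v) = l *\<^sub>R Dir l v" "G (Dir l v) = v"
    using Dir_unique[OF R *] by simp_all
qed

lemma linear_Dir:
  assumes R: "is_resolvent l R" shows "linear (Dir l)"
proof (rule linearI)
  show "Dir l (u + v) = Dir l u + Dir l v" for u v
    by (rule Dir_unique[OF R]) (simp_all add: Dir[OF R] DAt_add At_add G_add scaleR_add_right)
  show "Dir l (c *\<^sub>R v) = c *\<^sub>R Dir l v" for c v
    by (rule Dir_unique[OF R]) (simp_all add: Dir[OF R] DAt_scaleR At_scaleR G_scaleR)
qed

lemma Dir_diff_in_D:
  assumes "is_resolvent l R" "is_resolvent m Rm"
  shows "Dir m v - Dir l v \<in> D" "At (Dir m v - Dir l v) = m *\<^sub>R Dir m v - l *\<^sub>R Dir l v"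
  using assms by (auto simp: Dir DAt_diff At_diff G_diff)

text \<open>The difference lies in \<open>D\<close>, and l - A maps it to (l - m) D_m v. This
  identity links all Dirichlet operators; it yields the positivity of D_n - D_2n as well as the
  formula for R(n) D_m.\<close>

lemma Dir_diff:
  assumes "is_resolvent l R" "is_resolvent m Rm"
  shows "Dir m v - Dir l v = (l - m) *\<^sub>R R (Dir m v)"
proof -
  have "R ((l - m) *\<^sub>R Dir m v) = Dir m v - Dir l v"
    using is_resolventD(4)[OF assms(1) Dir_diff_in_D(1)[OF assms], of v] Dir_diff_in_D(2)[OF assms, of v]
    by (simp add: algebra_simps)
  then show ?thesis by (simp add: linear_simps[OF is_resolventD(1)[OF assms(1)]])
qed

text \<open>\<open>At\<close> acts on the range of \<open>Dir l\<close> as multiplication by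
  \<open>l\<close>, so convergence of the images is convergence in the graph norm and both equations
  pass to the limit.\<close>

lemma Dir_closed_graph:
  assumes R: "is_resolvent l R" and v: "X \<longlonglongrightarrow> v" and y: "(\<lambda>n. Dir l (X n)) \<longlonglongrightarrow> y"
  shows "Dir l v = y"
proof -
  have "closed {(x, At x) | x. x \<in> DAt}" using At_closed unfolding closed_operator_def by blast
  moreover have "(Dir l (X n), l *\<^sub>R Dir l (X n)) \<in> {(x, At x) | x. x \<in> DAt}" for n
    using Dir[OF R, of "X n"] by auto
  moreover have "(\<lambda>n. (Dir l (X n), l *\<^sub>R Dir l (X n))) \<longlonglongrightarrow> (y, l *\<^sub>R y)"
    by (intro tendsto_intros y)
  ultimately have "(y, l *\<^sub>R y) \<in> {(x, At x) | x. x \<in> DAt}"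
    by (rule closed_sequentially)
  then have y': "y \<in> DAt" "At y = l *\<^sub>R y" by auto
  have "(\<lambda>n. G (Dir l (X n))) \<longlonglongrightarrow> G y"
    using y by (intro graph_bounded_tendsto[OF G_bounded]) (auto simp: Dir[OF R] y' intro: tendsto_intros)
  then have "G y = v" using LIMSEQ_unique v by (simp add: Dir[OF R])
  with y' show ?thesis by (intro Dir_unique[OF R])
qed

text \<open>Closed graph theorem and uniform boundedness at once. The factor \<open>c l\<close> is
  taken as \<open>l\<close> for the family of Assumption 2 and as 1 for a single operator; being
  nonzero, it preserves closedness of the graph.\<close>

lemma Dir_uniform_bound:
  assumes R: "\<And>l. l \<in> I \<Longrightarrow> \<exists>R. is_resolvent l R"
    and ptw: "\<And>v. \<exists>C. \<forall>l\<in>I. norm (c l *\<^sub>R Dir l v) \<le> C" and c: "\<And>l. l \<in> I \<Longrightarrow> c l \<noteq> 0"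
  obtains C where "C > 0" "\<And>l v. l \<in> I \<Longrightarrow> norm (c l *\<^sub>R Dir l v) \<le> C * norm v"
proof (rule closed_graph_uniform_bound[of I "\<lambda>l v. c l *\<^sub>R Dir l v"])
  fix l assume l: "l \<in> I"
  obtain R where R: "is_resolvent l R" using R[OF l] by blast
  show "linear (\<lambda>v. c l *\<^sub>R Dir l v)" by (rule linear_compose_scale_right[OF linear_Dir[OF R]])
  fix X v y assume "X \<longlonglongrightarrow> v" "(\<lambda>n. c l *\<^sub>R Dir l (X n)) \<longlonglongrightarrow> y"
  moreover from this(2) have "(\<lambda>n. (1 / c l) *\<^sub>R (c l *\<^sub>R Dir l (X n))) \<longlonglongrightarrow> (1 / c l) *\<^sub>R y"
    by (intro tendsto_scaleR tendsto_const)
  ultimately have "Dir l v = (1 / c l) *\<^sub>R y" using Dir_closed_graph[OF R] c[OF l] by simp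
  then show "c l *\<^sub>R Dir l v = y" using c[OF l] by simp
qed (use ptw that in blast)+

lemma bounded_linear_Dir:
  assumes R: "is_resolvent l R" shows "bounded_linear (Dir l)"
proof -
  obtain C where "\<And>v. norm (1 *\<^sub>R Dir l v) \<le> C * norm v"
    by (rule Dir_uniform_bound[of "{l}" "\<lambda>_. 1"]) (use R in auto)
  then show ?thesis
    using linear_Dir[OF R] by (intro bounded_linear_intro[where K = C]) (auto simp: linear_add linear_cmul mult.commute)
qed

text \<open>From At (R x) = l R x - x the graph norm of \<open>R x\<close> is controlled by the norm
  of \<open>x\<close>.\<close>

lemma bounded_linear_Gam_resolvent:
  assumes R: "is_resolvent l R" shows "bounded_linear (\<lambda>x. Gam (R x))"
proof -
  note lin = is_resolventD(1)[OF R]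
  have RD: "R x \<in> DAt" for x using is_resolventD(2)[OF R] by simp
  obtain C where C: "0 \<le> C" "\<And>x. x \<in> DAt \<Longrightarrow> norm (Gam x) \<le> C * (norm x + norm (At x))"
    by (rule graph_boundedE[OF Gam_bounded]) (rule that)
  obtain B where B: "0 \<le> B" "\<And>x. norm (R x) \<le> norm x * B"
    using bounded_linear.nonneg_bounded[OF lin] by blast
  show ?thesis
  proof (rule bounded_linear_intro)
    show "Gam (R (x + y)) = Gam (R x) + Gam (R y)" for x y by (simp add: linear_simps[OF lin] Gam_add RD)
    show "Gam (R (c *\<^sub>R x)) = c *\<^sub>R Gam (R x)" for c x by (simp add: linear_simps[OF lin] Gam_scaleR RD)
    fix x
    have "At (R x) = l *\<^sub>R R x - x" using is_resolventD(3)[OF R, of x] by (simp add: algebra_simps)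
    then have "norm (At (R x)) \<le> \<bar>l\<bar> * norm (R x) + norm x" using norm_triangle_ineq4[of "l *\<^sub>R R x" x] by simp
    then have "norm (Gam (R x)) \<le> C * (norm (R x) + (\<bar>l\<bar> * norm (R x) + norm x))"
      using C(2)[OF RD[of x]] C(1) by (smt (verit) mult_left_mono)
    also have "\<dots> \<le> C * (norm x * B + (\<bar>l\<bar> * (norm x * B) + norm x))"
      using B C(1) by (intro mult_left_mono add_mono) auto
    also have "\<dots> = norm x * (C * (B + (\<bar>l\<bar> * B + 1)))" by (simp add: algebra_simps)
    finally show "norm (Gam (R x)) \<le> norm x * (C * (B + (\<bar>l\<bar> * B + 1)))" .
  qed
qed

text \<open>The bound on \<open>l D\<^sub>l\<close> puts the range of every Dirichlet operator into the Favard class: choose \<open>l = 1 / h\<close>.\<close>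

lemma Dir_Favard:
  assumes l0: "0 < l0" "w < l0" and C: "\<And>l v. l0 \<le> l \<Longrightarrow> norm (l *\<^sub>R Dir l v) \<le> C * norm v"
    and R: "is_resolvent m R"
  obtains F where "0 \<le> F" "\<And>v h. 0 < h \<Longrightarrow> h < min 1 (1 / l0) \<Longrightarrow> norm (T h (Dir m v) - Dir m v) \<le> h * (F * norm v)"
proof -
  obtain B where B: "0 \<le> B" "\<And>v. norm (Dir m v) \<le> norm v * B"
    using bounded_linear.nonneg_bounded[OF bounded_linear_Dir[OF R]] by blast
  define F where "F = K 1 * (\<bar>m\<bar> * B + \<bar>C\<bar>) + (K 1 + 1) * \<bar>C\<bar>"
  show thesis
  proof (rule that[of F])
    show "0 \<le> F" using B(1) K_pos[of 1] unfolding F_def by (intro add_nonneg_nonneg mult_nonneg_nonneg) auto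
    fix v and h :: real assume h: "0 < h" "h < min 1 (1 / l0)"
    let ?l = "1 / h"
    have "l0 \<le> ?l" using h l0 by (auto simp: field_simps)
    then have l: "l0 \<le> ?l" "w < ?l" using l0(2) by auto
    obtain Rl where Rl: "is_resolvent ?l Rl" by (rule resolvent_exists[OF l(2)]) (rule that)
    \<comment> \<open>Splits D_m v into a part in \<open>D\<close> whose image under
      \<open>At\<close> is bounded independently of \<open>h\<close>, and D_l v, which is itself of
      size \<open>h\<close> for l = 1 / h. Both move by O(h) under \<open>T h\<close>.\<close>
    let ?u = "Dir m v - Dir ?l v"
    have u: "?u \<in> D" "At ?u = m *\<^sub>R Dir m v - ?l *\<^sub>R Dir ?l v" by (rule Dir_diff_in_D[OF Rl R])+
    have Dl: "norm (?l *\<^sub>R Dir ?l v) \<le> \<bar>C\<bar> * norm v"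
      by (rule order_trans[OF C[OF l(1)]]) (intro mult_right_mono, auto)
    have Dl': "norm (Dir ?l v) \<le> h * (\<bar>C\<bar> * norm v)" using Dl h by (simp add: field_simps)
    have "norm (At ?u) \<le> norm (m *\<^sub>R Dir m v) + norm (?l *\<^sub>R Dir ?l v)" unfolding u(2) by (rule norm_triangle_ineq4)
    also have "norm (m *\<^sub>R Dir m v) \<le> \<bar>m\<bar> * (norm v * B)" using B(2) by (simp add: mult_left_mono)
    finally have Au: "norm (At ?u) \<le> (\<bar>m\<bar> * B + \<bar>C\<bar>) * norm v" using Dl by (simp add: algebra_simps)
    have Kh: "K h \<le> K 1" using h M_pos by (simp add: K_def mult_left_le)
    have 1: "norm (T h ?u - ?u) \<le> K 1 * h * ((\<bar>m\<bar> * B + \<bar>C\<bar>) * norm v)"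
    proof -
      have "norm (T h ?u - ?u) \<le> K h * h * norm (At ?u)" using h by (intro norm_T_minus_id_le u) simp
      also have "\<dots> \<le> K 1 * h * ((\<bar>m\<bar> * B + \<bar>C\<bar>) * norm v)"
        using Kh Au h K_pos[of 1] by (intro mult_mono) auto
      finally show ?thesis .
    qed
    have 2: "norm (T h (Dir ?l v) - Dir ?l v) \<le> (K 1 + 1) * (h * (\<bar>C\<bar> * norm v))"
    proof -
      have "norm (T h (Dir ?l v) - Dir ?l v) \<le> norm (T h (Dir ?l v)) + norm (Dir ?l v)" by (rule norm_triangle_ineq4)
      also have "\<dots> \<le> (K 1 + 1) * norm (Dir ?l v)" using T_bound[of h 1 "Dir ?l v"] h by (simp add: distrib_right)
      also have "\<dots> \<le> (K 1 + 1) * (h * (\<bar>C\<bar> * norm v))" using Dl' K_pos[of 1] by (intro mult_left_mono) auto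
      finally show ?thesis .
    qed
    have "T h (Dir m v) - Dir m v = (T h ?u - ?u) + (T h (Dir ?l v) - Dir ?l v)" using h by (simp add: T_diff)
    then have "norm (T h (Dir m v) - Dir m v) \<le> norm (T h ?u - ?u) + norm (T h (Dir ?l v) - Dir ?l v)"
      by (simp only: norm_triangle_ineq)
    also have "\<dots> \<le> h * (F * norm v)" using 1 2 by (simp add: F_def algebra_simps)
    finally show "norm (T h (Dir m v) - Dir m v) \<le> h * (F * norm v)" .
  qed
qed

section \<open>Regularity of the extrapolated convolution\<close>

lemma conv_Dir_C1:
  assumes R: "is_resolvent m R" and k: "C1_fun k k'" and t: "0 \<le> t"
  shows "conv (\<lambda>s. Dir m (k s)) t \<in> D"
    and "At (conv (\<lambda>s. Dir m (k s)) t) = conv (\<lambda>s. Dir m (k' s)) t + T t (Dir m (k 0)) - Dir m (k t)"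
  using conv_C1[OF C1_fun_linear[OF bounded_linear_Dir[OF R] k] t] by blast+

lemma Dir_continuous_on:
  "is_resolvent m R \<Longrightarrow> continuous_on S k \<Longrightarrow> continuous_on S (\<lambda>s. Dir m (k s))"
  by (rule bounded_linear.continuous_on[OF bounded_linear_Dir])

text \<open>For smooth \<open>v\<close> with v(0) = 0, \<open>conv_Dir_C1\<close> gives m y - A y =
  D_m v + W with W the convolution of D_m (m v - v'). In general v' is only an L^1 limit of C^1
  functions; the Favard bound makes the approximations of W Cauchy in the graph norm, so W still
  takes values in \<open>D\<close>.\<close>

lemma conv_Dir_regular:
  assumes R: "is_resolvent m R" and \<tau>: "0 < \<tau>"
    and F: "0 \<le> F" "0 < h0" "\<And>v h. 0 < h \<Longrightarrow> h < h0 \<Longrightarrow> norm (T h (Dir m v) - Dir m v) \<le> h * (F * norm v)"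
    and v: "continuous_on {0..\<tau>} v"
    and approx: "C1_approximable_primitive \<tau> g v"
  obtains W where "continuous_on {0..\<tau>} W" "continuous_on {0..\<tau>} (\<lambda>t. At (W t))"
    "\<And>t. t \<in> {0..\<tau>} \<Longrightarrow> W t \<in> D" "\<And>t. t \<in> {0..\<tau>} \<Longrightarrow> conv (\<lambda>s. Dir m (v s)) t \<in> D"
    "\<And>t. t \<in> {0..\<tau>} \<Longrightarrow>
      m *\<^sub>R conv (\<lambda>s. Dir m (v s)) t - At (conv (\<lambda>s. Dir m (v s)) t) = Dir m (v t) + W t"
proof -
  note linD = linear_simps[OF bounded_linear_Dir[OF R]]
  define \<epsilon> where "\<epsilon> n = inverse (real (Suc n))" for n
  have \<epsilon>: "0 < \<epsilon> n" for n by (simp add: \<epsilon>_def)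
  have \<epsilon>0: "\<epsilon> \<longlonglongrightarrow> 0" unfolding \<epsilon>_def by (rule LIMSEQ_inverse_real_of_nat)
  define P where "P n r q q' e \<longleftrightarrow> C1_fun r q \<and> C1_fun q q' \<and> r 0 = 0 \<and> e integrable_on {0..\<tau>} \<and>
     integral {0..\<tau>} e < \<epsilon> n \<and> (\<forall>t\<in>{0..\<tau>}. norm (g t - q t) \<le> e t) \<and> (\<forall>t\<in>{0..\<tau>}. norm (v t - r t) \<le> \<epsilon> n)"
    for n r q q' e
  have "\<forall>n. \<exists>r q q' e. P n r q q' e" unfolding P_def using approx \<epsilon> by (simp add: C1_approximable_primitive_def)
  then obtain r q q' e where P: "\<And>n. P n (r n) (q n) (q' n) (e n)" by metis
  have rq: "C1_fun (r n) (q n)" "C1_fun (q n) (q' n)" "r n 0 = 0" and e: "e n integrable_on {0..\<tau>}" "integral {0..\<tau>} (e n) < \<epsilon> n"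
    and gq: "t \<in> {0..\<tau>} \<Longrightarrow> norm (g t - q n t) \<le> e n t" and vr: "t \<in> {0..\<tau>} \<Longrightarrow> norm (v t - r n t) \<le> \<epsilon> n" for n t
    using P[of n] unfolding P_def by auto
  have rc: "continuous_on S (r n)" and qc: "continuous_on S (q n)" and q'c: "continuous_on S (q' n)" for S n
    using rq C1_fun_continuous C1_fun_continuous' by blast+
  have e0: "0 \<le> e n t" if "t \<in> {0..\<tau>}" for n t using gq[OF that, of n] norm_ge_zero order_trans by blast
  \<comment> \<open>The smooth substitute for m v - v'. It is C^1 because \<open>q n\<close> is C^1,
    which is why the derivative, and not just \<open>v\<close>, is approximated by C^1
    functions.\<close>
  define k where "k n s = m *\<^sub>R r n s - q n s" for n s
  define k' where "k' n s = m *\<^sub>R q n s - q' n s" for n s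
  have k: "C1_fun (k n) (k' n)" for n
    using rq unfolding k_def k'_def C1_fun_def by (auto intro!: derivative_eq_intros continuous_intros qc)
  have kc: "continuous_on S (k n)" for S n using k by (rule C1_fun_continuous)
  have kd: "C1_fun (\<lambda>s. k n s - k j s) (\<lambda>s. k' n s - k' j s)" for n j
    using k[of n] k[of j] unfolding C1_fun_def by (auto intro!: derivative_eq_intros continuous_intros)
  define W where "W n t = conv (\<lambda>s. Dir m (k n s)) t" for n t
  obtain B where B: "0 \<le> B" "\<And>v. norm (Dir m v) \<le> norm v * B"
    using bounded_linear.nonneg_bounded[OF bounded_linear_Dir[OF R]] by blast
  have W_D: "W n t \<in> D" if "t \<in> {0..\<tau>}" for n t
    unfolding W_def using conv_Dir_C1(1)[OF R k] that by simp
  have W_diff: "W n t - W j t = conv (\<lambda>s. Dir m (k n s - k j s)) t" for n j t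
    unfolding W_def by (simp add: linD conv_diff Dir_continuous_on[OF R] kc)
  have K_mono: "K t \<le> K \<tau>" if "t \<in> {0..\<tau>}" for t
    using that M_pos by (simp add: K_def mult_left_mono)
  \<comment> \<open>Majorant of \<open>k n s - k j s\<close>: the primitives are uniformly close and
    contribute the constant term, whereas the derivatives are close only in L^1 and contribute
    \<open>e n s + e j s\<close>.\<close>
  define N where "N n j s = \<bar>m\<bar> * (\<epsilon> n + \<epsilon> j) + (e n s + e j s)" for n j s
  have e_int: "e n integrable_on {0..t}" if "t \<in> {0..\<tau>}" for n t
    by (rule integrable_on_subinterval[OF e(1)]) (use that in auto)
  have N_int: "N n j integrable_on {0..t}" if "t \<in> {0..\<tau>}" for n j t
    unfolding N_def by (intro integrable_add e_int that) auto
  have N_le: "integral {0..t} (N n j) \<le> (\<bar>m\<bar> * \<tau> + 1) * (\<epsilon> n + \<epsilon> j)" if t: "t \<in> {0..\<tau>}" for n j t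
  proof -
    have "integral {0..t} (e n) \<le> \<epsilon> n" for n
      using integral_subset_le[OF _ e_int[OF t] e(1), of n] e(2)[of n] e0 t by force
    note this[of n] this[of j]
    moreover have "integral {0..t} (N n j) = t * (\<bar>m\<bar> * (\<epsilon> n + \<epsilon> j)) + (integral {0..t} (e n) + integral {0..t} (e j))"
    proof -
      have "integral {0..t} (N n j) = integral {0..t} (\<lambda>s. \<bar>m\<bar> * (\<epsilon> n + \<epsilon> j)) + integral {0..t} (\<lambda>s. e n s + e j s)"
        unfolding N_def by (intro integral_add integrable_add e_int t) auto
      also have "integral {0..t} (\<lambda>s. e n s + e j s) = integral {0..t} (e n) + integral {0..t} (e j)"
        by (intro integral_add e_int t)
      finally show ?thesis using t by (simp add: content_real)
    qed
    moreover have "t * (\<bar>m\<bar> * (\<epsilon> n + \<epsilon> j)) \<le> \<tau> * (\<bar>m\<bar> * (\<epsilon> n + \<epsilon> j))"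
      using t \<epsilon>[of n] \<epsilon>[of j] by (intro mult_right_mono) auto
    ultimately show ?thesis by (simp add: algebra_simps)
  qed
  have k_le: "norm (k n s - k j s) \<le> N n j s" if s: "s \<in> {0..\<tau>}" for n j s
  proof -
    have "norm (r n s - r j s) \<le> \<epsilon> n + \<epsilon> j"
      using norm_triangle_ineq4[of "v s - r j s" "v s - r n s"] vr[OF s, of n] vr[OF s, of j] by simp
    then have 1: "norm (m *\<^sub>R (r n s - r j s)) \<le> \<bar>m\<bar> * (\<epsilon> n + \<epsilon> j)" by (simp only: norm_scaleR) (rule mult_left_mono, auto)
    have 2: "norm (q n s - q j s) \<le> e n s + e j s"
      using norm_triangle_ineq4[of "g s - q j s" "g s - q n s"] gq[OF s, of n] gq[OF s, of j] by simp
    have "k n s - k j s = m *\<^sub>R (r n s - r j s) - (q n s - q j s)" by (simp add: k_def algebra_simps)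
    then have "norm (k n s - k j s) \<le> norm (m *\<^sub>R (r n s - r j s)) + norm (q n s - q j s)"
      by (simp only: norm_triangle_ineq4)
    then show ?thesis using 1 2 by (simp add: N_def)
  qed
  have bound: "K t * integral {0..t} (\<lambda>s. b * N n j s) \<le> (K \<tau> * b * (\<bar>m\<bar> * \<tau> + 1)) * (\<epsilon> n + \<epsilon> j)"
    if t: "t \<in> {0..\<tau>}" and b: "0 \<le> b" for t n j b
  proof -
    have "0 \<le> integral {0..t} (N n j)"
    proof (rule integral_nonneg[OF N_int[OF t]])
      fix s assume "s \<in> {0..t}"
      then have "s \<in> {0..\<tau>}" using t by auto
      then show "0 \<le> N n j s" using k_le norm_ge_zero order_trans by blast
    qed
    then have "K t * (b * integral {0..t} (N n j)) \<le> K \<tau> * (b * ((\<bar>m\<bar> * \<tau> + 1) * (\<epsilon> n + \<epsilon> j)))"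
      using K_mono[OF t] N_le[OF t, of n j] b K_pos[of \<tau>] by (intro mult_mono mult_nonneg_nonneg) auto
    then show ?thesis by (simp add: mult.assoc)
  qed
  have lim_ex: "\<exists>l. uniform_limit {0..\<tau>} f l sequentially"
    if f: "\<And>n j t. t \<in> {0..\<tau>} \<Longrightarrow> norm (f n t - f j t) \<le> c * (\<epsilon> n + \<epsilon> j)" for f :: "nat \<Rightarrow> real \<Rightarrow> 'x" and c
  proof -
    have "uniformly_Cauchy_on {0..\<tau>} f"
      unfolding uniformly_Cauchy_on_def
    proof (intro allI impI)
      fix d :: real assume d: "0 < d"
      have "(\<lambda>n. \<bar>c\<bar> * \<epsilon> n) \<longlonglongrightarrow> 0" by (rule tendsto_mult_right_zero[OF \<epsilon>0])
      then have "\<forall>\<^sub>F n in sequentially. \<bar>c\<bar> * \<epsilon> n < d / 2" using d by (intro order_tendstoD(2)) auto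
      then obtain N1 where N1: "\<And>n. N1 \<le> n \<Longrightarrow> \<bar>c\<bar> * \<epsilon> n < d / 2" by (auto simp: eventually_sequentially)
      have "dist (f n t) (f j t) < d" if "t \<in> {0..\<tau>}" "N1 \<le> n" "N1 \<le> j" for t n j
      proof -
        have "c * (\<epsilon> n + \<epsilon> j) \<le> \<bar>c\<bar> * (\<epsilon> n + \<epsilon> j)" using \<epsilon>[of n] \<epsilon>[of j] by (intro mult_right_mono) auto
        then show ?thesis using f[OF that(1), of n j] N1[OF that(2)] N1[OF that(3)]
          by (simp add: dist_norm distrib_left)
      qed
      then show "\<exists>N. \<forall>x\<in>{0..\<tau>}. \<forall>n\<ge>N. \<forall>j\<ge>N. dist (f n x) (f j x) < d" by blast
    qed
    then show ?thesis using Cauchy_uniformly_convergent unfolding uniformly_convergent_on_def by blast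
  qed
  have W_Cauchy: "norm (W n t - W j t) \<le> (K \<tau> * B * (\<bar>m\<bar> * \<tau> + 1)) * (\<epsilon> n + \<epsilon> j)" if t: "t \<in> {0..\<tau>}" for n j t
  proof -
    have "norm (W n t - W j t) \<le> K t * integral {0..t} (\<lambda>s. B * N n j s)"
      unfolding W_diff
    proof (rule norm_conv_le)
      show "continuous_on {0..t} (\<lambda>s. Dir m (k n s - k j s))" by (intro Dir_continuous_on[OF R] continuous_intros kc)
      show "(\<lambda>s. B * N n j s) integrable_on {0..t}" by (intro integrable_on_mult_right N_int t)
      fix s assume "s \<in> {0..t}"
      then have s: "s \<in> {0..\<tau>}" using t by auto
      show "norm (Dir m (k n s - k j s)) \<le> B * N n j s"
        using order_trans[OF B(2) mult_right_mono[OF k_le[OF s] B(1)]] by (simp add: mult.commute)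
    qed
    also have "\<dots> \<le> (K \<tau> * B * (\<bar>m\<bar> * \<tau> + 1)) * (\<epsilon> n + \<epsilon> j)" by (rule bound[OF t B(1)])
    finally show ?thesis .
  qed
  \<comment> \<open>The crucial estimate: it sees only the L^1 size of \<open>k n - k j\<close>.
    Applying \<open>conv_C1\<close> instead would bring in the derivatives \<open>k' n\<close>, on
    which there is no control.\<close>
  have AW_Cauchy: "norm (At (W n t) - At (W j t)) \<le> (K \<tau> * F * (\<bar>m\<bar> * \<tau> + 1)) * (\<epsilon> n + \<epsilon> j)" if t: "t \<in> {0..\<tau>}" for n j t
  proof -
    have "At (W n t) - At (W j t) = At (conv (\<lambda>s. Dir m (k n s - k j s)) t)"
      using W_D[OF t] by (simp flip: W_diff add: At_diff)
    also have "norm \<dots> \<le> K t * integral {0..t} (\<lambda>s. F * N n j s)"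
    proof (rule norm_A_conv_le[where ?h0.0 = h0])
      show "conv (\<lambda>s. Dir m (k n s - k j s)) t \<in> D" using conv_Dir_C1(1)[OF R kd] t by simp
      show "continuous_on {0..t} (\<lambda>s. Dir m (k n s - k j s))" by (intro Dir_continuous_on[OF R] continuous_intros kc)
      show "(\<lambda>s. F * N n j s) integrable_on {0..t}" by (intro integrable_on_mult_right N_int t)
      fix s h assume "s \<in> {0..t}" and h: "0 < h" "h < h0"
      then have s: "s \<in> {0..\<tau>}" using t by auto
      have "h * (F * norm (k n s - k j s)) \<le> h * (F * N n j s)"
        using h F(1) k_le[OF s] by (intro mult_left_mono) auto
      then show "norm (T h (Dir m (k n s - k j s)) - Dir m (k n s - k j s)) \<le> h * (F * N n j s)"
        using F(3)[OF h, of "k n s - k j s"] by linarith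
    qed (use t F in auto)
    also have "\<dots> \<le> (K \<tau> * F * (\<bar>m\<bar> * \<tau> + 1)) * (\<epsilon> n + \<epsilon> j)" by (rule bound[OF t F(1)])
    finally show ?thesis .
  qed
  obtain W0 where W0: "uniform_limit {0..\<tau>} W W0 sequentially" using lim_ex[where f = W, OF W_Cauchy] by blast
  obtain Z where Z: "uniform_limit {0..\<tau>} (\<lambda>n t. At (W n t)) Z sequentially" using lim_ex[where f = "\<lambda>n t. At (W n t)", OF AW_Cauchy] by blast
  have contW: "continuous_on {0..\<tau>} (W n)" for n
    unfolding W_def[abs_def] by (intro conv_continuous Dir_continuous_on[OF R] kc)
  have contAW: "continuous_on {0..\<tau>} (\<lambda>t. At (W n t))" for n
  proof -
    have "continuous_on {0..\<tau>} (\<lambda>t. conv (\<lambda>s. Dir m (k' n s)) t + T t (Dir m (k n 0)) - Dir m (k n t))"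
      by (intro continuous_intros conv_continuous Dir_continuous_on[OF R] kc C1_fun_continuous'[OF k]) auto
    then show ?thesis
      by (rule continuous_on_eq) (simp add: W_def conv_Dir_C1(2)[OF R k])
  qed
  have W0c: "continuous_on {0..\<tau>} W0"
    by (rule uniform_limit_theorem[OF _ W0]) (simp_all add: contW)
  have Zc: "continuous_on {0..\<tau>} Z"
    by (rule uniform_limit_theorem[OF _ Z]) (simp_all add: contAW)
  have W0_lim: "(\<lambda>n. W n t) \<longlonglongrightarrow> W0 t" and Z_lim: "(\<lambda>n. At (W n t)) \<longlonglongrightarrow> Z t" if "t \<in> {0..\<tau>}" for t
    using tendsto_uniform_limitI[OF W0 that] tendsto_uniform_limitI[OF Z that] by auto
  have W0_gen: "W0 t \<in> D \<and> At (W0 t) = Z t" if "t \<in> {0..\<tau>}" for t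
    by (rule generator_closed[OF W_D[OF that] W0_lim[OF that] Z_lim[OF that]])
  let ?y = "conv (\<lambda>s. Dir m (v s))"
  \<comment> \<open>The identity for the C^1 primitives \<open>r n\<close>, where the initial value
    0 removes the term with \<open>T t\<close>, is carried to \<open>v\<close> by closedness of the
    generator.\<close>
  have y_gen: "?y t \<in> D \<and> At (?y t) = m *\<^sub>R ?y t - Dir m (v t) - W0 t" if t: "t \<in> {0..\<tau>}" for t
  proof (rule generator_closed)
    let ?yn = "\<lambda>n. conv (\<lambda>s. Dir m (r n s)) t"
    show "?yn n \<in> D" for n using conv_Dir_C1(1)[OF R rq(1)] t by simp
    have vc: "continuous_on {0..t} v" by (rule continuous_on_subset[OF v]) (use t in auto)
    show y_lim: "?yn \<longlonglongrightarrow> ?y t"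
    proof (rule LIM_zero_cancel, rule Lim_null_comparison)
      show "\<forall>\<^sub>F n in sequentially. norm (?yn n - ?y t) \<le> K t * (t * (B * \<epsilon> n))"
      proof (rule always_eventually, rule allI)
        fix n
        have "?yn n - ?y t = conv (\<lambda>s. Dir m (r n s - v s)) t"
          by (simp add: linD conv_diff Dir_continuous_on[OF R] rc vc)
        also have "norm \<dots> \<le> K t * integral {0..t} (\<lambda>s. B * \<epsilon> n)"
        proof (rule norm_conv_le)
          show "continuous_on {0..t} (\<lambda>s. Dir m (r n s - v s))" by (intro Dir_continuous_on[OF R] continuous_intros rc vc)
          fix s assume "s \<in> {0..t}"
          then have s: "s \<in> {0..\<tau>}" using t by auto
          show "norm (Dir m (r n s - v s)) \<le> B * \<epsilon> n"
            using B(2)[of "r n s - v s"] mult_right_mono[OF vr[OF s, of n] B(1)]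
            by (simp add: mult.commute norm_minus_commute)
        qed auto
        finally show "norm (?yn n - ?y t) \<le> K t * (t * (B * \<epsilon> n))" using t by (simp add: content_real mult_ac)
      qed
      show "(\<lambda>n. K t * (t * (B * \<epsilon> n))) \<longlonglongrightarrow> 0" by (intro tendsto_mult_right_zero \<epsilon>0)
    qed
    have r_lim: "(\<lambda>n. r n t) \<longlonglongrightarrow> v t"
    proof (rule LIM_zero_cancel, rule Lim_null_comparison[OF _ \<epsilon>0])
      show "\<forall>\<^sub>F n in sequentially. norm (r n t - v t) \<le> \<epsilon> n" using vr[OF t] by (simp add: norm_minus_commute)
    qed
    have eq: "At (?yn n) = m *\<^sub>R ?yn n - Dir m (r n t) - W n t" for n
    proof -
      have "W n t = conv (\<lambda>s. m *\<^sub>R Dir m (r n s) - Dir m (q n s)) t" by (simp add: W_def k_def linD)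
      also have "\<dots> = m *\<^sub>R ?yn n - conv (\<lambda>s. Dir m (q n s)) t"
      proof -
        have "continuous_on {0..t} (\<lambda>s. m *\<^sub>R Dir m (r n s))" "continuous_on {0..t} (\<lambda>s. Dir m (q n s))"
          by (intro continuous_intros Dir_continuous_on[OF R] rc qc)+
        then show ?thesis by (simp only: conv_diff conv_scaleR)
      qed
      finally show ?thesis
        using conv_Dir_C1(2)[OF R rq(1), of t n] T_scaleR[of t 0 0] t by (simp add: rq(3) linD)
    qed
    show "(\<lambda>n. At (?yn n)) \<longlonglongrightarrow> m *\<^sub>R ?y t - Dir m (v t) - W0 t"
      unfolding eq
      by (intro tendsto_diff tendsto_scaleR tendsto_const y_lim W0_lim[OF t] bounded_linear.tendsto[OF bounded_linear_Dir[OF R] r_lim])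
  qed
  show thesis
  proof (rule that[of W0])
    show "continuous_on {0..\<tau>} (\<lambda>t. At (W0 t))" by (rule continuous_on_eq[OF Zc]) (simp add: W0_gen)
  qed (use W0c W0_gen y_gen in auto)
qed

text \<open>\<open>z = m y - A y\<close> does not depend on \<open>m\<close>; it represents the convolution with \<open>B = (m - A\<^sub>-\<^sub>1) D\<^sub>m\<close>.\<close>

lemma conv_Dir_eq_resolvent:
  assumes Rm: "is_resolvent m Rm" and R: "is_resolvent l R" and v: "continuous_on {0..t} v"
    and y: "conv (\<lambda>s. Dir m (v s)) t \<in> D"
  shows "conv (\<lambda>s. Dir l (v s)) t = R (m *\<^sub>R conv (\<lambda>s. Dir m (v s)) t - At (conv (\<lambda>s. Dir m (v s)) t))"
proof -
  let ?y = "conv (\<lambda>s. Dir m (v s)) t"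
  note lin = linear_simps[OF is_resolventD(1)[OF R]]
  have mc: "continuous_on {0..t} (\<lambda>s. Dir m (v s))" and lc: "continuous_on {0..t} (\<lambda>s. Dir l (v s))"
    using Dir_continuous_on Rm R v by blast+
  have "?y - conv (\<lambda>s. Dir l (v s)) t = conv (\<lambda>s. Dir m (v s) - Dir l (v s)) t"
    by (simp only: conv_diff[OF mc lc])
  also have "\<dots> = conv (\<lambda>s. (l - m) *\<^sub>R R (Dir m (v s))) t" by (simp only: Dir_diff[OF R Rm])
  also have "\<dots> = (l - m) *\<^sub>R R ?y"
    by (simp only: conv_scaleR conv_bounded_linear[OF is_resolventD(1)[OF R] resolvent_T[OF R] mc])
  finally have "conv (\<lambda>s. Dir l (v s)) t = ?y - (l - m) *\<^sub>R R ?y" by (simp add: algebra_simps)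
  moreover have "R (m *\<^sub>R ?y - At ?y) = R (l *\<^sub>R ?y - At ?y) - (l - m) *\<^sub>R R ?y"
    by (simp add: lin algebra_simps)
  ultimately show ?thesis by (simp add: is_resolventD(4)[OF R y])
qed

section \<open>Estimates for the observation operator\<close>

text \<open>\<open>Gam\<close> is bounded only for the graph norm and cannot be moved under the
  integral by itself. Composed with \<open>R\<close> it is bounded on the whole space, and
  \<open>R\<close> commutes with the semigroup.\<close>

lemma Gam_conv_resolvent:
  assumes R: "is_resolvent l R" and g: "continuous_on {0..t} g"
  shows "Gam (R (conv g t)) = integral {0..t} (\<lambda>s. Gam (T (t - s) (R (g s))))"
proof -
  have "Gam (R (conv g t)) = integral {0..t} (\<lambda>s. Gam (R (T (t - s) (g s))))"
    unfolding conv_def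
    using integral_linear[OF conv_integrable[OF g order_refl] bounded_linear_Gam_resolvent[OF R]] by (simp add: o_def)
  also have "\<dots> = integral {0..t} (\<lambda>s. Gam (T (t - s) (R (g s))))"
    by (rule integral_cong) (simp add: resolvent_T[OF R])
  finally show ?thesis .
qed

lemma Gam_T_continuous_on:
  assumes R: "is_resolvent l R" and f: "continuous_on S f" and g: "continuous_on S g" "\<And>x. x \<in> S \<Longrightarrow> 0 \<le> f x"
  shows "continuous_on S (\<lambda>x. Gam (T (f x) (R (g x))))"
proof -
  have "continuous_on S (\<lambda>x. Gam (R (T (f x) (g x))))"
    by (intro bounded_linear.continuous_on[OF bounded_linear_Gam_resolvent[OF R]] continuous_intros f g)
  then show ?thesis by (rule continuous_on_eq) (simp add: resolvent_T[OF R] g(2))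
qed

text \<open>The Volterra estimate for the kernel Gam T(t - s) R g(s). For fixed \<open>s\<close>,
  shifting \<open>t\<close> by \<open>s\<close> and enlarging [0, \<tau> - s] to [0, \<tau>] reduces
  the inner integral to an orbit started at R g(s).\<close>

lemma Gam_conv_Lp_bound:
  assumes R: "is_resolvent l R" and p: "1 \<le> p" and \<tau>: "0 < \<tau>" and g: "continuous_on {0..\<tau>} g"
    and adm: "\<And>s. s \<in> {0..\<tau>} \<Longrightarrow> (\<integral>\<^sup>+t\<in>{0..\<tau>}. ennreal (norm (Gam (T t (R (g s)))) powr p) \<partial>lborel) \<le> ennreal (b s)"
  shows "(\<integral>\<^sup>+t\<in>{0..\<tau>}. ennreal (norm (Gam (R (conv g t))) powr p) \<partial>lborel)
    \<le> ennreal (\<tau> powr (p - 1)) * (\<integral>\<^sup>+s\<in>{0..\<tau>}. ennreal (b s) \<partial>lborel)"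
proof -
  let ?k = "\<lambda>t s. Gam (T (t - s) (R (g s)))"
  have "(\<integral>\<^sup>+t\<in>{0..\<tau>}. ennreal (norm (Gam (R (conv g t))) powr p) \<partial>lborel)
      = (\<integral>\<^sup>+t\<in>{0..\<tau>}. ennreal (norm (integral {0..t} (?k t)) powr p) \<partial>lborel)"
  proof (rule nn_integral_cong)
    fix t
    show "ennreal (norm (Gam (R (conv g t))) powr p) * indicator {0..\<tau>} t
        = ennreal (norm (integral {0..t} (?k t)) powr p) * indicator {0..\<tau>} t"
    proof (cases "t \<in> {0..\<tau>}")
      case True
      have "continuous_on {0..t} g" by (rule continuous_on_subset[OF g]) (use True in auto)
      then show ?thesis by (simp only: Gam_conv_resolvent[OF R])
    qed simp
  qed
  also have "\<dots> \<le> ennreal (\<tau> powr (p - 1)) *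
      (\<integral>\<^sup>+s\<in>{0..\<tau>}. (\<integral>\<^sup>+t\<in>{s..\<tau>}. ennreal (norm (?k t s) powr p) \<partial>lborel) \<partial>lborel)"
    by (intro nn_integral_Volterra_powr_le p \<tau> Gam_T_continuous_on[OF R] continuous_intros continuous_on_compose2[OF g]) auto
  also have "\<dots> \<le> ennreal (\<tau> powr (p - 1)) * (\<integral>\<^sup>+s\<in>{0..\<tau>}. ennreal (b s) \<partial>lborel)"
  proof (intro mult_left_mono nn_integral_mono)
    fix s
    show "(\<integral>\<^sup>+t\<in>{s..\<tau>}. ennreal (norm (?k t s) powr p) \<partial>lborel) * indicator {0..\<tau>} s \<le> ennreal (b s) * indicator {0..\<tau>} s"
    proof (cases "s \<in> {0..\<tau>}")
      case True
      have "continuous_on {0..\<tau> - s} (\<lambda>t. norm (Gam (T t (R (g s)))) powr p)"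
        using p by (intro continuous_on_powr' continuous_intros Gam_T_continuous_on[OF R]) auto
      then have "(\<integral>\<^sup>+t\<in>{s..\<tau>}. ennreal (norm (?k t s) powr p) \<partial>lborel)
          = (\<integral>\<^sup>+t\<in>{0..\<tau> - s}. ennreal (norm (Gam (T t (R (g s)))) powr p) \<partial>lborel)"
        by (rule nn_integral_shift_Icc) simp
      also have "\<dots> \<le> (\<integral>\<^sup>+t\<in>{0..\<tau>}. ennreal (norm (Gam (T t (R (g s)))) powr p) \<partial>lborel)"
        using True by (intro nn_integral_mono mult_left_mono) (auto simp: indicator_def)
      also have "\<dots> \<le> ennreal (b s)" by (rule adm[OF True])
      finally show ?thesis using True by simp
    qed simp
  qed simp
  finally show ?thesis .
qed

text \<open>Because \<open>P\<close> is invariant under the semigroup, the orbit on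
  [n \<alpha>, (n + 1) \<alpha>] is an orbit on [0, \<alpha>] started at T(n \<alpha>) x in
  \<open>P\<close>; induction adds up such pieces. Here \<open>P\<close> stands for the positive
  elements of \<open>D\<close>, which do not form a subspace.\<close>

lemma Gam_admissible_extend:
  assumes R: "is_resolvent l R" and p: "0 < p" and \<alpha>: "0 < \<alpha>" and c: "0 \<le> c"
    and P: "\<And>x. x \<in> P \<Longrightarrow> x \<in> D" "\<And>x t. 0 \<le> t \<Longrightarrow> x \<in> P \<Longrightarrow> T t x \<in> P"
    and adm: "\<And>x. x \<in> P \<Longrightarrow> (\<integral>\<^sup>+t\<in>{0..\<alpha>}. ennreal (norm (Gam (T t x)) powr p) \<partial>lborel) \<le> ennreal (c * norm x powr p)"
  obtains c' where "0 < c'"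
    "\<And>x. x \<in> P \<Longrightarrow> (\<integral>\<^sup>+t\<in>{0..\<tau>}. ennreal (norm (Gam (T t x)) powr p) \<partial>lborel) \<le> ennreal (c' * norm x powr p)"
proof -
  have cont: "continuous_on S (\<lambda>t. norm (Gam (T (f t) x)) powr p)"
    if x: "x \<in> P" and S: "S \<subseteq> {0..}" and f: "continuous_on S f" "\<And>t. t \<in> S \<Longrightarrow> 0 \<le> f t" for S x f
  proof -
    \<comment> \<open>Every \<open>x\<close> in \<open>D\<close> is R(l x - At x), which makes its
      observed orbit continuous and hence measurable.\<close>
    have "continuous_on S (\<lambda>t. Gam (T (f t) (R (l *\<^sub>R x - At x))))"
      by (intro Gam_T_continuous_on[OF R] f continuous_intros)
    then have "continuous_on S (\<lambda>t. Gam (T (f t) x))" by (simp only: is_resolventD(4)[OF R P(1)[OF x]])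
    then show ?thesis using p by (intro continuous_on_powr' continuous_intros) auto
  qed
  have step: "\<exists>c'\<ge>0. \<forall>x\<in>P. (\<integral>\<^sup>+t\<in>{0..real n * \<alpha>}. ennreal (norm (Gam (T t x)) powr p) \<partial>lborel) \<le> ennreal (c' * norm x powr p)" for n
  proof (induction n)
    case 0
    have "(\<integral>\<^sup>+t\<in>{0..real 0 * \<alpha>}. ennreal (norm (Gam (T t x)) powr p) \<partial>lborel) = 0" for x
    proof -
      have "(\<integral>\<^sup>+t\<in>{0..real 0 * \<alpha>}. ennreal (norm (Gam (T t x)) powr p) \<partial>lborel) = (\<integral>\<^sup>+t. 0 \<partial>(lborel :: real measure))"
        by (rule nn_integral_cong_AE) (use AE_lborel_singleton[of 0] in eventually_elim, simp add: indicator_def)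
      then show ?thesis by simp
    qed
    then show ?case by (intro exI[of _ 0]) simp
  next
    case (Suc n)
    then obtain c1 where c1: "0 \<le> c1"
      "\<And>x. x \<in> P \<Longrightarrow> (\<integral>\<^sup>+t\<in>{0..real n * \<alpha>}. ennreal (norm (Gam (T t x)) powr p) \<partial>lborel) \<le> ennreal (c1 * norm x powr p)"
      by blast
    let ?a = "real n * \<alpha>" and ?b = "real (Suc n) * \<alpha>"
    define c2 where "c2 = c * K ?a powr p"
    have a: "0 \<le> ?a" using \<alpha> by simp
    have b: "?b - ?a = \<alpha>" by (simp add: algebra_simps)
    have "(\<integral>\<^sup>+t\<in>{0..?b}. ennreal (norm (Gam (T t x)) powr p) \<partial>lborel) \<le> ennreal ((c1 + c2) * norm x powr p)" if x: "x \<in> P" for x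
    proof -
      let ?h = "\<lambda>t. norm (Gam (T t x)) powr p"
      have meas: "(\<lambda>t. ennreal (?h t) * indicator {u..v} t) \<in> borel_measurable lborel" if "0 \<le> u" for u v
        by (rule borel_measurable_nn_indicator_continuous, rule cont[OF x, of _ "\<lambda>t. t"]) (use that in auto)
      have "(\<integral>\<^sup>+t\<in>{0..?b}. ennreal (?h t) \<partial>lborel) \<le>
          (\<integral>\<^sup>+t. ennreal (?h t) * indicator {0..?a} t + ennreal (?h t) * indicator {?a..?b} t \<partial>lborel)"
        by (rule nn_integral_mono) (auto simp: indicator_def)
      also have "\<dots> = (\<integral>\<^sup>+t\<in>{0..?a}. ennreal (?h t) \<partial>lborel) + (\<integral>\<^sup>+t\<in>{?a..?b}. ennreal (?h t) \<partial>lborel)"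
        by (intro nn_integral_add meas a) simp
      also have "(\<integral>\<^sup>+t\<in>{?a..?b}. ennreal (?h t) \<partial>lborel) =
          (\<integral>\<^sup>+t\<in>{?a..?b}. ennreal (norm (Gam (T (t - ?a) (T ?a x))) powr p) \<partial>lborel)"
        by (rule nn_integral_cong) (use a in \<open>auto simp: indicator_def simp flip: T_add\<close>)
      also have "\<dots> = (\<integral>\<^sup>+t\<in>{0..?b - ?a}. ennreal (norm (Gam (T t (T ?a x))) powr p) \<partial>lborel)"
      proof (rule nn_integral_shift_Icc)
        show "continuous_on {0..?b - ?a} (\<lambda>t. norm (Gam (T t (T ?a x))) powr p)"
          by (rule cont[OF P(2)[OF a x], of _ "\<lambda>t. t"]) auto
      qed simp
      also have "\<dots> \<le> ennreal (c * norm (T ?a x) powr p)" unfolding b by (rule adm[OF P(2)[OF a x]])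
      also have "\<dots> \<le> ennreal (c2 * norm x powr p)"
      proof (rule ennreal_leI)
        have "norm (T ?a x) powr p \<le> (K ?a * norm x) powr p" using T_bound[OF a order_refl] p by (intro powr_mono2) auto
        also have "\<dots> = K ?a powr p * norm x powr p" using K_pos[of ?a] by (simp add: powr_mult)
        finally show "c * norm (T ?a x) powr p \<le> c2 * norm x powr p"
          unfolding c2_def using c by (simp add: mult_left_mono mult.assoc)
      qed
      finally have "(\<integral>\<^sup>+t\<in>{0..?b}. ennreal (?h t) \<partial>lborel) \<le> ennreal (c1 * norm x powr p) + ennreal (c2 * norm x powr p)"
        using c1(2)[OF x] by (meson add_right_mono add_left_mono order_trans)
      then show ?thesis using c1(1) c by (simp add: c2_def distrib_right flip: ennreal_plus)
    qed
    then show ?case using c1(1) c by (intro exI[of _ "c1 + c2"]) (simp add: c2_def)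
  qed
  obtain n where n: "\<tau> \<le> real n * \<alpha>" using reals_Archimedean3[OF \<alpha>] less_imp_le by blast
  obtain c' where c': "0 \<le> c'" "\<And>x. x \<in> P \<Longrightarrow>
      (\<integral>\<^sup>+t\<in>{0..real n * \<alpha>}. ennreal (norm (Gam (T t x)) powr p) \<partial>lborel) \<le> ennreal (c' * norm x powr p)"
    using step[of n] by blast
  show thesis
  proof (rule that[of "c' + 1"])
    fix x assume x: "x \<in> P"
    have "(\<integral>\<^sup>+t\<in>{0..\<tau>}. ennreal (norm (Gam (T t x)) powr p) \<partial>lborel) \<le>
        (\<integral>\<^sup>+t\<in>{0..real n * \<alpha>}. ennreal (norm (Gam (T t x)) powr p) \<partial>lborel)"
      using n by (intro nn_integral_mono mult_left_mono) (auto simp: indicator_def)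
    also have "\<dots> \<le> ennreal (c' * norm x powr p)" by (rule c'(2)[OF x])
    also have "\<dots> \<le> ennreal ((c' + 1) * norm x powr p)" by (intro ennreal_leI mult_right_mono) auto
    finally show "(\<integral>\<^sup>+t\<in>{0..\<tau>}. ennreal (norm (Gam (T t x)) powr p) \<partial>lborel) \<le> ennreal ((c' + 1) * norm x powr p)" .
  qed (use c' in simp)
qed

text \<open>The two summands converge for different reasons. On \<open>W\<close> in \<open>D\<close>
  the resolvent commutes with \<open>At\<close>, so the regularisations converge in the graph norm
  and \<open>Gam\<close> follows strongly; on D_m v the only available information is the weak decay
  of Gam D_n v.\<close>

lemma Gam_resolvent_weak_limit:
  fixes u :: "'v \<Rightarrow> real"
  assumes R: "\<And>n::nat. N0 \<le> n \<Longrightarrow> is_resolvent (real n) (R n)"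
    and bound: "\<And>n x. N0 \<le> n \<Longrightarrow> norm (real n *\<^sub>R R n x) \<le> C * norm x"
    and Rm: "is_resolvent m Rm" and W: "W \<in> D" and u: "bounded_linear u"
    and weak: "((\<lambda>l. u (Gam (Dir l v))) \<longlongrightarrow> 0) at_top"
  shows "(\<lambda>n. u (Gam (real n *\<^sub>R R n (Dir m v + W)))) \<longlonglongrightarrow> u (Gam (Dir m v + W))"
proof -
  have RD: "R n x \<in> DAt" if "N0 \<le> n" for n x using is_resolventD(2)[OF R[OF that]] by simp
  \<comment> \<open>Indices beyond \<open>N1\<close> exceed \<open>\<bar>m\<bar>\<close>, so that
    division by \<open>real n - m\<close> is legitimate.\<close>
  obtain N1 :: nat where N1: "\<bar>m\<bar> < real N1" using reals_Archimedean2 by blast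
  let ?N = "max N0 N1"
  have ev: "\<forall>\<^sub>F n in sequentially. ?N \<le> n" by (rule eventually_ge_at_top)
  have DirA: "Dir m v \<in> DAt" by (rule Dir[OF Rm])
  have RW: "(\<lambda>n. Gam (real (n + N0) *\<^sub>R R (n + N0) W)) \<longlonglongrightarrow> Gam W"
  proof (rule graph_bounded_tendsto[OF Gam_bounded])
    show "\<forall>\<^sub>F n in sequentially. real (n + N0) *\<^sub>R R (n + N0) W \<in> DAt"
      by (intro always_eventually allI DAt_scaleR RD) simp
    show "W \<in> DAt" using W by simp
    show "(\<lambda>n. real (n + N0) *\<^sub>R R (n + N0) W) \<longlonglongrightarrow> W"
      by (rule LIMSEQ_ignore_initial_segment[OF resolvent_tendsto_id[OF R bound]])
    have "At (real (n + N0) *\<^sub>R R (n + N0) W) = real (n + N0) *\<^sub>R R (n + N0) (At W)" for n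
    proof -
      have "At (R (n + N0) W) = R (n + N0) (At W)"
        using generator_bounded_linear[OF W is_resolventD(1)[OF R] resolvent_T[OF R]] by simp
      then show ?thesis by (simp add: At_scaleR RD)
    qed
    moreover have "(\<lambda>n. real (n + N0) *\<^sub>R R (n + N0) (At W)) \<longlonglongrightarrow> At W"
      by (rule LIMSEQ_ignore_initial_segment[OF resolvent_tendsto_id[OF R bound]])
    ultimately show "(\<lambda>n. At (real (n + N0) *\<^sub>R R (n + N0) W)) \<longlonglongrightarrow> At W" by simp
  qed
  then have 1: "(\<lambda>n. u (Gam (real n *\<^sub>R R n W))) \<longlonglongrightarrow> u (Gam W)"
    by (rule bounded_linear.tendsto[OF u LIMSEQ_offset])
  have "(\<lambda>n. u (Gam (Dir (real n) v))) \<longlonglongrightarrow> 0"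
    by (rule filterlim_compose[OF weak filterlim_real_sequentially])
  moreover have "(\<lambda>n. real n / (real n - m)) \<longlonglongrightarrow> 1"
    by real_asymp
  ultimately have "(\<lambda>n. real n / (real n - m) * (u (Gam (Dir m v)) - u (Gam (Dir (real n) v)))) \<longlonglongrightarrow>
      1 * (u (Gam (Dir m v)) - 0)"
    by (intro tendsto_mult tendsto_diff tendsto_const)
  then have "(\<lambda>n. real n / (real n - m) * (u (Gam (Dir m v)) - u (Gam (Dir (real n) v)))) \<longlonglongrightarrow> u (Gam (Dir m v))"
    by simp
  moreover have "\<forall>\<^sub>F n in sequentially. real n / (real n - m) * (u (Gam (Dir m v)) - u (Gam (Dir (real n) v)))
      = u (Gam (real n *\<^sub>R R n (Dir m v)))"
    using ev
  proof eventually_elim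
    case (elim n)
    then have n: "N0 \<le> n" "real n - m \<noteq> 0" using N1 by auto
    have "R n (Dir m v) = (1 / (real n - m)) *\<^sub>R (Dir m v - Dir (real n) v)"
      using Dir_diff[OF R[OF n(1)] Rm, of v] n(2) by simp
    then show ?case
      using Dir(1)[OF R[OF n(1)], of v] DirA
      by (simp add: Gam_scaleR Gam_diff DAt_diff DAt_scaleR linear_simps[OF u])
  qed
  ultimately have 2: "(\<lambda>n. u (Gam (real n *\<^sub>R R n (Dir m v)))) \<longlonglongrightarrow> u (Gam (Dir m v))"
    by (rule Lim_transform_eventually)
  have "(\<lambda>n. u (Gam (real n *\<^sub>R R n (Dir m v))) + u (Gam (real n *\<^sub>R R n W))) \<longlonglongrightarrow> u (Gam (Dir m v)) + u (Gam W)"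
    by (intro tendsto_add 1 2)
  moreover have "u (Gam (Dir m v)) + u (Gam W) = u (Gam (Dir m v + W))"
    using DirA W by (simp add: Gam_add linear_simps[OF u])
  moreover have "\<forall>\<^sub>F n in sequentially. u (Gam (real n *\<^sub>R R n (Dir m v))) + u (Gam (real n *\<^sub>R R n W))
      = u (Gam (real n *\<^sub>R R n (Dir m v + W)))"
    using ev
  proof eventually_elim
    case (elim n)
    then show ?case
      using RD[of n] R[of n] by (simp add: linear_simps[OF is_resolventD(1)[OF R]] scaleR_add_right Gam_add DAt_scaleR linear_simps[OF u])
  qed
  ultimately show ?thesis using Lim_transform_eventually by fastforce
qed

end

text \<open>Truncated Laplace integrals of an orbit in the cone stay in the cone; the given
  \<open>R\<close> agrees with the Laplace transform since a resolvent is unique.\<close>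

lemma (in bounded_C0_semigroup) resolvent_in_cone:
  assumes l: "w < l" and R: "is_resolvent l R"
    and C: "closed C" "0 \<in> C" "\<And>x y. x \<in> C \<Longrightarrow> y \<in> C \<Longrightarrow> x + y \<in> C" "\<And>c x. 0 \<le> c \<Longrightarrow> x \<in> C \<Longrightarrow> c *\<^sub>R x \<in> C"
    and T: "\<And>t x. 0 \<le> t \<Longrightarrow> x \<in> C \<Longrightarrow> T t x \<in> C" and x: "x \<in> C"
  shows "R x \<in> C"
proof -
  obtain S where S: "is_resolvent l S"
    and lim: "(\<lambda>n. integral {0..real n} (\<lambda>s. exp (- l * s) *\<^sub>R T s x)) \<longlonglongrightarrow> S x"
    by (rule resolvent_exists[OF l]) (rule that)
  have "integral {0..real n} (\<lambda>s. exp (- l * s) *\<^sub>R T s x) \<in> C" for n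
  proof (rule has_integral_in_convex_cone[OF C])
    show "((\<lambda>s. exp (- l * s) *\<^sub>R T s x) has_integral integral {0..real n} (\<lambda>s. exp (- l * s) *\<^sub>R T s x)) {0..real n}"
      by (intro integrable_integral integrable_continuous_real continuous_intros) auto
  qed (use C T x in auto)
  then have "S x \<in> C" using lim C(1) by (rule closed_sequentially[rotated])
  moreover have "R x = S x"
    using is_resolventD(4)[OF R is_resolventD(2)[OF S], of x] by (simp add: is_resolventD(3)[OF S])
  ultimately show ?thesis by simp
qed

text \<open>The simple functions evaluate \<open>f\<close> at the grid point of mesh 1 / (n + 1) to
  the left of \<open>t\<close>. Rounding down keeps that point in [0, \<tau>].\<close>

lemma strongly_measurable_on_continuous:
  fixes f :: "real \<Rightarrow> 'a::real_normed_vector"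
  assumes f: "continuous_on {0..\<tau>} f"
  shows "strongly_measurable_on {0..\<tau>} f"
  unfolding strongly_measurable_on_def
proof (intro exI conjI allI)
  let ?r = "\<lambda>n t. real_of_int \<lfloor>real (Suc n) * t\<rfloor> / real (Suc n)"
  let ?M = "restrict_space lborel {0..\<tau>}"
  fix n
  have "simple_function ?M (\<lambda>t. \<lfloor>real (Suc n) * t\<rfloor>)"
    unfolding simple_function_def
  proof (intro conjI ballI)
    have "(\<lambda>t. \<lfloor>real (Suc n) * t\<rfloor>) ` space ?M \<subseteq> {0..\<lfloor>real (Suc n) * \<tau>\<rfloor>}"
      by (auto simp: space_restrict_space intro!: floor_mono mult_left_mono)
    then show "finite ((\<lambda>t. \<lfloor>real (Suc n) * t\<rfloor>) ` space ?M)" by (rule finite_subset) simp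
    fix i
    have eq: "(\<lambda>t. \<lfloor>real (Suc n) * t\<rfloor>) -` {i} \<inter> space ?M
        = {0..\<tau>} \<inter> {t. real_of_int i \<le> real (Suc n) * t \<and> real (Suc n) * t < real_of_int i + 1}"
      by (auto simp: space_restrict_space floor_eq_iff)
    have "{t. real_of_int i \<le> real (Suc n) * t \<and> real (Suc n) * t < real_of_int i + 1} \<in> sets borel"
      by measurable
    then show "(\<lambda>t. \<lfloor>real (Suc n) * t\<rfloor>) -` {i} \<inter> space ?M \<in> sets ?M"
      unfolding eq sets_restrict_space sets_lborel by (rule imageI)
  qed
  then show "simple_function ?M (\<lambda>t. f (?r n t))" by (rule simple_function_compose1)
next
  let ?r = "\<lambda>n t. real_of_int \<lfloor>real (Suc n) * t\<rfloor> / real (Suc n)"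
  show "AE t in lborel. t \<in> {0..\<tau>} \<longrightarrow> (\<lambda>n. f (?r n t)) \<longlonglongrightarrow> f t"
  proof (intro AE_I2 impI)
    fix t assume t: "t \<in> {0..\<tau>}"
    have le: "?r n t \<le> t" and ge: "t - inverse (real (Suc n)) \<le> ?r n t" for n
    proof -
      show "?r n t \<le> t" using of_int_floor_le[of "real (Suc n) * t"] by (simp add: pos_divide_le_eq mult.commute)
      have "real (Suc n) * t - 1 \<le> real_of_int \<lfloor>real (Suc n) * t\<rfloor>" by linarith
      then have "(real (Suc n) * t - 1) / real (Suc n) \<le> ?r n t" by (rule divide_right_mono) simp
      then show "t - inverse (real (Suc n)) \<le> ?r n t" by (simp add: diff_divide_distrib inverse_eq_divide)
    qed
    have "(\<lambda>n. t - inverse (real (Suc n))) \<longlonglongrightarrow> t"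
      using tendsto_diff[OF tendsto_const LIMSEQ_inverse_real_of_nat, of t] by simp
    then have "(\<lambda>n. ?r n t) \<longlonglongrightarrow> t"
      by (rule tendsto_sandwich[rotated 2, OF _ tendsto_const]) (use le ge in \<open>auto intro: always_eventually\<close>)
    moreover have "?r n t \<in> {0..\<tau>}" for n using le[of n] t by (auto intro: order_trans)
    ultimately show "(\<lambda>n. f (?r n t)) \<longlonglongrightarrow> f t"
      by (intro continuous_on_tendsto_compose[OF f _ t]) auto
  qed
qed

context boundary_system
begin

text \<open>One function \<open>f n\<close> is read in two ways through \<open>conv_x\<close>: as
  \<open>Gam\<close> of a convolution with \<open>x n\<close> it obeys the L^p bound, and as a
  combination of regularisations of z it has the right weak limit.\<close>

lemma Gam_extrapolated_conv_Lp_bound: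
  assumes R: "\<And>n::nat. N0 \<le> n \<Longrightarrow> is_resolvent (real n) (R n)" and N0: "0 < N0"
    and R_bound: "\<And>n x. N0 \<le> n \<Longrightarrow> norm (real n *\<^sub>R R n x) \<le> C1 * norm x"
    and Rm: "is_resolvent m Rm" and p: "1 \<le> p" and \<tau>: "0 < \<tau>" and v: "continuous_on {0..\<tau>} v"
    and C: "0 \<le> C" "\<And>n v. N0 \<le> n \<Longrightarrow> norm (real n *\<^sub>R Dir (real n) v) \<le> C * norm v"
    and adm: "\<And>n s. N0 \<le> n \<Longrightarrow> s \<in> {0..\<tau>} \<Longrightarrow>
      (\<integral>\<^sup>+t\<in>{0..\<tau>}. ennreal (norm (Gam (T t ((2 * real n) *\<^sub>R (Dir (real n) (v s) - Dir (real (2 * n)) (v s))))) powr p) \<partial>lborel)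
        \<le> ennreal (c * norm ((2 * real n) *\<^sub>R (Dir (real n) (v s) - Dir (real (2 * n)) (v s))) powr p)"
    and c: "0 \<le> c"
    and y: "\<And>t. t \<in> {0..\<tau>} \<Longrightarrow> conv (\<lambda>s. Dir m (v s)) t \<in> D"
    and W: "\<And>t. t \<in> {0..\<tau>} \<Longrightarrow> W t \<in> D"
    and z: "\<And>t. t \<in> {0..\<tau>} \<Longrightarrow>
      m *\<^sub>R conv (\<lambda>s. Dir m (v s)) t - At (conv (\<lambda>s. Dir m (v s)) t) = Dir m (v t) + W t"
    and weak: "\<And>v u. bounded_linear (u :: 'v \<Rightarrow> real) \<Longrightarrow> ((\<lambda>l. u (Gam (Dir l v))) \<longlongrightarrow> 0) at_top"
  shows "(\<integral>\<^sup>+t\<in>{0..\<tau>}. ennreal (norm (Gam (Dir m (v t) + W t)) powr p) \<partial>lborel)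
    \<le> ennreal (\<tau> powr (p - 1) * (c * (3 * C) powr p)) * (\<integral>\<^sup>+t\<in>{0..\<tau>}. ennreal (norm (v t) powr p) \<partial>lborel)"
proof -
  define x where "x n s = (2 * real n) *\<^sub>R (Dir (real n) (v s) - Dir (real (2 * n)) (v s))" for n s
  \<comment> \<open>A preimage of \<open>x n\<close> under R(2 n), in the form required by
    \<open>Gam_conv_Lp_bound\<close>. Its norm may grow with \<open>n\<close>; only that of
    \<open>x n\<close> enters the estimate.\<close>
  define g where "g n s = (2 * real n * real n) *\<^sub>R Dir (real n) (v s)" for n s
  let ?z = "\<lambda>t. Dir m (v t) + W t"
  have R2: "is_resolvent (real (2 * n)) (R (2 * n))" if "N0 \<le> n" for n using R[of "2 * n"] that by simp
  have vc: "continuous_on {0..t} v" if "t \<in> {0..\<tau>}" for t by (rule continuous_on_subset[OF v]) (use that in auto)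
  have gc: "continuous_on {0..t} (g n)" if "N0 \<le> n" "t \<in> {0..\<tau>}" for n t
    unfolding g_def by (intro continuous_intros Dir_continuous_on[OF R[OF that(1)]] vc that)
  have Rg: "R (2 * n) (g n s) = x n s" if "N0 \<le> n" for n s
    using Dir_diff[OF R2[OF that] R[OF that], of "v s"]
    by (simp add: x_def g_def linear_simps[OF is_resolventD(1)[OF R2[OF that]]] mult.assoc)
  \<comment> \<open>The operators n D_n and 2 n D_2n are both bounded by \<open>C\<close> and enter
    with weights 2 and -1, whence the factor 3.\<close>
  have x_norm: "norm (x n s) \<le> 3 * C * norm (v s)" if "N0 \<le> n" for n s
  proof -
    have "x n s = 2 *\<^sub>R (real n *\<^sub>R Dir (real n) (v s)) - real (2 * n) *\<^sub>R Dir (real (2 * n)) (v s)"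
      by (simp add: x_def scaleR_diff_right)
    then have "norm (x n s) \<le> norm (2 *\<^sub>R (real n *\<^sub>R Dir (real n) (v s))) + norm (real (2 * n) *\<^sub>R Dir (real (2 * n)) (v s))"
      by (simp only: norm_triangle_ineq4)
    also have "norm (2 *\<^sub>R (real n *\<^sub>R Dir (real n) (v s))) = 2 * norm (real n *\<^sub>R Dir (real n) (v s))" by simp
    finally have "norm (x n s) \<le> 2 * norm (real n *\<^sub>R Dir (real n) (v s)) + norm (real (2 * n) *\<^sub>R Dir (real (2 * n)) (v s))" .
    also have "\<dots> \<le> 2 * (C * norm (v s)) + C * norm (v s)"
      using that by (intro add_mono mult_left_mono C(2)) auto
    finally show ?thesis by simp
  qed
  have conv_x: "R (2 * n) (conv (g n) t) = 2 *\<^sub>R (real n *\<^sub>R R n (?z t)) - real (2 * n) *\<^sub>R R (2 * n) (?z t)"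
    if n: "N0 \<le> n" and t: "t \<in> {0..\<tau>}" for n t
  proof -
    have c1: "continuous_on {0..t} (\<lambda>s. Dir (real n) (v s))" "continuous_on {0..t} (\<lambda>s. Dir (real (2 * n)) (v s))"
      using Dir_continuous_on[OF R[OF n] vc[OF t]] Dir_continuous_on[OF R2[OF n] vc[OF t]] by auto
    have "R (2 * n) (conv (g n) t) = conv (\<lambda>s. R (2 * n) (g n s)) t"
      by (rule conv_bounded_linear[OF is_resolventD(1)[OF R2[OF n]] resolvent_T[OF R2[OF n]] gc[OF n t], symmetric])
    also have "\<dots> = (2 * real n) *\<^sub>R (conv (\<lambda>s. Dir (real n) (v s)) t - conv (\<lambda>s. Dir (real (2 * n)) (v s)) t)"
      by (simp only: Rg[OF n] x_def conv_scaleR conv_diff[OF c1])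
    also have "conv (\<lambda>s. Dir (real n) (v s)) t = R n (?z t)"
      using conv_Dir_eq_resolvent[OF Rm R[OF n] vc[OF t] y[OF t]] by (simp only: z[OF t])
    also have "conv (\<lambda>s. Dir (real (2 * n)) (v s)) t = R (2 * n) (?z t)"
      using conv_Dir_eq_resolvent[OF Rm R2[OF n] vc[OF t] y[OF t]] by (simp only: z[OF t])
    finally show ?thesis by (simp add: scaleR_diff_right)
  qed
  \<comment> \<open>The shift by \<open>N0\<close> makes every index admissible, so that bound and
    measurability hold for all \<open>n\<close> as Fatou's lemma requires.\<close>
  define f where "f n t = Gam (R (2 * (n + N0)) (conv (g (n + N0)) t))" for n t
  have lim: "(\<lambda>n. u (f n t)) \<longlonglongrightarrow> u (Gam (?z t))" if t: "t \<in> {0..\<tau>}" and u: "bounded_linear u" for t and u :: "'v \<Rightarrow> real"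
  proof -
    let ?a = "\<lambda>n. u (Gam (real n *\<^sub>R R n (?z t)))"
    have a: "?a \<longlonglongrightarrow> u (Gam (?z t))"
      by (rule Gam_resolvent_weak_limit[OF R R_bound Rm W[OF t] u weak[OF u]])
    have "strict_mono (\<lambda>n. n + N0)" "strict_mono (\<lambda>n. 2 * (n + N0))" by (auto intro: strict_monoI)
    \<comment> \<open>Both regularisations have the same weak limit; the weights 2 and -1 leave
      exactly one copy of it.\<close>
    then have "(\<lambda>n. 2 * ?a (n + N0) - ?a (2 * (n + N0))) \<longlonglongrightarrow> 2 * u (Gam (?z t)) - u (Gam (?z t))"
      using LIMSEQ_subseq_LIMSEQ[OF a] by (intro tendsto_intros) (force simp: o_def)+
    moreover have "u (f n t) = 2 * ?a (n + N0) - ?a (2 * (n + N0))" for n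
    proof -
      have n: "N0 \<le> n + N0" by simp
      have "R (n + N0) (?z t) \<in> DAt" "R (2 * (n + N0)) (?z t) \<in> DAt"
        using is_resolventD(2)[OF R[OF n]] is_resolventD(2)[OF R2[OF n]] by auto
      then show ?thesis
        unfolding f_def conv_x[OF n t]
        by (simp only: Gam_diff Gam_scaleR DAt_scaleR linear_simps[OF u] real_scaleR_def)
    qed
    ultimately show ?thesis by simp
  qed
  have cont_f: "continuous_on {0..\<tau>} (f n)" for n
    unfolding f_def[abs_def]
    by (intro bounded_linear.continuous_on[OF bounded_linear_Gam_resolvent[OF R2]] conv_continuous gc) (use \<tau> in auto)
  let ?V = "\<integral>\<^sup>+t\<in>{0..\<tau>}. ennreal (norm (v t) powr p) \<partial>lborel"
  have cont_v: "continuous_on {0..\<tau>} (\<lambda>t. norm (v t) powr p)"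
    using p by (intro continuous_on_powr' continuous_intros v) auto
  have bound: "(\<integral>\<^sup>+t\<in>{0..\<tau>}. ennreal (norm (f n t) powr p) \<partial>lborel)
      \<le> ennreal (\<tau> powr (p - 1) * (c * (3 * C) powr p)) * ?V" for n
  proof -
    let ?n = "n + N0"
    have n: "N0 \<le> ?n" by simp
    let ?b = "\<lambda>s. c * (3 * C) powr p * norm (v s) powr p"
    have "(\<integral>\<^sup>+t\<in>{0..\<tau>}. ennreal (norm (f n t) powr p) \<partial>lborel)
        \<le> ennreal (\<tau> powr (p - 1)) * (\<integral>\<^sup>+s\<in>{0..\<tau>}. ennreal (?b s) \<partial>lborel)"
      unfolding f_def
    proof (rule Gam_conv_Lp_bound[OF R2[OF n] p \<tau>])
      show "continuous_on {0..\<tau>} (g ?n)" using gc[OF n, of \<tau>] \<tau> by simp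
      fix s assume s: "s \<in> {0..\<tau>}"
      have "(\<integral>\<^sup>+t\<in>{0..\<tau>}. ennreal (norm (Gam (T t (x ?n s))) powr p) \<partial>lborel) \<le> ennreal (c * norm (x ?n s) powr p)"
        unfolding x_def by (rule adm[OF n s])
      also have "\<dots> \<le> ennreal (?b s)"
      proof (rule ennreal_leI)
        have "norm (x ?n s) powr p \<le> (3 * C * norm (v s)) powr p" using x_norm[OF n] p by (intro powr_mono2) auto
        also have "\<dots> = (3 * C) powr p * norm (v s) powr p" using C(1) by (simp add: powr_mult)
        finally show "c * norm (x ?n s) powr p \<le> ?b s" using c by (simp add: mult_left_mono mult.assoc)
      qed
      finally show "(\<integral>\<^sup>+t\<in>{0..\<tau>}. ennreal (norm (Gam (T t (R (2 * ?n) (g ?n s)))) powr p) \<partial>lborel) \<le> ennreal (?b s)"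
        by (simp only: Rg[OF n])
    qed
    also have "(\<integral>\<^sup>+s\<in>{0..\<tau>}. ennreal (?b s) \<partial>lborel)
        = (\<integral>\<^sup>+s. ennreal (c * (3 * C) powr p) * (ennreal (norm (v s) powr p) * indicator {0..\<tau>} s) \<partial>lborel)"
      using c by (intro nn_integral_cong) (simp add: ennreal_mult' mult.assoc)
    also have "\<dots> = ennreal (c * (3 * C) powr p) * ?V"
      by (rule nn_integral_cmult[OF borel_measurable_nn_indicator_continuous[OF cont_v]])
    also have "ennreal (\<tau> powr (p - 1)) * (ennreal (c * (3 * C) powr p) * ?V)
        = ennreal (\<tau> powr (p - 1) * (c * (3 * C) powr p)) * ?V"
      by (simp add: ennreal_mult' mult.assoc)
    finally show ?thesis .
  qed
  show ?thesis
  proof (rule nn_integral_powr_weak_limit[where f = f, OF _ _ lim bound])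
    show "0 < p" using p by simp
    show "(\<lambda>t. ennreal (norm (f n t) powr p) * indicator {0..\<tau>} t) \<in> borel_measurable lborel" for n
      using p by (intro borel_measurable_nn_indicator_continuous continuous_on_powr' continuous_intros cont_f) auto
  qed
qed

end

section \<open>Growth constants and the final estimate\<close>

lemma above_growth_boundE:
  assumes T: "C0_semigroup T" and "above_growth_bound T l"
  obtains w M where "w < l" "0 < M" "\<And>t x. 0 \<le> t \<Longrightarrow> norm (T t x) \<le> M * exp (w * t) * norm x"
proof -
  obtain w M where w: "w < l" and M: "\<And>t. 0 \<le> t \<Longrightarrow> onorm (T t) \<le> M * exp (w * t)"
    using assms(2) unfolding above_growth_bound_def by blast
  \<comment> \<open>The maximum with 1 secures a positive constant, which the hypothesis does not
    promise.\<close>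
  have "norm (T t x) \<le> max M 1 * exp (w * t) * norm x" if t: "0 \<le> t" for t x
  proof -
    have "bounded_linear (T t)" using T t unfolding C0_semigroup_def by blast
    then have "norm (T t x) \<le> onorm (T t) * norm x" by (rule onorm)
    also have "onorm (T t) \<le> max M 1 * exp (w * t)"
      using M[OF t] by (rule order_trans) (intro mult_right_mono, auto)
    finally show ?thesis by (simp add: mult_right_mono)
  qed
  then show thesis using that[of w "max M 1"] w by simp
qed

text \<open>The constant is obtained from large integer spectral parameters alone. The point
  \<open>lam\<close> enters only through the representation z = D_lam v + W of the convolution, so
  \<open>\<eta>\<close> can be fixed before \<open>lam\<close> and \<open>v\<close>.\<close>

theorem theorem2p2:
  fixes At :: "'x::{banach,ordered_real_vector,lattice} \<Rightarrow> 'x"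
    and DAt :: "'x set"
    and G Gam :: "'x \<Rightarrow> 'v::{banach,ordered_real_vector,lattice}"
    and T :: "real \<Rightarrow> 'x \<Rightarrow> 'x"
    and p :: real
  assumes BL_X: "banach_lattice TYPE('x)"
    and BL_V: "banach_lattice TYPE('v)"
    and At_closed: "closed_operator DAt At"
    and At_dense: "densely_defined DAt"
    and G_bdd: "graph_bounded DAt At G"
    and Gam_bdd: "graph_bounded DAt At Gam"
    \<comment> \<open>Assumption 1\<close>
    and A1_gen: "generates {x \<in> DAt. G x = 0} At T"
    and A1_pos: "positive_semigroup T"
    and A1_surj: "G ` DAt = UNIV"
    \<comment> \<open>Assumption 2 for p\<close>
    and p_ge: "1 \<le> p"
    and A2_i: "\<exists>l1. \<forall>lam\<ge>l1. \<forall>v. 0 \<le> v \<longrightarrow> 0 \<le> dirichlet_op DAt At G lam v"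
    and A2_ii_pos: "\<forall>x\<in>DAt. 0 \<le> x \<longrightarrow> 0 \<le> Gam x"
    and A2_ii_adm: "\<exists>\<alpha>>0. \<exists>\<gamma>>0. \<forall>x\<in>{x \<in> DAt. G x = 0}. 0 \<le> x \<longrightarrow>
          (\<integral>\<^sup>+ t\<in>{0..\<alpha>}. ennreal (norm (Gam (T t x)) powr p) \<partial>lborel)
            \<le> ennreal (\<gamma> powr p * norm x powr p)"
    and A2_iii: "\<exists>l0. above_growth_bound T l0 \<and>
          (\<forall>v. \<exists>C. \<forall>lam\<ge>l0. norm (lam *\<^sub>R dirichlet_op DAt At G lam v) \<le> C)"
    and A2_iv: "\<forall>v u. bounded_linear (u :: 'v \<Rightarrow> real) \<longrightarrow>
          ((\<lambda>lam. u (Gam (dirichlet_op DAt At G lam v))) \<longlongrightarrow> 0) at_top"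
  shows "\<exists>\<eta>::real \<Rightarrow> real.
     (\<forall>\<tau>>0. \<eta> \<tau> > 0 \<and>
        (\<forall>v. W1p0_pos p \<tau> v \<longrightarrow>
          (\<forall>lam\<in>resolvent_set {x \<in> DAt. G x = 0} At.
             (\<forall>t\<in>{0..\<tau>}.
                conv_pre T (dirichlet_op DAt At G lam) v t \<in> {x \<in> DAt. G x = 0} \<and>
                extrap_conv T At lam (dirichlet_op DAt At G lam) v t \<in> DAt) \<and>
             strongly_measurable_on {0..\<tau>}
               (\<lambda>t. Gam (extrap_conv T At lam (dirichlet_op DAt At G lam) v t)) \<and>
             (\<integral>\<^sup>+ t\<in>{0..\<tau>}.
                 ennreal (norm (Gam (extrap_conv T At lam (dirichlet_op DAt At G lam) v t)) powr p)
               \<partial>lborel)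
               \<le> ennreal (\<eta> \<tau> powr p) * (\<integral>\<^sup>+ t\<in>{0..\<tau>}. ennreal (norm (v t) powr p) \<partial>lborel)))) \<and>
     (1 < p \<longrightarrow> (\<eta> \<longlongrightarrow> 0) (at_right 0))"
proof -
  from A2_iii obtain l0 where l0: "above_growth_bound T l0"
    and ptw: "\<And>v. \<exists>C. \<forall>lam\<ge>l0. norm (lam *\<^sub>R dirichlet_op DAt At G lam v) \<le> C" by blast
  have C0: "C0_semigroup T" and gen: "generator T {x \<in> DAt. G x = 0} At"
    using A1_gen unfolding generates_def by blast+
  obtain w M where w: "w < l0" and M: "0 < M" "\<And>t x. 0 \<le> t \<Longrightarrow> norm (T t x) \<le> M * exp (w * t) * norm x"
    by (rule above_growth_boundE[OF C0 l0]) (rule that)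
  interpret boundary_system T DAt G At M w Gam
    by unfold_locales (fact C0 gen M At_closed G_bdd Gam_bdd A1_surj)+
  obtain l1 where l1: "\<And>l v. l1 \<le> l \<Longrightarrow> 0 \<le> v \<Longrightarrow> 0 \<le> Dir l v" using A2_i by blast
  \<comment> \<open>Beyond \<open>L\<close> the uniform bound, the positivity of the Dirichlet
    operators and the existence of resolvents all hold; the 1 makes the factor \<open>l\<close>
    nonzero and 1 / L meaningful.\<close>
  define L where "L = max (max l0 l1) 1"
  have L: "l0 \<le> L" "l1 \<le> L" "0 < L" "w < L" using w by (auto simp: L_def)
  obtain C where C: "C > 0" "\<And>l v. l \<in> {L..} \<Longrightarrow> norm (l *\<^sub>R Dir l v) \<le> C * norm v"
  proof (rule Dir_uniform_bound[of "{L..}" "\<lambda>l. l"])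
    show "\<exists>R. is_resolvent l R" if "l \<in> {L..}" for l
      using resolvent_exists[of l] that L by (metis atLeast_iff order_less_le_trans)
    show "\<exists>C. \<forall>l\<in>{L..}. norm (l *\<^sub>R Dir l v) \<le> C" for v
      using ptw[of v] L(1) by (meson atLeast_iff order_trans)
  qed (use L(3) that in auto)
  have "\<forall>n::nat. \<exists>R. w < real n \<longrightarrow> is_resolvent (real n) R \<and> (\<forall>x. norm (R x) \<le> M / (real n - w) * norm x)"
    using resolvent_exists by metis
  then obtain R where R: "\<And>n. w < real n \<Longrightarrow> is_resolvent (real n) (R n)"
    and R_norm: "\<And>n x. w < real n \<Longrightarrow> norm (R n x) \<le> M / (real n - w) * norm x" by metis
  \<comment> \<open>The requirement 2 |w| + 1 \<le> n gives n / (n - w) \<le> 2, hence the uniform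
    bound \<open>2 * M\<close> for n R(n).\<close>
  obtain N0 :: nat where N0: "max L (2 * \<bar>w\<bar> + 1) \<le> real N0" using real_arch_simple by blast
  have N0_le: "L \<le> real n" "w < real n" "2 * \<bar>w\<bar> + 1 \<le> real n" if "N0 \<le> n" for n
    using N0 that L(4) by auto
  have R_bound: "norm (real n *\<^sub>R R n x) \<le> 2 * M * norm x" if n: "N0 \<le> n" for n x
  proof -
    have "real n * (M / (real n - w)) \<le> 2 * M" using N0_le[OF n] M(1) by (simp add: field_simps)
    then have "real n * (M / (real n - w)) * norm x \<le> 2 * M * norm x" by (rule mult_right_mono) simp
    moreover have "real n * norm (R n x) \<le> real n * (M / (real n - w) * norm x)"
      using R_norm[OF N0_le(2)[OF n]] by (intro mult_left_mono) auto
    ultimately show ?thesis by (simp add: mult.assoc)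
  qed
  let ?cone = "{x::'x. 0 \<le> x}"
  have cone: "closed ?cone" by (rule closed_positive_cone[OF BL_X])
  have T_pos: "0 \<le> T t x" if "0 \<le> t" "0 \<le> x" for t x using A1_pos that unfolding positive_semigroup_def by blast
  define P where "P = {x \<in> D. 0 \<le> x}"
  have P: "x \<in> D" "0 \<le> t \<Longrightarrow> T t x \<in> P" if "x \<in> P" for x t
    using that generator_T[of x t] T_pos[of t x] by (auto simp: P_def)
  obtain \<alpha> \<gamma> where \<alpha>: "0 < \<alpha>" and \<gamma>: "0 < \<gamma>" and adm: "\<And>x. x \<in> P \<Longrightarrow>
      (\<integral>\<^sup>+t\<in>{0..\<alpha>}. ennreal (norm (Gam (T t x)) powr p) \<partial>lborel) \<le> ennreal (\<gamma> powr p * norm x powr p)"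
    using A2_ii_adm unfolding P_def by blast
  have p0: "0 < p" using p_ge by simp
  define adm_const where "adm_const c \<tau> \<longleftrightarrow> 0 < c \<and> (\<forall>x\<in>P.
      (\<integral>\<^sup>+t\<in>{0..\<tau>}. ennreal (norm (Gam (T t x)) powr p) \<partial>lborel) \<le> ennreal (c * norm x powr p))" for c \<tau>
  have adm_small: "adm_const (\<gamma> powr p) \<tau>" if "\<tau> \<le> \<alpha>" for \<tau>
    unfolding adm_const_def
  proof (intro conjI ballI)
    fix x assume "x \<in> P"
    have "(\<integral>\<^sup>+t\<in>{0..\<tau>}. ennreal (norm (Gam (T t x)) powr p) \<partial>lborel) \<le> (\<integral>\<^sup>+t\<in>{0..\<alpha>}. ennreal (norm (Gam (T t x)) powr p) \<partial>lborel)"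
      using that by (intro nn_integral_mono mult_left_mono) (auto simp: indicator_def)
    then show "(\<integral>\<^sup>+t\<in>{0..\<tau>}. ennreal (norm (Gam (T t x)) powr p) \<partial>lborel) \<le> ennreal (\<gamma> powr p * norm x powr p)"
      using adm[OF \<open>x \<in> P\<close>] by (rule order_trans)
  qed (use \<gamma> in simp)
  have adm_large: "\<exists>c. adm_const c \<tau>" for \<tau>
    by (rule Gam_admissible_extend[OF R[OF N0_le(2)[OF order_refl]] p0 \<alpha> _ P adm, of \<tau>])
      (auto simp: adm_const_def)
  \<comment> \<open>For \<open>\<tau> \<le> \<alpha>\<close> the constant of the hypothesis itself
    is kept. An arbitrary choice there could spoil the limit as \<open>\<tau>\<close> tends to
    0.\<close>
  define c where "c \<tau> = (if \<tau> \<le> \<alpha> then \<gamma> powr p else (SOME c. adm_const c \<tau>))" for \<tau>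
  have c: "adm_const (c \<tau>) \<tau>" for \<tau>
    using adm_small adm_large someI_ex[of "\<lambda>c. adm_const c \<tau>"] by (simp add: c_def)
  then have c_pos: "0 < c \<tau>" for \<tau> unfolding adm_const_def by blast
  define \<eta> where "\<eta> \<tau> = (\<tau> powr (p - 1) * (c \<tau> * (3 * C) powr p)) powr (1 / p)" for \<tau>
  have \<eta>_pos: "0 < \<eta> \<tau>" if "0 < \<tau>" for \<tau> using that c_pos[of \<tau>] C(1) by (simp add: \<eta>_def)
  have \<eta>_powr: "\<eta> \<tau> powr p = \<tau> powr (p - 1) * (c \<tau> * (3 * C) powr p)" if "0 < \<tau>" for \<tau>
    using that c_pos[of \<tau>] C(1) p0 by (simp add: \<eta>_def powr_powr)
  have \<eta>_lim: "(\<eta> \<longlongrightarrow> 0) (at_right 0)" if p1: "1 < p"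
  proof -
    have "((\<lambda>\<tau>. (\<tau> powr (p - 1) * (\<gamma> powr p * (3 * C) powr p)) powr (1 / p)) \<longlongrightarrow> (0 powr (p - 1) * (\<gamma> powr p * (3 * C) powr p)) powr (1 / p)) (at_right 0)"
      using p1 eventually_nonneg_at_right
      by (intro tendsto_powr' tendsto_mult tendsto_const tendsto_ident_at) (auto elim: eventually_mono)
    then have "((\<lambda>\<tau>. (\<tau> powr (p - 1) * (\<gamma> powr p * (3 * C) powr p)) powr (1 / p)) \<longlongrightarrow> 0) (at_right 0)"
      using p1 by simp
    moreover have "\<forall>\<^sub>F \<tau> in at_right 0. (\<tau> powr (p - 1) * (\<gamma> powr p * (3 * C) powr p)) powr (1 / p) = \<eta> \<tau>"
      using eventually_at_right_real[OF \<alpha>] by eventually_elim (simp add: \<eta>_def c_def)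
    ultimately show ?thesis by (rule Lim_transform_eventually)
  qed
  have main: "(\<forall>t\<in>{0..\<tau>}. conv_pre T (Dir lam) v t \<in> D \<and> extrap_conv T At lam (Dir lam) v t \<in> DAt) \<and>
      strongly_measurable_on {0..\<tau>} (\<lambda>t. Gam (extrap_conv T At lam (Dir lam) v t)) \<and>
      (\<integral>\<^sup>+ t\<in>{0..\<tau>}. ennreal (norm (Gam (extrap_conv T At lam (Dir lam) v t)) powr p) \<partial>lborel)
        \<le> ennreal (\<eta> \<tau> powr p) * (\<integral>\<^sup>+ t\<in>{0..\<tau>}. ennreal (norm (v t) powr p) \<partial>lborel)"
    if \<tau>: "0 < \<tau>" and v: "W1p0_pos p \<tau> v" and lam: "lam \<in> resolvent_set D At" for \<tau> v lam
  proof -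
    let ?inv = "inv_into D (\<lambda>x. lam *\<^sub>R x - At x)"
    have bij: "bij_betw (\<lambda>x. lam *\<^sub>R x - At x) D UNIV" and "bounded_linear ?inv"
      using lam unfolding resolvent_set_def by auto
    then have Rm: "is_resolvent lam ?inv"
      unfolding is_resolvent_def
      using bij_betwE[OF bij_betw_inv_into[OF bij]] bij_betw_inv_into_right[OF bij] bij_betw_inv_into_left[OF bij]
      by blast
    have vc: "continuous_on {0..\<tau>} v" and v_AE: "AE t in lborel. t \<in> {0<..<\<tau>} \<longrightarrow> 0 \<le> v t"
      using v unfolding W1p0_pos_def by blast+
    \<comment> \<open>Positivity is given almost everywhere but is needed for every
      \<open>s\<close>, since admissibility is applied pointwise to elements built from
      \<open>v s\<close>; continuity of \<open>v\<close> closes the gap.\<close>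
    have v_pos: "0 \<le> v t" if "t \<in> {0..\<tau>}" for t
      using continuous_AE_closed[OF vc \<tau> closed_positive_cone[OF BL_V] _ that] v_AE by simp
    obtain F where F: "0 \<le> F" "\<And>v h. 0 < h \<Longrightarrow> h < min 1 (1 / L) \<Longrightarrow>
        norm (T h (Dir lam v) - Dir lam v) \<le> h * (F * norm v)"
    proof (rule Dir_Favard[OF L(3,4) _ Rm])
      show "norm (l *\<^sub>R Dir l v) \<le> C * norm v" if "L \<le> l" for l v using C(2) that by simp
    qed (rule that)
    obtain g where g: "C1_approximable_primitive \<tau> g v"
      by (rule W1p0_pos_C1_approx[OF v p_ge \<tau>]) (rule that)
    have h0: "0 < min 1 (1 / L)" using L(3) by simp
    obtain W where Wc: "continuous_on {0..\<tau>} W" "continuous_on {0..\<tau>} (\<lambda>t. At (W t))"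
      and W: "\<And>t. t \<in> {0..\<tau>} \<Longrightarrow> W t \<in> D" and y: "\<And>t. t \<in> {0..\<tau>} \<Longrightarrow> conv (\<lambda>s. Dir lam (v s)) t \<in> D"
      and z: "\<And>t. t \<in> {0..\<tau>} \<Longrightarrow>
        lam *\<^sub>R conv (\<lambda>s. Dir lam (v s)) t - At (conv (\<lambda>s. Dir lam (v s)) t) = Dir lam (v t) + W t"
      by (rule conv_Dir_regular[OF Rm \<tau> F(1) h0 F(2) vc g]) (assumption+, rule that)
    have pre: "conv_pre T (Dir lam) v t = conv (\<lambda>s. Dir lam (v s)) t" for t
      by (simp add: conv_pre_def conv_def)
    have ext: "extrap_conv T At lam (Dir lam) v t = Dir lam (v t) + W t" if "t \<in> {0..\<tau>}" for t
      using z[OF that] by (simp add: extrap_conv_def pre)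
    have zA: "Dir lam (v t) + W t \<in> DAt" if "t \<in> {0..\<tau>}" for t
      using Dir(1)[OF Rm] W[OF that] by (simp add: DAt_add)
    have zc: "continuous_on {0..\<tau>} (\<lambda>t. Dir lam (v t) + W t)"
      by (intro continuous_on_add Dir_continuous_on[OF Rm] vc Wc)
    have "continuous_on {0..\<tau>} (\<lambda>t. lam *\<^sub>R Dir lam (v t) + At (W t))"
      by (intro continuous_on_add continuous_on_scaleR continuous_on_const Dir_continuous_on[OF Rm] vc Wc)
    then have Azc: "continuous_on {0..\<tau>} (\<lambda>t. At (Dir lam (v t) + W t))"
      by (rule continuous_on_eq) (use Dir[OF Rm] W in \<open>simp add: At_add\<close>)
    have "continuous_on {0..\<tau>} (\<lambda>t. Gam (Dir lam (v t) + W t))"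
      unfolding continuous_on_def
    proof
      fix t assume t: "t \<in> {0..\<tau>}"
      show "((\<lambda>t. Gam (Dir lam (v t) + W t)) \<longlongrightarrow> Gam (Dir lam (v t) + W t)) (at t within {0..\<tau>})"
      proof (rule graph_bounded_tendsto[OF Gam_bounded _ zA[OF t]])
        show "\<forall>\<^sub>F s in at t within {0..\<tau>}. Dir lam (v s) + W s \<in> DAt"
          unfolding eventually_at_filter by (rule always_eventually) (use zA in blast)
      qed (use zc Azc t in \<open>auto simp: continuous_on_def\<close>)
    qed
    then have "continuous_on {0..\<tau>} (\<lambda>t. Gam (extrap_conv T At lam (Dir lam) v t))"
      by (rule continuous_on_eq) (simp add: ext)
    then have meas: "strongly_measurable_on {0..\<tau>} (\<lambda>t. Gam (extrap_conv T At lam (Dir lam) v t))"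
      by (rule strongly_measurable_on_continuous)
    have adm': "(\<integral>\<^sup>+t\<in>{0..\<tau>}. ennreal (norm (Gam (T t ((2 * real n) *\<^sub>R (Dir (real n) (v s) - Dir (real (2 * n)) (v s))))) powr p) \<partial>lborel)
        \<le> ennreal (c \<tau> * norm ((2 * real n) *\<^sub>R (Dir (real n) (v s) - Dir (real (2 * n)) (v s))) powr p)"
      if n: "N0 \<le> n" and s: "s \<in> {0..\<tau>}" for n s
    proof -
      have n2: "N0 \<le> 2 * n" using n by simp
      note Rn = R[OF N0_le(2)[OF n]] and R2 = R[OF N0_le(2)[OF n2]]
      have "Dir (real n) (v s) - Dir (real (2 * n)) (v s) = real n *\<^sub>R R (2 * n) (Dir (real n) (v s))"
        using Dir_diff[OF R2 Rn, of "v s"] by simp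
      moreover have "0 \<le> Dir (real n) (v s)" by (rule l1[OF _ v_pos[OF s]]) (use N0_le(1)[OF n] L(2) in simp)
      then have "R (2 * n) (Dir (real n) (v s)) \<in> ?cone"
        by (intro resolvent_in_cone[OF N0_le(2)[OF n2] R2 cone]) (auto simp: T_pos scaleR_nonneg_nonneg)
      ultimately have "0 \<le> (2 * real n) *\<^sub>R (Dir (real n) (v s) - Dir (real (2 * n)) (v s))"
        by (simp add: scaleR_nonneg_nonneg)
      moreover have "(2 * real n) *\<^sub>R (Dir (real n) (v s) - Dir (real (2 * n)) (v s)) \<in> D"
        using D_scaleR[OF Dir_diff_in_D(1)[OF R2 Rn]] by blast
      ultimately have "(2 * real n) *\<^sub>R (Dir (real n) (v s) - Dir (real (2 * n)) (v s)) \<in> P" by (simp add: P_def)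
      then show ?thesis using c[of \<tau>] unfolding adm_const_def by blast
    qed
    have "(\<integral>\<^sup>+t\<in>{0..\<tau>}. ennreal (norm (Gam (Dir lam (v t) + W t)) powr p) \<partial>lborel)
        \<le> ennreal (\<eta> \<tau> powr p) * (\<integral>\<^sup>+ t\<in>{0..\<tau>}. ennreal (norm (v t) powr p) \<partial>lborel)"
      unfolding \<eta>_powr[OF \<tau>]
    proof (rule Gam_extrapolated_conv_Lp_bound[OF _ _ R_bound Rm p_ge \<tau> vc _ _ adm' _ y W z])
      show "is_resolvent (real n) (R n)" if "N0 \<le> n" for n using R[OF N0_le(2)[OF that]] .
      show "0 < N0" using N0_le(1)[of N0] L(3) by (cases N0) auto
      show "norm (real n *\<^sub>R Dir (real n) v) \<le> C * norm v" if "N0 \<le> n" for n v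
        using C(2)[of "real n" v] N0_le(1)[OF that] by simp
      show "((\<lambda>l. u (Gam (Dir l v))) \<longlongrightarrow> 0) at_top" if "bounded_linear u" for v and u :: "'v \<Rightarrow> real"
        using A2_iv that by blast
    qed (use C(1) c_pos[of \<tau>] in auto)
    moreover have "(\<integral>\<^sup>+ t\<in>{0..\<tau>}. ennreal (norm (Gam (extrap_conv T At lam (Dir lam) v t)) powr p) \<partial>lborel)
        = (\<integral>\<^sup>+t\<in>{0..\<tau>}. ennreal (norm (Gam (Dir lam (v t) + W t)) powr p) \<partial>lborel)"
      by (rule nn_integral_cong) (auto simp: ext indicator_def)
    ultimately show ?thesis using meas y zA by (simp add: pre ext)
  qed
  show ?thesis
    by (intro exI[of _ \<eta>] conjI allI impI ballI) (use main \<eta>_pos \<eta>_lim in blast)+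
qed

end
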